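(* Let $(R,\mathfrak{m},F)$ be a commutative local ring. (1) For any inner product space $V$ over $R$ there is an isometry $$V\cong\langle u_1\rangle\perp\dots\perp\langle u_l\rangle\perp N_1\perp\dots\perp N_r$$ for some (integers $l,r\geq 0$,) $u_i\in R^*$ and $N_i=\left\langle\begin{pmatrix}a_i&1\\1&b_i\end{pmatrix}\right\rangle$ with $a_i,b_i\in\mathfrak{m}$. (2) For any $a,b\in\mathfrak{m}$ there is an isometry of inner product spaces $$\left\langle\begin{pmatrix}a&1\\1&b\end{pmatrix}\right\rangle\perp\langle -1\rangle\;\cong\;\left\langle\frac{1-ab}{(-1+a)(-1+b)}\right\rangle\perp\langle -1+a\rangle\perp\langle -1+b\rangle.$$ (3) For any inner product space $V$ over $R$, there is an inner product space $W$ over $R$ which has an orthogonal basis and such that $V\perp W$ has an orthogonal basis. In particular, the Grothendieck-Witt group $GW(R)$ of inner product spaces is additively generated by the (classes of the) one-dimensional spaces $\langle u\rangle$, $u\in R^*$.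
   Context: An inner product space over a commutative ring $R$ is a finitely generated projective $R$-module $V$ equipped with a non-degenerate symmetric $R$-bilinear form $\mathfrak{b}:V\times V\to R$. When $R$ is local, $V$ is free of some finite rank $n$; an orthogonal basis of $V$ is a basis $v_1,\dots,v_n$ with $\mathfrak{b}(v_i,v_j)=0$ for $i\neq j$. For an invertible symmetric matrix $A\in M_n(R)$, $\langle A\rangle$ denotes the inner product space $R^n$ with form $\mathfrak{b}(x,y)={}^t x A y$; for $u\in R^*$, $\langle u\rangle$ is the rank one case, $\mathfrak{b}(x,y)=uxy$. The symbol $\perp$ denotes orthogonal sum. $GW(R)$ is the Grothendieck group of the abelian monoid of isometry classes of inner product spaces over $R$ under orthogonal sum. *)

theory Defs
  imports "HOL-Algebra.QuotRing" "HOL-Algebra.Module" "HOL-Algebra.Generated_Groups"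
begin

section \<open>Local rings and modules\<close>

locale local_ring = cring R + maximalideal \<mm> R for R (structure) and \<mm> +
  assumes maximalideal_unique: "maximalideal I R \<Longrightarrow> I = \<mm>"

definition mod_hom ::
  "('a, 'm) ring_scheme \<Rightarrow> ('a, 'b, 'k) module_scheme \<Rightarrow> ('a, 'c, 'l) module_scheme \<Rightarrow> ('b \<Rightarrow> 'c) set"
  where "mod_hom R M N =
    {f \<in> carrier M \<rightarrow> carrier N.
       (\<forall>x \<in> carrier M. \<forall>y \<in> carrier M. f (x \<oplus>\<^bsub>M\<^esub> y) = f x \<oplus>\<^bsub>N\<^esub> f y) \<and>
       (\<forall>r \<in> carrier R. \<forall>x \<in> carrier M. f (r \<odot>\<^bsub>M\<^esub> x) = r \<odot>\<^bsub>N\<^esub> f x)}"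

definition finitely_generated :: "('a, 'm) ring_scheme \<Rightarrow> ('a, 'b, 'k) module_scheme \<Rightarrow> bool"
  where "finitely_generated R M \<longleftrightarrow>
    (\<exists>S. finite S \<and> S \<subseteq> carrier M \<and>
      (\<forall>x \<in> carrier M. \<exists>c \<in> S \<rightarrow> carrier R. x = (\<Oplus>\<^bsub>M\<^esub>s\<in>S. c s \<odot>\<^bsub>M\<^esub> s)))"

text \<open>
  Projectivity is the lifting property against surjections \<open>g : M \<rightarrow> N\<close>. A definition cannot
  quantify over carrier types, so \<open>M\<close> and \<open>N\<close> range over modules carried by the types
  \<open>'b \<Rightarrow> 'a\<close> and \<open>'b\<close>. This is no restriction: \<open>N\<close> may be \<open>P\<close> itself and \<open>M\<close> the free module
  of finitely supported functions on the carrier of \<open>P\<close>, so \<open>P\<close> is a direct summand of a free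
  module and therefore lifts against all surjections.
\<close>

definition projective :: "('a, 'm) ring_scheme \<Rightarrow> ('a, 'b, 'k) module_scheme \<Rightarrow> bool"
  where "projective R P \<longleftrightarrow>
    (\<forall>(M :: ('a, 'b \<Rightarrow> 'a) module) (N :: ('a, 'b) module) g h.
       module R M \<and> module R N \<and>
       g \<in> mod_hom R M N \<and> g ` carrier M = carrier N \<and> h \<in> mod_hom R P N \<longrightarrow>
       (\<exists>k \<in> mod_hom R P M. \<forall>x \<in> carrier P. g (k x) = h x))"

definition linear_dual :: "('a, 'm) ring_scheme \<Rightarrow> ('a, 'b, 'k) module_scheme \<Rightarrow> ('b \<Rightarrow> 'a) set"
  where "linear_dual R M =
    {\<phi> \<in> carrier M \<rightarrow>\<^sub>E carrier R.
       (\<forall>x \<in> carrier M. \<forall>y \<in> carrier M. \<phi> (x \<oplus>\<^bsub>M\<^esub> y) = \<phi> x \<oplus>\<^bsub>R\<^esub> \<phi> y) \<and>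
       (\<forall>r \<in> carrier R. \<forall>x \<in> carrier M. \<phi> (r \<odot>\<^bsub>M\<^esub> x) = r \<otimes>\<^bsub>R\<^esub> \<phi> x)}"

definition is_basis ::
  "('a, 'm) ring_scheme \<Rightarrow> ('a, 'b, 'k) module_scheme \<Rightarrow> nat \<Rightarrow> (nat \<Rightarrow> 'b) \<Rightarrow> bool"
  where "is_basis R M n v \<longleftrightarrow>
    v \<in> {..<n} \<rightarrow> carrier M \<and>
    (\<forall>x \<in> carrier M. \<exists>!c. c \<in> {..<n} \<rightarrow>\<^sub>E carrier R \<and> x = (\<Oplus>\<^bsub>M\<^esub>i\<in>{..<n}. c i \<odot>\<^bsub>M\<^esub> v i))"


section \<open>Inner product spaces\<close>

record ('a, 'b) ips = "('a, 'b) module" +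
  form :: "'b \<Rightarrow> 'b \<Rightarrow> 'a"

text \<open>
  Over a ring, non-degenerate means that the adjoint map \<open>x \<mapsto> \<bb>(x, _)\<close> from \<open>V\<close> to its dual is
  bijective, not merely injective. Functionals are extensional (\<open>undefined\<close> off the carrier).
\<close>

locale inner_product_space = module R V for R (structure) and V :: "('a, 'b) ips" (structure) +
  assumes fin_gen: "finitely_generated R V"
    and proj: "projective R V"
    and form_closed: "\<lbrakk>x \<in> carrier V; y \<in> carrier V\<rbrakk> \<Longrightarrow> form V x y \<in> carrier R"
    and form_add: "\<lbrakk>x \<in> carrier V; y \<in> carrier V; z \<in> carrier V\<rbrakk> \<Longrightarrow>
      form V (x \<oplus>\<^bsub>V\<^esub> y) z = form V x z \<oplus> form V y z"
    and form_smult: "\<lbrakk>r \<in> carrier R; x \<in> carrier V; y \<in> carrier V\<rbrakk> \<Longrightarrow>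
      form V (r \<odot>\<^bsub>V\<^esub> x) y = r \<otimes> form V x y"
    and form_sym: "\<lbrakk>x \<in> carrier V; y \<in> carrier V\<rbrakk> \<Longrightarrow> form V x y = form V y x"
    and nondegenerate:
      "bij_betw (\<lambda>x. \<lambda>y\<in>carrier V. form V x y) (carrier V) (linear_dual R V)"

definition isometric :: "('a, 'm) ring_scheme \<Rightarrow> ('a, 'b) ips \<Rightarrow> ('a, 'c) ips \<Rightarrow> bool"
  where "isometric R V W \<longleftrightarrow>
    inner_product_space R V \<and> inner_product_space R W \<and>
    (\<exists>f \<in> mod_hom R V W. bij_betw f (carrier V) (carrier W) \<and>
      (\<forall>x \<in> carrier V. \<forall>y \<in> carrier V. form W (f x) (f y) = form V x y))"

definition has_orthogonal_basis :: "('a, 'm) ring_scheme \<Rightarrow> ('a, 'b) ips \<Rightarrow> bool"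
  where "has_orthogonal_basis R V \<longleftrightarrow>
    (\<exists>n v. is_basis R V n v \<and>
      (\<forall>i<n. \<forall>j<n. i \<noteq> j \<longrightarrow> form V (v i) (v j) = \<zero>\<^bsub>R\<^esub>))"

text \<open>
  In the constructions below the fields \<open>mult\<close> and \<open>one\<close>, which the library's module record
  inherits from rings, are irrelevant. Coordinates are numbered from \<open>0\<close>, and elements of
  \<open>R\<^sup>n\<close> are extensional functions on \<open>{..<n}\<close>.
\<close>

definition matrix_space :: "('a, 'm) ring_scheme \<Rightarrow> nat \<Rightarrow> (nat \<Rightarrow> nat \<Rightarrow> 'a) \<Rightarrow> ('a, nat \<Rightarrow> 'a) ips"
  where "matrix_space R n A =
    \<lparr>carrier = {..<n} \<rightarrow>\<^sub>E carrier R,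
     mult = undefined,
     one = undefined,
     zero = (\<lambda>i\<in>{..<n}. \<zero>\<^bsub>R\<^esub>),
     add = (\<lambda>x y. \<lambda>i\<in>{..<n}. x i \<oplus>\<^bsub>R\<^esub> y i),
     smult = (\<lambda>r x. \<lambda>i\<in>{..<n}. r \<otimes>\<^bsub>R\<^esub> x i),
     form = (\<lambda>x y. \<Oplus>\<^bsub>R\<^esub>i\<in>{..<n}. \<Oplus>\<^bsub>R\<^esub>j\<in>{..<n}. x i \<otimes>\<^bsub>R\<^esub> A i j \<otimes>\<^bsub>R\<^esub> y j)\<rparr>"

definition mat2 :: "'a \<Rightarrow> 'a \<Rightarrow> 'a \<Rightarrow> 'a \<Rightarrow> nat \<Rightarrow> nat \<Rightarrow> 'a"
  where "mat2 a b c d i j = (if i = 0 then if j = 0 then a else b else if j = 0 then c else d)"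

definition rank_one_space :: "('a, 'm) ring_scheme \<Rightarrow> 'a \<Rightarrow> ('a, nat \<Rightarrow> 'a) ips"
  where "rank_one_space R u = matrix_space R 1 (\<lambda>_ _. u)"

definition rank_two_space :: "('a, 'm) ring_scheme \<Rightarrow> 'a \<Rightarrow> 'a \<Rightarrow> ('a, nat \<Rightarrow> 'a) ips"
  where "rank_two_space R a b = matrix_space R 2 (mat2 a \<one>\<^bsub>R\<^esub> \<one>\<^bsub>R\<^esub> b)"

definition orth_sum :: "('a, 'm) ring_scheme \<Rightarrow> ('a, 'b) ips \<Rightarrow> ('a, 'c) ips \<Rightarrow> ('a, 'b \<times> 'c) ips"
  where "orth_sum R V W =
    \<lparr>carrier = carrier V \<times> carrier W,
     mult = undefined,
     one = undefined,
     zero = (\<zero>\<^bsub>V\<^esub>, \<zero>\<^bsub>W\<^esub>),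
     add = (\<lambda>(x, y) (x', y'). (x \<oplus>\<^bsub>V\<^esub> x', y \<oplus>\<^bsub>W\<^esub> y')),
     smult = (\<lambda>r (x, y). (r \<odot>\<^bsub>V\<^esub> x, r \<odot>\<^bsub>W\<^esub> y)),
     form = (\<lambda>(x, y) (x', y'). form V x x' \<oplus>\<^bsub>R\<^esub> form W y y')\<rparr>"

text \<open>The orthogonal sum of \<open>V 0, \<dots>, V (k - 1)\<close>; it is the zero space for \<open>k = 0\<close>.\<close>

definition orth_sum_family :: "('a, 'm) ring_scheme \<Rightarrow> nat \<Rightarrow> (nat \<Rightarrow> ('a, 'b) ips) \<Rightarrow> ('a, nat \<Rightarrow> 'b) ips"
  where "orth_sum_family R k V =
    \<lparr>carrier = (\<Pi>\<^sub>E i\<in>{..<k}. carrier (V i)),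
     mult = undefined,
     one = undefined,
     zero = (\<lambda>i\<in>{..<k}. \<zero>\<^bsub>V i\<^esub>),
     add = (\<lambda>x y. \<lambda>i\<in>{..<k}. x i \<oplus>\<^bsub>V i\<^esub> y i),
     smult = (\<lambda>r x. \<lambda>i\<in>{..<k}. r \<odot>\<^bsub>V i\<^esub> x i),
     form = (\<lambda>x y. \<Oplus>\<^bsub>R\<^esub>i\<in>{..<k}. form (V i) (x i) (y i))\<rparr>"


section \<open>The Grothendieck-Witt group\<close>

text \<open>
  The Grothendieck group of a commutative monoid, both written multiplicatively as in the
  library: the class of \<open>(a, b)\<close> is the formal difference of \<open>a\<close> and \<open>b\<close>.
\<close>

definition grothendieck_rel :: "('a, 'k) monoid_scheme \<Rightarrow> (('a \<times> 'a) \<times> ('a \<times> 'a)) set"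
  where "grothendieck_rel M =
    {((a, b), (c, d)). a \<in> carrier M \<and> b \<in> carrier M \<and> c \<in> carrier M \<and> d \<in> carrier M \<and>
       (\<exists>e \<in> carrier M. a \<otimes>\<^bsub>M\<^esub> d \<otimes>\<^bsub>M\<^esub> e = c \<otimes>\<^bsub>M\<^esub> b \<otimes>\<^bsub>M\<^esub> e)}"

definition grothendieck_group :: "('a, 'k) monoid_scheme \<Rightarrow> ('a \<times> 'a) set monoid"
  where "grothendieck_group M =
    \<lparr>carrier = (carrier M \<times> carrier M) // grothendieck_rel M,
     mult = (\<lambda>X Y. \<Union>(a, b)\<in>X. \<Union>(c, d)\<in>Y. grothendieck_rel M `` {(a \<otimes>\<^bsub>M\<^esub> c, b \<otimes>\<^bsub>M\<^esub> d)}),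
     one = grothendieck_rel M `` {(\<one>\<^bsub>M\<^esub>, \<one>\<^bsub>M\<^esub>)}\<rparr>"

definition grothendieck_class :: "('a, 'k) monoid_scheme \<Rightarrow> 'a \<Rightarrow> ('a \<times> 'a) set"
  where "grothendieck_class M a = grothendieck_rel M `` {(a, \<one>\<^bsub>M\<^esub>)}"

text \<open>
  An isometry class is taken within the inner product spaces carried by the type
  \<open>nat \<Rightarrow> 'a\<close>. A finitely generated projective module is isomorphic to a submodule of some
  \<open>R\<^sup>n\<close>, so every inner product space, of whatever carrier type, is isometric to one of these.
\<close>

definition isometry_class :: "('a, 'm) ring_scheme \<Rightarrow> ('a, 'b) ips \<Rightarrow> ('a, nat \<Rightarrow> 'a) ips set"
  where "isometry_class R V = {X. isometric R V X}"

definition isometry_class_monoid :: "('a, 'm) ring_scheme \<Rightarrow> ('a, nat \<Rightarrow> 'a) ips set monoid"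
  where "isometry_class_monoid R =
    \<lparr>carrier = {isometry_class R V |V :: ('a, nat \<Rightarrow> 'a) ips. inner_product_space R V},
     mult = (\<lambda>A B. \<Union>V\<in>A. \<Union>W\<in>B. isometry_class R (orth_sum R V W)),
     one = isometry_class R (matrix_space R 0 (\<lambda>_ _. \<zero>\<^bsub>R\<^esub>))\<rparr>"

definition GW :: "('a, 'm) ring_scheme \<Rightarrow> (('a, nat \<Rightarrow> 'a) ips set \<times> ('a, nat \<Rightarrow> 'a) ips set) set monoid"
  where "GW R = grothendieck_group (isometry_class_monoid R)"

definition GW_class ::
  "('a, 'm) ring_scheme \<Rightarrow> ('a, 'b) ips \<Rightarrow> (('a, nat \<Rightarrow> 'a) ips set \<times> ('a, nat \<Rightarrow> 'a) ips set) set"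
  where "GW_class R V = grothendieck_class (isometry_class_monoid R) (isometry_class R V)"

end

(*
A bilinear symmetric form on a module is an inner product space if and only if there are finitely
many vectors u_i, w_i with x = sum_i b(w_i, x) u_i for all x (a "dual family"). When a non-degenerate
subspace is split off, projecting such a family to the orthogonal complement gives a dual family
there, in which the u_i that lay in the subspace can be dropped.

Over a local ring, induct on the number of indices. If some b(u_i, u_i) is a unit, split off the line
spanned by u_i; if only some b(u_i, u_j) with i different from j is a unit, split off the plane
spanned by u_i and u_j. If all b(u_i, u_j) lie in the maximal ideal, then so does every b(w_i, u_i),
and u_i can be eliminated as in Nakayama's lemma.

A plane becomes diagonal after adding <-1>, by an explicit change of basis. The rest is a
computation in the commutative monoid of isometry classes: the classes that become diagonal after
adding a diagonal class are closed under orthogonal sums, hence exhaust the monoid.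
*)

theory Submission
  imports Defs
begin

section \<open>Module homomorphisms\<close>

text \<open>Freeness of modules over a local ring is never invoked. Projectivity quantifies over
  modules and non-degeneracy over functionals, so neither passes easily to complements, sums and
  isometric images. A dual family is a finite system of equations that is pushed along the map at
  hand, and both properties are then read off from it. Planes cannot be avoided: if 2 lies in
  \<open>\<mm>\<close>, then for \<open>a\<close>, \<open>b\<close> in \<open>\<mm>\<close> all
  norms a x^2 + 2 x y + b y^2 of a block lie in \<open>\<mm>\<close>, so no line with unit norm can
  be split off. Adding <-1> supplies a vector of unit norm, and the value -1 is the one that cancels
  the off-diagonal entry 1 of the block. Orthogonal sums change the carrier type, and associativity
  and commutativity hold only up to isometry. Isometry classes taken on one fixed type turn these
  isometries into equations. Nothing is lost, because every inner product space has an isometric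
  copy on that type and equality of classes gives back an isometry.\<close>

lemma mod_homI:
  assumes "\<And>x. x \<in> carrier M \<Longrightarrow> f x \<in> carrier N"
    and "\<And>x y. \<lbrakk>x \<in> carrier M; y \<in> carrier M\<rbrakk> \<Longrightarrow> f (x \<oplus>\<^bsub>M\<^esub> y) = f x \<oplus>\<^bsub>N\<^esub> f y"
    and "\<And>r x. \<lbrakk>r \<in> carrier R; x \<in> carrier M\<rbrakk> \<Longrightarrow> f (r \<odot>\<^bsub>M\<^esub> x) = r \<odot>\<^bsub>N\<^esub> f x"
  shows "f \<in> mod_hom R M N"
  using assms by (simp add: mod_hom_def)

lemma mod_hom_closed: "\<lbrakk>f \<in> mod_hom R M N; x \<in> carrier M\<rbrakk> \<Longrightarrow> f x \<in> carrier N"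
  by (auto simp: mod_hom_def)

lemma mod_hom_add:
  "\<lbrakk>f \<in> mod_hom R M N; x \<in> carrier M; y \<in> carrier M\<rbrakk> \<Longrightarrow> f (x \<oplus>\<^bsub>M\<^esub> y) = f x \<oplus>\<^bsub>N\<^esub> f y"
  by (simp add: mod_hom_def)

lemma mod_hom_smult:
  "\<lbrakk>f \<in> mod_hom R M N; r \<in> carrier R; x \<in> carrier M\<rbrakk> \<Longrightarrow> f (r \<odot>\<^bsub>M\<^esub> x) = r \<odot>\<^bsub>N\<^esub> f x"
  by (simp add: mod_hom_def)

lemma mod_hom_comp: "\<lbrakk>f \<in> mod_hom R M N; g \<in> mod_hom R N P\<rbrakk> \<Longrightarrow> g \<circ> f \<in> mod_hom R M P"
  by (rule mod_homI) (simp_all add: mod_hom_closed mod_hom_add mod_hom_smult)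

text \<open>Preservation of zero is not a clause of \<open>mod_hom\<close>; it follows from
  homogeneity by writing zero as 0 times zero.\<close>

lemma mod_hom_zero:
  assumes "module R M" "module R N" "f \<in> mod_hom R M N"
  shows "f \<zero>\<^bsub>M\<^esub> = \<zero>\<^bsub>N\<^esub>"
proof -
  interpret M: module R M by fact
  interpret N: module R N by fact
  have "f \<zero>\<^bsub>M\<^esub> = f (\<zero>\<^bsub>R\<^esub> \<odot>\<^bsub>M\<^esub> \<zero>\<^bsub>M\<^esub>)" by simp
  also have "\<dots> = \<zero>\<^bsub>R\<^esub> \<odot>\<^bsub>N\<^esub> f \<zero>\<^bsub>M\<^esub>" by (rule mod_hom_smult[OF assms(3)]) auto
  also have "\<dots> = \<zero>\<^bsub>N\<^esub>" using mod_hom_closed[OF assms(3)] by simp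
  finally show ?thesis .
qed

lemma (in module) lincomb_closed:
  assumes "c \<in> I \<rightarrow> carrier R" "v \<in> I \<rightarrow> carrier M"
  shows "(\<Oplus>\<^bsub>M\<^esub>i\<in>I. c i \<odot>\<^bsub>M\<^esub> v i) \<in> carrier M"
  using assms by (intro M.finsum_closed) (auto simp: Pi_def)

lemma mod_hom_lincomb:
  assumes "module R M" "module R N" "f \<in> mod_hom R M N"
    and "finite I" "c \<in> I \<rightarrow> carrier R" "v \<in> I \<rightarrow> carrier M"
  shows "f (\<Oplus>\<^bsub>M\<^esub>i\<in>I. c i \<odot>\<^bsub>M\<^esub> v i) = (\<Oplus>\<^bsub>N\<^esub>i\<in>I. c i \<odot>\<^bsub>N\<^esub> f (v i))"
proof -
  interpret M: module R M by fact
  interpret N: module R N by fact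
  show ?thesis
    using assms(4-6)
  proof (induction I)
    case empty
    show ?case using mod_hom_zero[OF assms(1-3)] by simp
  next
    case (insert i I)
    have [simp]: "(\<Oplus>\<^bsub>M\<^esub>i\<in>I. c i \<odot>\<^bsub>M\<^esub> v i) \<in> carrier M"
      using insert.prems by (intro M.lincomb_closed) auto
    have "f (\<Oplus>\<^bsub>M\<^esub>i\<in>insert i I. c i \<odot>\<^bsub>M\<^esub> v i) = f (c i \<odot>\<^bsub>M\<^esub> v i \<oplus>\<^bsub>M\<^esub> (\<Oplus>\<^bsub>M\<^esub>i\<in>I. c i \<odot>\<^bsub>M\<^esub> v i))"
      using insert.prems insert.hyps by (subst M.finsum_insert) (auto simp: Pi_def)
    also have "\<dots> = c i \<odot>\<^bsub>N\<^esub> f (v i) \<oplus>\<^bsub>N\<^esub> (\<Oplus>\<^bsub>N\<^esub>i\<in>I. c i \<odot>\<^bsub>N\<^esub> f (v i))"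
      using insert by (auto simp: mod_hom_add[OF assms(3)] mod_hom_smult[OF assms(3)])
    also have "\<dots> = (\<Oplus>\<^bsub>N\<^esub>i\<in>insert i I. c i \<odot>\<^bsub>N\<^esub> f (v i))"
      using insert.prems insert.hyps
      by (subst N.finsum_insert) (auto simp: Pi_def mod_hom_closed[OF assms(3)])
    finally show ?case .
  qed
qed

text \<open>Every element of \<open>N\<close> is an image, so each module axiom of \<open>N\<close>
  is pulled back to \<open>M\<close>. Preservation of zero is a hypothesis because
  \<open>mod_hom_zero\<close> would already need \<open>N\<close> to be a module.\<close>

lemma module_transfer:
  assumes "module R M" "f ` carrier M = carrier N"
    and add: "\<And>x y. \<lbrakk>x \<in> carrier M; y \<in> carrier M\<rbrakk> \<Longrightarrow> f (x \<oplus>\<^bsub>M\<^esub> y) = f x \<oplus>\<^bsub>N\<^esub> f y"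
    and smult: "\<And>r x. \<lbrakk>r \<in> carrier R; x \<in> carrier M\<rbrakk> \<Longrightarrow> f (r \<odot>\<^bsub>M\<^esub> x) = r \<odot>\<^bsub>N\<^esub> f x"
    and zero: "f \<zero>\<^bsub>M\<^esub> = \<zero>\<^bsub>N\<^esub>"
  shows "module R N"
proof -
  interpret M: module R M by fact
  have E: "\<exists>x'\<in>carrier M. x = f x'" if "x \<in> carrier N" for x using assms(2) that by auto
  have C: "f x \<in> carrier N" if "x \<in> carrier M" for x using assms(2) that by auto
  note add' = add[symmetric] and smult' = smult[symmetric] and zero' = zero[symmetric]
  show ?thesis
  proof (intro moduleI abelian_groupI)
    show "cring R" ..
    show "\<exists>y\<in>carrier N. y \<oplus>\<^bsub>N\<^esub> x = \<zero>\<^bsub>N\<^esub>" if "x \<in> carrier N" for x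
    proof -
      from E[OF that] obtain x' where x': "x' \<in> carrier M" "x = f x'" by auto
      show ?thesis
        by (rule bexI[of _ "f (\<ominus>\<^bsub>M\<^esub> x')"]) (auto simp: x' add' zero' M.l_neg C)
    qed
  qed (auto dest!: E simp: add' smult' zero' C M.a_ac M.smult_l_distr M.smult_r_distr M.smult_assoc1)
qed

text \<open>For \<open>S\<close> a set of vectors of type \<open>'b\<close> the carrier has type
  \<open>'b \<Rightarrow> 'a\<close>, which is the type that \<open>projective\<close> admits for
  the source of a surjection.\<close>

definition free_module :: "('a, 'm) ring_scheme \<Rightarrow> 'i set \<Rightarrow> ('a, 'i \<Rightarrow> 'a) module"
  where "free_module R S =
    \<lparr>carrier = S \<rightarrow>\<^sub>E carrier R, mult = undefined, one = undefined,
     zero = (\<lambda>i\<in>S. \<zero>\<^bsub>R\<^esub>),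
     add = (\<lambda>x y. \<lambda>i\<in>S. x i \<oplus>\<^bsub>R\<^esub> y i),
     smult = (\<lambda>r x. \<lambda>i\<in>S. r \<otimes>\<^bsub>R\<^esub> x i)\<rparr>"

lemma free_module_module:
  fixes R (structure)
  assumes "cring R"
  shows "module R (free_module R S)"
proof -
  interpret cring R by fact
  have C: "x i \<in> carrier R" if "x \<in> carrier (free_module R S)" "i \<in> S" for x i
    using that by (auto simp: free_module_def)
  have E: "x = y" if "x \<in> carrier (free_module R S)" "y \<in> carrier (free_module R S)"
    "\<And>i. i \<in> S \<Longrightarrow> x i = y i" for x y
    using that unfolding free_module_def by (auto intro: PiE_ext)
  have cl: "\<zero>\<^bsub>free_module R S\<^esub> \<in> carrier (free_module R S)"
    "\<And>x y. \<lbrakk>x \<in> carrier (free_module R S); y \<in> carrier (free_module R S)\<rbrakk>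
      \<Longrightarrow> x \<oplus>\<^bsub>free_module R S\<^esub> y \<in> carrier (free_module R S)"
    "\<And>r x. \<lbrakk>r \<in> carrier R; x \<in> carrier (free_module R S)\<rbrakk>
      \<Longrightarrow> r \<odot>\<^bsub>free_module R S\<^esub> x \<in> carrier (free_module R S)"
    by (auto simp: free_module_def)
  have ev: "\<And>i. i \<in> S \<Longrightarrow> \<zero>\<^bsub>free_module R S\<^esub> i = \<zero>"
    "\<And>x y i. i \<in> S \<Longrightarrow> (x \<oplus>\<^bsub>free_module R S\<^esub> y) i = x i \<oplus> y i"
    "\<And>r x i. i \<in> S \<Longrightarrow> (r \<odot>\<^bsub>free_module R S\<^esub> x) i = r \<otimes> x i"
    by (auto simp: free_module_def)
  show ?thesis
  proof (intro moduleI abelian_groupI)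
    show "\<exists>y\<in>carrier (free_module R S). y \<oplus>\<^bsub>free_module R S\<^esub> x = \<zero>\<^bsub>free_module R S\<^esub>"
      if x: "x \<in> carrier (free_module R S)" for x
    proof
      show m: "(\<lambda>i\<in>S. \<ominus> x i) \<in> carrier (free_module R S)"
        using C[OF x] by (auto simp: free_module_def)
      show "(\<lambda>i\<in>S. \<ominus> x i) \<oplus>\<^bsub>free_module R S\<^esub> x = \<zero>\<^bsub>free_module R S\<^esub>"
        by (rule E) (simp_all add: cl x m ev C l_neg)
    qed
  qed (rule assms cl E; simp add: cl ev C a_ac l_distr r_distr m_assoc)+
qed


section \<open>Forms and dual families\<close>

text \<open>Only the algebra of a symmetric bilinear form is required, so that complements, sums and
  images can be computed in before they are known to be inner product spaces.\<close>

locale form_space = module R V for R (structure) and V :: "('a, 'b) ips" (structure) +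
  assumes form_closed [simp]: "\<lbrakk>x \<in> carrier V; y \<in> carrier V\<rbrakk> \<Longrightarrow> form V x y \<in> carrier R"
    and form_add_left: "\<lbrakk>x \<in> carrier V; y \<in> carrier V; z \<in> carrier V\<rbrakk> \<Longrightarrow>
      form V (x \<oplus>\<^bsub>V\<^esub> y) z = form V x z \<oplus> form V y z"
    and form_smult_left: "\<lbrakk>r \<in> carrier R; x \<in> carrier V; y \<in> carrier V\<rbrakk> \<Longrightarrow>
      form V (r \<odot>\<^bsub>V\<^esub> x) y = r \<otimes> form V x y"
    and form_sym: "\<lbrakk>x \<in> carrier V; y \<in> carrier V\<rbrakk> \<Longrightarrow> form V x y = form V y x"
begin

lemma form_add_right: "\<lbrakk>x \<in> carrier V; y \<in> carrier V; z \<in> carrier V\<rbrakk> \<Longrightarrow>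
    form V z (x \<oplus>\<^bsub>V\<^esub> y) = form V z x \<oplus> form V z y"
  by (simp add: form_add_left form_sym[of z])

lemma form_smult_right: "\<lbrakk>r \<in> carrier R; x \<in> carrier V; y \<in> carrier V\<rbrakk> \<Longrightarrow>
    form V y (r \<odot>\<^bsub>V\<^esub> x) = r \<otimes> form V y x"
  by (simp add: form_smult_left form_sym[of y])

lemma form_zero_left [simp]: "x \<in> carrier V \<Longrightarrow> form V \<zero>\<^bsub>V\<^esub> x = \<zero>"
  using form_smult_left[of \<zero> "\<zero>\<^bsub>V\<^esub>" x] by simp

lemma form_zero_right [simp]: "x \<in> carrier V \<Longrightarrow> form V x \<zero>\<^bsub>V\<^esub> = \<zero>"
  using form_sym[of x "\<zero>\<^bsub>V\<^esub>"] by simp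

lemma form_minus_left: "\<lbrakk>x \<in> carrier V; y \<in> carrier V\<rbrakk> \<Longrightarrow> form V (\<ominus>\<^bsub>V\<^esub> x) y = \<ominus> form V x y"
  using form_smult_left[of "\<ominus> \<one>" x y] by (simp add: smult_l_minus R.l_minus)

lemma form_lincomb_right:
  assumes "finite I" "c \<in> I \<rightarrow> carrier R" "v \<in> I \<rightarrow> carrier V" "x \<in> carrier V"
  shows "form V x (\<Oplus>\<^bsub>V\<^esub>i\<in>I. c i \<odot>\<^bsub>V\<^esub> v i) = (\<Oplus>i\<in>I. c i \<otimes> form V x (v i))"
  using assms(1-3)
proof (induction I)
  case empty
  then show ?case using assms(4) by simp
next
  case (insert i I)
  have "(\<Oplus>\<^bsub>V\<^esub>i\<in>I. c i \<odot>\<^bsub>V\<^esub> v i) \<in> carrier V"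
    using insert.prems by (intro lincomb_closed) auto
  with insert assms(4) show ?case
    by (simp add: Pi_def form_add_right form_smult_right)
qed

lemma form_lincomb_left:
  assumes "finite I" "c \<in> I \<rightarrow> carrier R" "v \<in> I \<rightarrow> carrier V" "x \<in> carrier V"
  shows "form V (\<Oplus>\<^bsub>V\<^esub>i\<in>I. c i \<odot>\<^bsub>V\<^esub> v i) x = (\<Oplus>i\<in>I. c i \<otimes> form V (v i) x)"
proof -
  have "form V (\<Oplus>\<^bsub>V\<^esub>i\<in>I. c i \<odot>\<^bsub>V\<^esub> v i) x = (\<Oplus>i\<in>I. c i \<otimes> form V x (v i))"
    using assms by (subst form_sym) (auto simp: form_lincomb_right lincomb_closed)
  also have "\<dots> = (\<Oplus>i\<in>I. c i \<otimes> form V (v i) x)"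
    using assms by (intro R.finsum_cong') (auto simp: Pi_def form_sym[of x])
  finally show ?thesis .
qed

end

lemma ips_form_space: "inner_product_space R V \<Longrightarrow> form_space R V"
  unfolding inner_product_space_def inner_product_space_axioms_def form_space_def form_space_axioms_def
  by blast

text \<open>This is a dual basis in the sense of the dual basis criterion for projective modules,
  with the coordinate functionals represented by the vectors \<open>w i\<close>. The
  \<open>u i\<close> may repeat or be dependent. The index type is free, so that families can be
  combined over a disjoint sum.\<close>

definition dual_family ::
  "('a, 'm) ring_scheme \<Rightarrow> ('a, 'b) ips \<Rightarrow> 'i set \<Rightarrow> ('i \<Rightarrow> 'b) \<Rightarrow> ('i \<Rightarrow> 'b) \<Rightarrow> bool"
  where "dual_family R V I u w \<longleftrightarrow>
    finite I \<and> u \<in> I \<rightarrow> carrier V \<and> w \<in> I \<rightarrow> carrier V \<and>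
    (\<forall>x \<in> carrier V. x = (\<Oplus>\<^bsub>V\<^esub>i\<in>I. form V (w i) x \<odot>\<^bsub>V\<^esub> u i))"

text \<open>Bridges two conventions: a dual family is indexed and may repeat vectors, whereas
  \<open>finitely_generated\<close> attaches one coefficient to each vector of a set.\<close>

lemma (in module) lincomb_over_image:
  assumes "finite I" "c \<in> I \<rightarrow> carrier R" "u \<in> I \<rightarrow> carrier M"
  shows "\<exists>d \<in> u ` I \<rightarrow> carrier R.
    (\<Oplus>\<^bsub>M\<^esub>i\<in>I. c i \<odot>\<^bsub>M\<^esub> u i) = (\<Oplus>\<^bsub>M\<^esub>s\<in>u ` I. d s \<odot>\<^bsub>M\<^esub> s)"
  using assms
proof (induction I)
  case empty
  then show ?case by simp
next
  case (insert i I)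
  from insert obtain d where d: "d \<in> u ` I \<rightarrow> carrier R"
    "(\<Oplus>\<^bsub>M\<^esub>i\<in>I. c i \<odot>\<^bsub>M\<^esub> u i) = (\<Oplus>\<^bsub>M\<^esub>s\<in>u ` I. d s \<odot>\<^bsub>M\<^esub> s)" by auto
  have ins: "(\<Oplus>\<^bsub>M\<^esub>i\<in>insert i I. c i \<odot>\<^bsub>M\<^esub> u i) = c i \<odot>\<^bsub>M\<^esub> u i \<oplus>\<^bsub>M\<^esub> (\<Oplus>\<^bsub>M\<^esub>s\<in>u ` I. d s \<odot>\<^bsub>M\<^esub> s)"
    using insert d by (simp add: Pi_def)
  have c: "c i \<in> carrier R" "u i \<in> carrier M" "u ` I \<subseteq> carrier M" using insert by auto
  show ?case
  proof (cases "u i \<in> u ` I")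
    case False
    let ?d = "d(u i := c i)"
    have "(\<Oplus>\<^bsub>M\<^esub>s\<in>insert (u i) (u ` I). ?d s \<odot>\<^bsub>M\<^esub> s) = ?d (u i) \<odot>\<^bsub>M\<^esub> u i \<oplus>\<^bsub>M\<^esub> (\<Oplus>\<^bsub>M\<^esub>s\<in>u ` I. ?d s \<odot>\<^bsub>M\<^esub> s)"
      using insert False d(1) c by (intro M.finsum_insert) (auto simp: Pi_def)
    also have "(\<Oplus>\<^bsub>M\<^esub>s\<in>u ` I. ?d s \<odot>\<^bsub>M\<^esub> s) = (\<Oplus>\<^bsub>M\<^esub>s\<in>u ` I. d s \<odot>\<^bsub>M\<^esub> s)"
    proof (intro M.finsum_cong')
      show "?d s \<odot>\<^bsub>M\<^esub> s = d s \<odot>\<^bsub>M\<^esub> s" if "s \<in> u ` I" for s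
      proof -
        have "s \<noteq> u i" using False that by blast
        then show ?thesis by simp
      qed
    qed (use d(1) c in \<open>auto simp: Pi_def\<close>)
    finally show ?thesis
      using ins d(1) c by (intro bexI[of _ ?d]) (auto simp: Pi_def)
  next
    \<comment> \<open>The vector \<open>u i\<close> already occurs in the image of \<open>I\<close>,
      so \<open>c i\<close> is added to the coefficient that it has there.\<close>
    case True
    let ?d = "d(u i := c i \<oplus> d (u i))"
    let ?J = "u ` I - {u i}"
    have J: "u ` I = insert (u i) ?J" "u ` insert i I = insert (u i) ?J" using True by auto
    have split: "(\<Oplus>\<^bsub>M\<^esub>s\<in>insert (u i) ?J. e s \<odot>\<^bsub>M\<^esub> s) = e (u i) \<odot>\<^bsub>M\<^esub> u i \<oplus>\<^bsub>M\<^esub> (\<Oplus>\<^bsub>M\<^esub>s\<in>?J. e s \<odot>\<^bsub>M\<^esub> s)"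
      if "e \<in> u ` I \<rightarrow> carrier R" for e
      using insert True that c by (intro M.finsum_insert) (auto simp: Pi_def)
    have d': "?d \<in> u ` I \<rightarrow> carrier R" using d(1) c True by (auto simp: Pi_def)
    have eq: "(\<Oplus>\<^bsub>M\<^esub>s\<in>?J. ?d s \<odot>\<^bsub>M\<^esub> s) = (\<Oplus>\<^bsub>M\<^esub>s\<in>?J. d s \<odot>\<^bsub>M\<^esub> s)"
      using d(1) c by (intro M.finsum_cong') (auto simp: Pi_def)
    have cl: "(\<Oplus>\<^bsub>M\<^esub>s\<in>?J. d s \<odot>\<^bsub>M\<^esub> s) \<in> carrier M"
      using d(1) c by (intro M.finsum_closed) (auto simp: Pi_def)
    have di: "d (u i) \<in> carrier R" using d(1) True by auto
    have "(\<Oplus>\<^bsub>M\<^esub>i\<in>insert i I. c i \<odot>\<^bsub>M\<^esub> u i) = c i \<odot>\<^bsub>M\<^esub> u i \<oplus>\<^bsub>M\<^esub> (\<Oplus>\<^bsub>M\<^esub>s\<in>insert (u i) ?J. d s \<odot>\<^bsub>M\<^esub> s)"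
      unfolding J(1)[symmetric] by (rule ins)
    also have "\<dots> = (\<Oplus>\<^bsub>M\<^esub>s\<in>insert (u i) ?J. ?d s \<odot>\<^bsub>M\<^esub> s)"
      unfolding split[OF d'] split[OF d(1)] eq using c cl di
      by (simp add: smult_l_distr M.a_assoc)
    finally have "(\<Oplus>\<^bsub>M\<^esub>i\<in>insert i I. c i \<odot>\<^bsub>M\<^esub> u i) = (\<Oplus>\<^bsub>M\<^esub>s\<in>u ` insert i I. ?d s \<odot>\<^bsub>M\<^esub> s)"
      unfolding J(2) .
    moreover have "?d \<in> u ` insert i I \<rightarrow> carrier R" using d' True by (simp add: insert_absorb)
    ultimately show ?thesis by (rule bexI)
  qed
qed

lemma dual_familyD:
  assumes "dual_family R V I u w"
  shows "finite I" "u \<in> I \<rightarrow> carrier V" "w \<in> I \<rightarrow> carrier V"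
    "\<And>i. i \<in> I \<Longrightarrow> u i \<in> carrier V" "\<And>i. i \<in> I \<Longrightarrow> w i \<in> carrier V"
    "\<And>x. x \<in> carrier V \<Longrightarrow> (\<Oplus>\<^bsub>V\<^esub>i\<in>I. form V (w i) x \<odot>\<^bsub>V\<^esub> u i) = x"
  using assms unfolding dual_family_def by auto

section \<open>Dual families imply finite generation, projectivity and non-degeneracy\<close>

context form_space
begin

lemma dual_family_finitely_generated:
  assumes "dual_family R V I u w"
  shows "finitely_generated R V"
  unfolding finitely_generated_def
proof (intro exI[of _ "u ` I"] conjI ballI)
  note D = dual_familyD[OF assms]
  show "finite (u ` I)" "u ` I \<subseteq> carrier V" using D by auto
  fix x assume x: "x \<in> carrier V"
  show "\<exists>c \<in> u ` I \<rightarrow> carrier R. x = (\<Oplus>\<^bsub>V\<^esub>s\<in>u ` I. c s \<odot>\<^bsub>V\<^esub> s)"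
  proof -
    have "(\<lambda>i. form V (w i) x) \<in> I \<rightarrow> carrier R" using D(5) x by auto
    from lincomb_over_image[OF D(1) this D(2)] show ?thesis unfolding D(6)[OF x] .
  qed
qed

text \<open>The coordinates \<open>form V (w i) x\<close> are linear in \<open>x\<close>. Choosing
  preimages \<open>m i\<close> of \<open>h (u i)\<close> and recombining them with these coordinates
  therefore gives a linear lift, with no well-definedness to check.\<close>

lemma dual_family_projective:
  assumes "dual_family R V I u w"
  shows "projective R V"
  unfolding projective_def
proof (intro allI impI, elim conjE)
  note D = dual_familyD[OF assms]
  fix M :: "('a, 'b \<Rightarrow> 'a) module" and N :: "('a, 'b) module" and g h
  assume M: "module R M" and N: "module R N" and g: "g \<in> mod_hom R M N"
    and surj: "g ` carrier M = carrier N" and h: "h \<in> mod_hom R V N"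
  interpret M: module R M by fact
  have "\<forall>i\<in>I. \<exists>m\<in>carrier M. g m = h (u i)"
    using surj mod_hom_closed[OF h] D(4) by (metis imageE)
  then obtain m where m: "\<And>i. i \<in> I \<Longrightarrow> m i \<in> carrier M" "\<And>i. i \<in> I \<Longrightarrow> g (m i) = h (u i)"
    by metis
  define k where "k x = (\<Oplus>\<^bsub>M\<^esub>i\<in>I. form V (w i) x \<odot>\<^bsub>M\<^esub> m i)" for x
  show "\<exists>k\<in>mod_hom R V M. \<forall>x\<in>carrier V. g (k x) = h x"
  proof (intro bexI[of _ k] ballI mod_homI)
    show "k x \<in> carrier M" if "x \<in> carrier V" for x
      unfolding k_def using that m D(5) by (intro M.lincomb_closed) auto
    show "k (x \<oplus>\<^bsub>V\<^esub> y) = k x \<oplus>\<^bsub>M\<^esub> k y" if "x \<in> carrier V" "y \<in> carrier V" for x y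
    proof -
      have "k (x \<oplus>\<^bsub>V\<^esub> y) = (\<Oplus>\<^bsub>M\<^esub>i\<in>I. form V (w i) x \<odot>\<^bsub>M\<^esub> m i \<oplus>\<^bsub>M\<^esub> form V (w i) y \<odot>\<^bsub>M\<^esub> m i)"
        unfolding k_def using that m D(5)
        by (intro M.finsum_cong') (auto simp: form_add_right M.smult_l_distr)
      then show ?thesis
        unfolding k_def using that m D(5) by (simp add: M.finsum_addf Pi_def)
    qed
    show "k (r \<odot>\<^bsub>V\<^esub> x) = r \<odot>\<^bsub>M\<^esub> k x" if "r \<in> carrier R" "x \<in> carrier V" for r x
    proof -
      have "k (r \<odot>\<^bsub>V\<^esub> x) = (\<Oplus>\<^bsub>M\<^esub>i\<in>I. r \<odot>\<^bsub>M\<^esub> (form V (w i) x \<odot>\<^bsub>M\<^esub> m i))"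
        unfolding k_def using that m D(5)
        by (intro M.finsum_cong') (auto simp: form_smult_right M.smult_assoc1)
      then show ?thesis
        unfolding k_def using that m D(1,5) by (simp add: M.finsum_smult_ldistr Pi_def)
    qed
    show "g (k x) = h x" if x: "x \<in> carrier V" for x
    proof -
      interpret N: module R N by fact
      have "g (k x) = (\<Oplus>\<^bsub>N\<^esub>i\<in>I. form V (w i) x \<odot>\<^bsub>N\<^esub> g (m i))"
        unfolding k_def using x m D(1,5) by (intro mod_hom_lincomb[OF M N g]) auto
      also have "\<dots> = (\<Oplus>\<^bsub>N\<^esub>i\<in>I. form V (w i) x \<odot>\<^bsub>N\<^esub> h (u i))"
        using x m D(4,5) by (intro N.finsum_cong') (auto simp: mod_hom_closed[OF h])
      also have "\<dots> = h (\<Oplus>\<^bsub>V\<^esub>i\<in>I. form V (w i) x \<odot>\<^bsub>V\<^esub> u i)"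
        using x D(1,2,5) by (intro mod_hom_lincomb[OF module_axioms N h, symmetric]) auto
      finally show ?thesis using D(6)[OF x] by simp
    qed
  qed
qed

text \<open>Functionals take values in the ring, which is not a module record here, so
  \<open>mod_hom_lincomb\<close> does not cover them.\<close>

lemma linear_dual_lincomb:
  assumes "\<phi> \<in> linear_dual R V" "finite I" "c \<in> I \<rightarrow> carrier R" "v \<in> I \<rightarrow> carrier V"
  shows "\<phi> (\<Oplus>\<^bsub>V\<^esub>i\<in>I. c i \<odot>\<^bsub>V\<^esub> v i) = (\<Oplus>i\<in>I. c i \<otimes> \<phi> (v i))"
  using assms(2-4)
proof (induction I)
  case empty
  have "\<phi> \<zero>\<^bsub>V\<^esub> = \<phi> (\<zero> \<odot>\<^bsub>V\<^esub> \<zero>\<^bsub>V\<^esub>)" by simp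
  also have "\<dots> = \<zero> \<otimes> \<phi> \<zero>\<^bsub>V\<^esub>"
    using assms(1) R.zero_closed M.zero_closed unfolding linear_dual_def by blast
  also have "\<dots> = \<zero>" using assms(1) by (auto simp: linear_dual_def PiE_def Pi_iff)
  finally show ?case by simp
next
  case (insert i I)
  have "(\<Oplus>\<^bsub>V\<^esub>i\<in>I. c i \<odot>\<^bsub>V\<^esub> v i) \<in> carrier V"
    using insert.prems by (intro lincomb_closed) auto
  with insert assms(1) show ?case
    by (simp add: Pi_def PiE_def linear_dual_def)
qed

text \<open>A vector is recovered from its coordinates, and these are pairings with the
  \<open>w i\<close>.\<close>

lemma dual_family_cancel:
  assumes "dual_family R V I u w" "x \<in> carrier V" "y \<in> carrier V"
    and "\<And>z. z \<in> carrier V \<Longrightarrow> form V x z = form V y z"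
  shows "x = y"
proof -
  note D = dual_familyD[OF assms(1)]
  have "x = (\<Oplus>\<^bsub>V\<^esub>i\<in>I. form V (w i) x \<odot>\<^bsub>V\<^esub> u i)" using D(6)[OF assms(2)] by simp
  also have "\<dots> = (\<Oplus>\<^bsub>V\<^esub>i\<in>I. form V (w i) y \<odot>\<^bsub>V\<^esub> u i)"
  proof (intro M.finsum_cong')
    fix i assume "i \<in> I"
    then show "form V (w i) x \<odot>\<^bsub>V\<^esub> u i = form V (w i) y \<odot>\<^bsub>V\<^esub> u i"
      using assms(2-4) D(5) by (metis form_sym)
  qed (use D assms in auto)
  also have "\<dots> = y" using D(6)[OF assms(3)] by simp
  finally show ?thesis .
qed

lemma dual_family_nondegenerate:
  assumes "dual_family R V I u w"
  shows "bij_betw (\<lambda>x. \<lambda>y\<in>carrier V. form V x y) (carrier V) (linear_dual R V)"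
proof (intro bij_betw_imageI subset_antisym subsetI)
  note D = dual_familyD[OF assms]
  show "inj_on (\<lambda>x. \<lambda>y\<in>carrier V. form V x y) (carrier V)"
  proof (rule inj_onI)
    fix x y assume *: "x \<in> carrier V" "y \<in> carrier V"
      "(\<lambda>z\<in>carrier V. form V x z) = (\<lambda>z\<in>carrier V. form V y z)"
    have "form V x z = form V y z" if "z \<in> carrier V" for z
      using fun_cong[OF *(3), of z] that by simp
    then show "x = y" using dual_family_cancel[OF assms *(1,2)] by blast
  qed
  show "\<phi> \<in> linear_dual R V" if "\<phi> \<in> (\<lambda>x. \<lambda>y\<in>carrier V. form V x y) ` carrier V" for \<phi>
    using that by (auto simp: linear_dual_def form_add_right form_smult_right)
  fix \<phi> assume \<phi>: "\<phi> \<in> linear_dual R V"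
  then have \<phi>c: "\<phi> x \<in> carrier R" if "x \<in> carrier V" for x
    using that by (auto simp: linear_dual_def)
  \<comment> \<open>The representing vector has the values of the functional on the
    \<open>u i\<close> as coefficients of the \<open>w i\<close>: pairing it with \<open>y\<close>
    gives the functional applied to the expansion of \<open>y\<close>.\<close>
  define x where "x = (\<Oplus>\<^bsub>V\<^esub>i\<in>I. \<phi> (u i) \<odot>\<^bsub>V\<^esub> w i)"
  have x: "x \<in> carrier V" unfolding x_def using \<phi>c D(3,4) by (intro lincomb_closed) auto
  have "form V x y = \<phi> y" if y: "y \<in> carrier V" for y
  proof -
    have "form V x y = (\<Oplus>i\<in>I. \<phi> (u i) \<otimes> form V (w i) y)"
      unfolding x_def using \<phi>c D(1,3,4) y by (intro form_lincomb_left) auto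
    also have "\<dots> = (\<Oplus>i\<in>I. form V (w i) y \<otimes> \<phi> (u i))"
      using \<phi>c D(4,5) y by (intro R.finsum_cong') (auto simp: R.m_comm)
    also have "\<dots> = \<phi> (\<Oplus>\<^bsub>V\<^esub>i\<in>I. form V (w i) y \<odot>\<^bsub>V\<^esub> u i)"
      using D(1,2,5) y by (intro linear_dual_lincomb[OF \<phi>, symmetric]) auto
    finally show ?thesis using D(6)[OF y] by simp
  qed
  then have "(\<lambda>y\<in>carrier V. form V x y) = \<phi>"
    using \<phi> by (auto simp: linear_dual_def fun_eq_iff PiE_def extensional_def)
  then show "\<phi> \<in> (\<lambda>x. \<lambda>y\<in>carrier V. form V x y) ` carrier V" using x by auto
qed

lemma dual_family_ips:
  assumes "dual_family R V I u w"
  shows "inner_product_space R V"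
  using dual_family_finitely_generated[OF assms] dual_family_projective[OF assms]
    dual_family_nondegenerate[OF assms]
  by (intro inner_product_space.intro inner_product_space_axioms.intro module_axioms)
    (auto simp: form_add_left form_smult_left intro: form_sym)

end

text \<open>
  Lifting the identity of \<open>V\<close> along \<open>R\<^sup>S \<rightarrow> V\<close> gives coordinate functionals for the
  generating set \<open>S\<close>, and non-degeneracy represents them by vectors.
\<close>

lemma ips_dual_family:
  fixes V :: "('a, 'b) ips"
  assumes "inner_product_space R V"
  obtains I :: "'b set" and u w where "dual_family R V I u w"
proof -
  interpret V: inner_product_space R V by fact
  obtain S where S: "finite S" "S \<subseteq> carrier V"
    "\<And>x. x \<in> carrier V \<Longrightarrow> \<exists>c \<in> S \<rightarrow> carrier R. x = (\<Oplus>\<^bsub>V\<^esub>s\<in>S. c s \<odot>\<^bsub>V\<^esub> s)"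
    using V.fin_gen unfolding finitely_generated_def by blast
  \<comment> \<open>\<open>projective\<close> ranges over plain module records, so the identity is
    lifted against \<open>V\<close> stripped of its form field.\<close>
  define N where "N = module.truncate V"
  have Nsimps: "carrier N = carrier V" "add N = add V" "smult N = smult V" "zero N = zero V"
    by (simp_all add: N_def module.truncate_def)
  define M where "M = free_module R S"
  have M: "module R M" unfolding M_def by (rule free_module_module) (rule V.R.is_cring)
  have N: "module R N"
    by (rule module_transfer[OF V.module_axioms, of "\<lambda>x. x"]) (simp_all add: Nsimps)
  define g where "g c = (\<Oplus>\<^bsub>V\<^esub>s\<in>S. c s \<odot>\<^bsub>V\<^esub> s)" for c
  have cM: "c s \<in> carrier R" if "c \<in> carrier M" "s \<in> S" for c s
    using that by (auto simp: M_def free_module_def)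
  have g: "g \<in> mod_hom R M N"
  proof (rule mod_homI)
    show "g c \<in> carrier N" if "c \<in> carrier M" for c
      unfolding g_def Nsimps using that S(2) cM by (intro V.lincomb_closed) auto
    show "g (c \<oplus>\<^bsub>M\<^esub> d) = g c \<oplus>\<^bsub>N\<^esub> g d" if "c \<in> carrier M" "d \<in> carrier M" for c d
    proof -
      have "g (c \<oplus>\<^bsub>M\<^esub> d) = (\<Oplus>\<^bsub>V\<^esub>s\<in>S. c s \<odot>\<^bsub>V\<^esub> s \<oplus>\<^bsub>V\<^esub> d s \<odot>\<^bsub>V\<^esub> s)"
        unfolding g_def using that cM S(2)
        by (intro V.M.finsum_cong') (auto simp: M_def free_module_def subset_iff intro!: V.smult_l_distr)
      then show ?thesis
        unfolding g_def Nsimps using that cM S(2)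
        by (subst (asm) V.M.finsum_addf) (auto simp: subset_iff)
    qed
    show "g (r \<odot>\<^bsub>M\<^esub> c) = r \<odot>\<^bsub>N\<^esub> g c" if "r \<in> carrier R" "c \<in> carrier M" for r c
    proof -
      have "g (r \<odot>\<^bsub>M\<^esub> c) = (\<Oplus>\<^bsub>V\<^esub>s\<in>S. r \<odot>\<^bsub>V\<^esub> (c s \<odot>\<^bsub>V\<^esub> s))"
        unfolding g_def using that cM S(2)
        by (intro V.M.finsum_cong') (auto simp: M_def free_module_def subset_iff intro!: V.smult_assoc1)
      then show ?thesis
        unfolding g_def Nsimps using that cM S(1,2)
        by (subst V.finsum_smult_ldistr) (auto simp: subset_iff)
    qed
  qed
  have surj: "g ` carrier M = carrier N"
  proof (intro subset_antisym subsetI)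
    fix x assume "x \<in> carrier N"
    with S(3) obtain c where c: "c \<in> S \<rightarrow> carrier R" "x = (\<Oplus>\<^bsub>V\<^esub>s\<in>S. c s \<odot>\<^bsub>V\<^esub> s)"
      by (auto simp: Nsimps)
    have "x = g (restrict c S)"
      unfolding c(2) g_def using c(1) S(2) by (intro V.M.finsum_cong') (auto simp: Pi_iff subset_iff)
    moreover have "restrict c S \<in> carrier M" using c(1) by (auto simp: M_def free_module_def)
    ultimately show "x \<in> g ` carrier M" by blast
  qed (use mod_hom_closed[OF g] in auto)
  have id: "(\<lambda>x. x) \<in> mod_hom R V N" by (rule mod_homI) (simp_all add: Nsimps)
  have "\<exists>k\<in>mod_hom R V M. \<forall>x\<in>carrier V. g (k x) = x"
    using V.proj[unfolded projective_def, THEN spec, THEN spec, THEN spec, THEN spec, of M N g "\<lambda>x. x"]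
    by (rule mp) (intro conjI M N g surj id)
  then obtain k where k: "k \<in> mod_hom R V M" "\<And>x. x \<in> carrier V \<Longrightarrow> g (k x) = x"
    by blast
  have "\<exists>w\<in>carrier V. \<forall>x\<in>carrier V. form V w x = k x s" if s: "s \<in> S" for s
  proof -
    have "(\<lambda>x\<in>carrier V. k x s) \<in> linear_dual R V"
      unfolding linear_dual_def using s cM mod_hom_closed[OF k(1)]
      by (auto simp: mod_hom_add[OF k(1)] mod_hom_smult[OF k(1)]) (auto simp: M_def free_module_def)
    then obtain w where w: "w \<in> carrier V" "(\<lambda>y\<in>carrier V. form V w y) = (\<lambda>x\<in>carrier V. k x s)"
      using V.nondegenerate unfolding bij_betw_def by (metis (no_types, lifting) imageE)
    have "form V w x = k x s" if "x \<in> carrier V" for x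
      using fun_cong[OF w(2), of x] that by simp
    with w(1) show ?thesis by blast
  qed
  then obtain w where w: "\<And>s. s \<in> S \<Longrightarrow> w s \<in> carrier V"
    "\<And>s x. \<lbrakk>s \<in> S; x \<in> carrier V\<rbrakk> \<Longrightarrow> form V (w s) x = k x s" by metis
  have "dual_family R V S (\<lambda>s. s) w"
    unfolding dual_family_def
  proof (intro conjI ballI)
    fix x assume x: "x \<in> carrier V"
    have "x = g (k x)" using k(2)[OF x] by simp
    also have "\<dots> = (\<Oplus>\<^bsub>V\<^esub>s\<in>S. form V (w s) x \<odot>\<^bsub>V\<^esub> s)"
      unfolding g_def using x w S(2) cM[OF mod_hom_closed[OF k(1) x]]
      by (intro V.M.finsum_cong') (auto simp: subset_iff)
    finally show "x = (\<Oplus>\<^bsub>V\<^esub>s\<in>S. form V (w s) x \<odot>\<^bsub>V\<^esub> s)" .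
  qed (use S w in auto)
  then show ?thesis using that by blast
qed


section \<open>Isometries\<close>

text \<open>Bijectivity is left out: injectivity is automatic when the source is an inner product
  space, so only surjectivity has to be supplied for an isometry.\<close>

definition form_hom :: "('a, 'm) ring_scheme \<Rightarrow> ('a, 'b) ips \<Rightarrow> ('a, 'c) ips \<Rightarrow> ('b \<Rightarrow> 'c) set"
  where "form_hom R V W =
    {f \<in> mod_hom R V W. \<forall>x \<in> carrier V. \<forall>y \<in> carrier V. form W (f x) (f y) = form V x y}"

lemma form_homD:
  assumes "f \<in> form_hom R V W"
  shows "f \<in> mod_hom R V W"
    "\<And>x y. \<lbrakk>x \<in> carrier V; y \<in> carrier V\<rbrakk> \<Longrightarrow> form W (f x) (f y) = form V x y"
    "\<And>x. x \<in> carrier V \<Longrightarrow> f x \<in> carrier W"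
    "\<And>x y. \<lbrakk>x \<in> carrier V; y \<in> carrier V\<rbrakk> \<Longrightarrow> f (x \<oplus>\<^bsub>V\<^esub> y) = f x \<oplus>\<^bsub>W\<^esub> f y"
    "\<And>r x. \<lbrakk>r \<in> carrier R; x \<in> carrier V\<rbrakk> \<Longrightarrow> f (r \<odot>\<^bsub>V\<^esub> x) = r \<odot>\<^bsub>W\<^esub> f x"
  using assms unfolding form_hom_def by (auto simp: mod_hom_def)

lemma form_homI:
  assumes "f \<in> mod_hom R V W"
    "\<And>x y. \<lbrakk>x \<in> carrier V; y \<in> carrier V\<rbrakk> \<Longrightarrow> form W (f x) (f y) = form V x y"
  shows "f \<in> form_hom R V W"
  using assms unfolding form_hom_def by blast

lemma ips_module: "inner_product_space R V \<Longrightarrow> module R V"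
  by (simp add: inner_product_space_def)

lemma ips_cancel:
  fixes V :: "('a, 'b) ips"
  assumes "inner_product_space R V" "x \<in> carrier V" "y \<in> carrier V"
    and "\<And>z. z \<in> carrier V \<Longrightarrow> form V x z = form V y z"
  shows "x = y"
proof -
  obtain I :: "'b set" and u w where "dual_family R V I u w" using ips_dual_family[OF assms(1)] .
  from form_space.dual_family_cancel[OF ips_form_space[OF assms(1)] this assms(2,3,4)] show ?thesis .
qed

text \<open>Vectors with equal images have equal pairings with every vector of \<open>V\<close>, and
  by non-degeneracy these determine a vector.\<close>

lemma form_hom_inj:
  assumes "inner_product_space R V" "f \<in> form_hom R V W"
  shows "inj_on f (carrier V)"
proof (rule inj_onI)
  fix x y assume "x \<in> carrier V" "y \<in> carrier V" "f x = f y"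
  then show "x = y"
    using form_homD(2)[OF assms(2)] by (intro ips_cancel[OF assms(1)]) metis+
qed

lemma isometric_iff:
  "isometric R V W \<longleftrightarrow> inner_product_space R V \<and> inner_product_space R W \<and>
    (\<exists>f \<in> form_hom R V W. f ` carrier V = carrier W)"
  unfolding isometric_def using form_hom_inj[of R V _ W]
  unfolding form_hom_def bij_betw_def by blast

lemma form_space_transfer:
  assumes V: "form_space R V" and f: "f \<in> form_hom R V W" and surj: "f ` carrier V = carrier W"
    and zero: "f \<zero>\<^bsub>V\<^esub> = \<zero>\<^bsub>W\<^esub>"
  shows "form_space R W"
proof -
  interpret V: form_space R V by fact
  note F = form_homD[OF f]
  have E: "\<exists>x'\<in>carrier V. x = f x'" if "x \<in> carrier W" for x using surj that by auto
  have M: "module R W"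
    by (rule module_transfer[OF V.module_axioms surj F(4,5) zero])
  show ?thesis
    by (intro form_space.intro M form_space_axioms.intro)
      (auto dest!: E simp: F(2) F(4,5)[symmetric] V.form_add_left V.form_smult_left intro: V.form_sym)
qed

text \<open>The target is not assumed to be an inner product space, nor even a module: the
  surjection carries the axioms and a dual family over to it. Most isometries below are obtained
  this way, with the structure of the target as a by-product.\<close>

lemma isometric_transfer:
  fixes V :: "('a, 'b) ips" and W :: "('a, 'c) ips"
  assumes V: "inner_product_space R V" and f: "f \<in> form_hom R V W" and surj: "f ` carrier V = carrier W"
    and zero: "f \<zero>\<^bsub>V\<^esub> = \<zero>\<^bsub>W\<^esub>"
  shows "isometric R V W"
proof -
  interpret V: form_space R V using ips_form_space[OF V] .
  interpret W: form_space R W using form_space_transfer[OF V.form_space_axioms f surj zero] .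
  note F = form_homD[OF f]
  obtain I :: "'b set" and u w where "dual_family R V I u w" using ips_dual_family[OF V] .
  note D = dual_familyD[OF this]
  have "dual_family R W I (f \<circ> u) (f \<circ> w)"
    unfolding dual_family_def
  proof (intro conjI ballI)
    fix y assume "y \<in> carrier W"
    then obtain x where x: "x \<in> carrier V" "y = f x" using surj by auto
    have "f x = f (\<Oplus>\<^bsub>V\<^esub>i\<in>I. form V (w i) x \<odot>\<^bsub>V\<^esub> u i)" using D(6)[OF x(1)] by simp
    also have "\<dots> = (\<Oplus>\<^bsub>W\<^esub>i\<in>I. form V (w i) x \<odot>\<^bsub>W\<^esub> f (u i))"
      using D x by (intro mod_hom_lincomb[OF V.module_axioms W.module_axioms F(1)]) auto
    also have "\<dots> = (\<Oplus>\<^bsub>W\<^esub>i\<in>I. form W ((f \<circ> w) i) y \<odot>\<^bsub>W\<^esub> (f \<circ> u) i)"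
      using D x F by (intro W.M.finsum_cong') auto
    finally show "y = (\<Oplus>\<^bsub>W\<^esub>i\<in>I. form W ((f \<circ> w) i) y \<odot>\<^bsub>W\<^esub> (f \<circ> u) i)"
      using x by simp
  qed (use D F in auto)
  then have "inner_product_space R W" by (rule W.dual_family_ips)
  then show ?thesis using V f surj unfolding isometric_iff by blast
qed

lemma isometric_ips:
  assumes "isometric R V W"
  shows "inner_product_space R V" "inner_product_space R W"
  using assms by (auto simp: isometric_def)

lemma isometric_refl: "inner_product_space R V \<Longrightarrow> isometric R V V"
  unfolding isometric_iff form_hom_def mod_hom_def by (auto intro!: exI[of _ "\<lambda>x. x"])

lemma isometric_sym:
  assumes "isometric R V W"
  shows "isometric R W V"
proof -
  note ips = isometric_ips[OF assms]
  obtain f where f: "f \<in> form_hom R V W" "f ` carrier V = carrier W"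
    using assms unfolding isometric_iff by blast
  note F = form_homD[OF f(1)]
  have inj: "inj_on f (carrier V)" by (rule form_hom_inj[OF ips(1) f(1)])
  interpret V: module R V using ips_module[OF ips(1)] .
  define g where "g = the_inv_into (carrier V) f"
  have g: "g (f x) = x" if "x \<in> carrier V" for x
    using inj that by (simp add: g_def the_inv_into_f_f)
  have E: "\<exists>x'\<in>carrier V. x = f x'" if "x \<in> carrier W" for x using f(2) that by auto
  have "g \<in> form_hom R W V"
    by (intro form_homI mod_homI)
      (auto dest!: E simp: g F(2) F(4,5)[symmetric])
  moreover have "g ` carrier W = carrier V"
    unfolding f(2)[symmetric] image_image using g by simp
  ultimately show ?thesis using ips unfolding isometric_iff by blast
qed

lemma isometric_trans:
  assumes "isometric R U V" "isometric R V W"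
  shows "isometric R U W"
proof -
  obtain f g where f: "f \<in> form_hom R U V" "f ` carrier U = carrier V"
    and g: "g \<in> form_hom R V W" "g ` carrier V = carrier W"
    using assms unfolding isometric_iff by blast
  have "g \<circ> f \<in> form_hom R U W"
    using mod_hom_comp[OF form_homD(1)[OF f(1)] form_homD(1)[OF g(1)]]
    by (rule form_homI) (simp add: form_homD[OF f(1)] form_homD[OF g(1)])
  moreover have "(g \<circ> f) ` carrier U = carrier W" using f(2) g(2) by (simp only: image_comp[symmetric])
  ultimately show ?thesis
    using isometric_ips[OF assms(1)] isometric_ips[OF assms(2)] unfolding isometric_iff by blast
qed


section \<open>Orthogonal sums\<close>

lemma orth_sum_simps [simp]:
  "carrier (orth_sum R V W) = carrier V \<times> carrier W"
  "\<zero>\<^bsub>orth_sum R V W\<^esub> = (\<zero>\<^bsub>V\<^esub>, \<zero>\<^bsub>W\<^esub>)"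
  "(x, y) \<oplus>\<^bsub>orth_sum R V W\<^esub> (x', y') = (x \<oplus>\<^bsub>V\<^esub> x', y \<oplus>\<^bsub>W\<^esub> y')"
  "r \<odot>\<^bsub>orth_sum R V W\<^esub> (x, y) = (r \<odot>\<^bsub>V\<^esub> x, r \<odot>\<^bsub>W\<^esub> y)"
  "form (orth_sum R V W) (x, y) (x', y') = form V x x' \<oplus>\<^bsub>R\<^esub> form W y y'"
  by (simp_all add: orth_sum_def)

lemma orth_sum_form_space:
  assumes "form_space R V" "form_space R W"
  shows "form_space R (orth_sum R V W)"
proof -
  interpret V: form_space R V by fact
  interpret W: form_space R W by fact
  have M: "module R (orth_sum R V W)"
  proof (intro moduleI abelian_groupI)
    show "\<exists>y\<in>carrier (orth_sum R V W). y \<oplus>\<^bsub>orth_sum R V W\<^esub> x = \<zero>\<^bsub>orth_sum R V W\<^esub>"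
      if "x \<in> carrier (orth_sum R V W)" for x
      using that by (intro bexI[of _ "(\<ominus>\<^bsub>V\<^esub> fst x, \<ominus>\<^bsub>W\<^esub> snd x)"]) (auto simp: V.M.l_neg W.M.l_neg)
  qed (auto simp: V.M.a_ac W.M.a_ac V.smult_l_distr W.smult_l_distr V.smult_r_distr W.smult_r_distr
      V.smult_assoc1 W.smult_assoc1 V.R.is_cring)
  show ?thesis
  proof (intro form_space.intro M form_space_axioms.intro)
    show "form (orth_sum R V W) x y = form (orth_sum R V W) y x"
      if "x \<in> carrier (orth_sum R V W)" "y \<in> carrier (orth_sum R V W)" for x y
      using that V.form_sym[of "fst x" "fst y"] W.form_sym[of "snd x" "snd y"] by auto
  qed (auto simp: V.form_add_left W.form_add_left V.form_smult_left W.form_smult_left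
        V.R.r_distr V.R.a_ac)
qed

lemma orth_sum_inl_hom:
  assumes "module R W" shows "(\<lambda>x. (x, \<zero>\<^bsub>W\<^esub>)) \<in> mod_hom R V (orth_sum R V W)"
proof -
  interpret W: module R W by fact
  show ?thesis by (rule mod_homI) auto
qed

lemma orth_sum_inr_hom:
  assumes "module R V" shows "(\<lambda>y. (\<zero>\<^bsub>V\<^esub>, y)) \<in> mod_hom R W (orth_sum R V W)"
proof -
  interpret V: module R V by fact
  show ?thesis by (rule mod_homI) auto
qed

text \<open>Dual families of the two summands, padded with zeros and indexed by the disjoint sum,
  form a dual family of the orthogonal sum.\<close>

lemma orth_sum_ips:
  fixes V :: "('a, 'b) ips" and W :: "('a, 'c) ips"
  assumes V: "inner_product_space R V" and W: "inner_product_space R W"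
  shows "inner_product_space R (orth_sum R V W)"
proof -
  interpret V: form_space R V using ips_form_space[OF V] .
  interpret W: form_space R W using ips_form_space[OF W] .
  interpret VW: form_space R "orth_sum R V W"
    by (rule orth_sum_form_space[OF V.form_space_axioms W.form_space_axioms])
  obtain I :: "'b set" and u w where "dual_family R V I u w" using ips_dual_family[OF V] .
  note D = dual_familyD[OF this]
  obtain J :: "'c set" and u' w' where "dual_family R W J u' w'" using ips_dual_family[OF W] .
  note D' = dual_familyD[OF this]
  let ?u = "case_sum (\<lambda>i. (u i, \<zero>\<^bsub>W\<^esub>)) (\<lambda>j. (\<zero>\<^bsub>V\<^esub>, u' j))"
  let ?w = "case_sum (\<lambda>i. (w i, \<zero>\<^bsub>W\<^esub>)) (\<lambda>j. (\<zero>\<^bsub>V\<^esub>, w' j))"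
  let ?S = "orth_sum R V W"
  have "dual_family R ?S (I <+> J) ?u ?w"
    unfolding dual_family_def
  proof (intro conjI ballI)
    fix z assume "z \<in> carrier ?S"
    then obtain x y where z: "z = (x, y)" "x \<in> carrier V" "y \<in> carrier W" by auto
    let ?h = "\<lambda>k. form ?S (?w k) z \<odot>\<^bsub>?S\<^esub> ?u k"
    have cl: "?h k \<in> carrier ?S" if "k \<in> I <+> J" for k
      using that D D' z by (auto simp: Plus_def)
    have "(\<Oplus>\<^bsub>?S\<^esub>k\<in>I <+> J. ?h k) = (\<Oplus>\<^bsub>?S\<^esub>k\<in>Inl ` I. ?h k) \<oplus>\<^bsub>?S\<^esub> (\<Oplus>\<^bsub>?S\<^esub>k\<in>Inr ` J. ?h k)"
      unfolding Plus_def using D(1) D'(1) cl by (intro VW.M.finsum_Un_disjoint) auto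
    also have "(\<Oplus>\<^bsub>?S\<^esub>k\<in>Inl ` I. ?h k) = (\<Oplus>\<^bsub>?S\<^esub>i\<in>I. ?h (Inl i))"
      using cl by (intro VW.M.finsum_reindex) auto
    also have "\<dots> = (\<Oplus>\<^bsub>?S\<^esub>i\<in>I. form V (w i) x \<odot>\<^bsub>?S\<^esub> (u i, \<zero>\<^bsub>W\<^esub>))"
      using D z by (intro VW.M.finsum_cong') auto
    also have "\<dots> = (x, \<zero>\<^bsub>W\<^esub>)"
      using D z mod_hom_lincomb[OF V.module_axioms VW.module_axioms orth_sum_inl_hom[OF W.module_axioms] D(1),
          of "\<lambda>i. form V (w i) x" u] by (simp add: Pi_def)
    also have "(\<Oplus>\<^bsub>?S\<^esub>k\<in>Inr ` J. ?h k) = (\<Oplus>\<^bsub>?S\<^esub>j\<in>J. ?h (Inr j))"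
      using cl by (intro VW.M.finsum_reindex) auto
    also have "\<dots> = (\<Oplus>\<^bsub>?S\<^esub>j\<in>J. form W (w' j) y \<odot>\<^bsub>?S\<^esub> (\<zero>\<^bsub>V\<^esub>, u' j))"
      using D' z by (intro VW.M.finsum_cong') auto
    also have "\<dots> = (\<zero>\<^bsub>V\<^esub>, y)"
      using D' z mod_hom_lincomb[OF W.module_axioms VW.module_axioms orth_sum_inr_hom[OF V.module_axioms] D'(1),
          of "\<lambda>i. form W (w' i) y" u'] by (simp add: Pi_def)
    finally show "z = (\<Oplus>\<^bsub>?S\<^esub>k\<in>I <+> J. ?h k)" using z by simp
  qed (use D D' in \<open>auto simp: Plus_def\<close>)
  then show ?thesis by (rule VW.dual_family_ips)
qed

lemma orth_sum_cong:
  assumes "isometric R V V'" "isometric R W W'"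
  shows "isometric R (orth_sum R V W) (orth_sum R V' W')"
proof -
  obtain f g where f: "f \<in> form_hom R V V'" "f ` carrier V = carrier V'"
    and g: "g \<in> form_hom R W W'" "g ` carrier W = carrier W'"
    using assms unfolding isometric_iff by blast
  have "map_prod f g \<in> form_hom R (orth_sum R V W) (orth_sum R V' W')"
    by (intro form_homI mod_homI) (auto simp: form_homD[OF f(1)] form_homD[OF g(1)])
  moreover have "map_prod f g ` carrier (orth_sum R V W) = carrier (orth_sum R V' W')"
    using f(2) g(2) by (simp add: map_prod_surj_on)
  ultimately show ?thesis
    unfolding isometric_iff
    by (intro conjI bexI orth_sum_ips isometric_ips[OF assms(1)] isometric_ips[OF assms(2)])
qed

lemma orth_sum_comm:
  assumes "inner_product_space R V" "inner_product_space R W"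
  shows "isometric R (orth_sum R V W) (orth_sum R W V)"
proof (rule isometric_transfer)
  interpret V: form_space R V using ips_form_space[OF assms(1)] .
  interpret W: form_space R W using ips_form_space[OF assms(2)] .
  show "inner_product_space R (orth_sum R V W)" by (intro orth_sum_ips assms)
  show "prod.swap \<in> form_hom R (orth_sum R V W) (orth_sum R W V)"
    by (intro form_homI mod_homI) (auto simp: V.R.a_comm)
  show "prod.swap ` carrier (orth_sum R V W) = carrier (orth_sum R W V)" by (simp add: product_swap)
qed simp

lemma orth_sum_assoc:
  assumes "inner_product_space R U" "inner_product_space R V" "inner_product_space R W"
  shows "isometric R (orth_sum R (orth_sum R U V) W) (orth_sum R U (orth_sum R V W))"
proof (rule isometric_transfer)
  interpret U: form_space R U using ips_form_space[OF assms(1)] .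
  interpret V: form_space R V using ips_form_space[OF assms(2)] .
  interpret W: form_space R W using ips_form_space[OF assms(3)] .
  let ?f = "\<lambda>p. (fst (fst p), (snd (fst p), snd p))"
  show "inner_product_space R (orth_sum R (orth_sum R U V) W)" by (intro orth_sum_ips assms)
  show "?f \<in> form_hom R (orth_sum R (orth_sum R U V) W) (orth_sum R U (orth_sum R V W))"
    by (intro form_homI mod_homI) (auto simp: U.R.a_assoc)
  show "?f ` carrier (orth_sum R (orth_sum R U V) W) = carrier (orth_sum R U (orth_sum R V W))"
    unfolding orth_sum_simps by force
qed simp

lemma orth_sum_zero_right:
  assumes "inner_product_space R V" "inner_product_space R Z" "carrier Z = {\<zero>\<^bsub>Z\<^esub>}"
  shows "isometric R (orth_sum R V Z) V"
proof (rule isometric_transfer)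
  interpret V: form_space R V using ips_form_space[OF assms(1)] .
  interpret Z: form_space R Z using ips_form_space[OF assms(2)] .
  show "inner_product_space R (orth_sum R V Z)" by (intro orth_sum_ips assms)
  show "fst \<in> form_hom R (orth_sum R V Z) V"
    by (intro form_homI mod_homI) (auto simp: assms(3))
  show "fst ` carrier (orth_sum R V Z) = carrier V" by (simp add: assms(3) fst_image_times)
qed simp

lemma zero_ips:
  assumes "form_space R Z" "carrier Z = {\<zero>\<^bsub>Z\<^esub>}"
  shows "inner_product_space R Z"
proof -
  interpret Z: form_space R Z by fact
  \<comment> \<open>The empty family is dual here, since the empty sum is the only vector; the index
    type \<open>nat\<close> is an arbitrary choice.\<close>
  have "dual_family R Z ({} :: nat set) (\<lambda>_. \<zero>\<^bsub>Z\<^esub>) (\<lambda>_. \<zero>\<^bsub>Z\<^esub>)"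
    unfolding dual_family_def using assms(2) by simp
  then show ?thesis by (rule Z.dual_family_ips)
qed

lemma zero_form_spaceI:
  assumes R: "cring R" and Z: "carrier Z = {\<zero>\<^bsub>Z\<^esub>}" "\<zero>\<^bsub>Z\<^esub> \<oplus>\<^bsub>Z\<^esub> \<zero>\<^bsub>Z\<^esub> = \<zero>\<^bsub>Z\<^esub>"
    "\<And>r. r \<in> carrier R \<Longrightarrow> r \<odot>\<^bsub>Z\<^esub> \<zero>\<^bsub>Z\<^esub> = \<zero>\<^bsub>Z\<^esub>" "form Z \<zero>\<^bsub>Z\<^esub> \<zero>\<^bsub>Z\<^esub> = \<zero>\<^bsub>R\<^esub>"
  shows "form_space R Z"
proof -
  interpret R: cring R by fact
  show ?thesis
    by (intro form_space.intro form_space_axioms.intro moduleI abelian_groupI R) (simp_all add: Z)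
qed

text \<open>The zero space arises as different records, such as an empty orthogonal sum and
  \<open>matrix_space R 0 A\<close>; this identifies them.\<close>

lemma isometric_zero:
  assumes "inner_product_space R Y" "carrier Y = {\<zero>\<^bsub>Y\<^esub>}"
    and "inner_product_space R Z" "carrier Z = {\<zero>\<^bsub>Z\<^esub>}"
  shows "isometric R Y Z"
proof -
  interpret Y: form_space R Y using ips_form_space[OF assms(1)] .
  interpret Z: form_space R Z using ips_form_space[OF assms(3)] .
  show ?thesis
  proof (rule isometric_transfer[OF assms(1), of "\<lambda>_. \<zero>\<^bsub>Z\<^esub>"])
    show "(\<lambda>_. \<zero>\<^bsub>Z\<^esub>) \<in> form_hom R Y Z" by (intro form_homI mod_homI) (auto simp: assms(2))
  qed (auto simp: assms(2,4))
qed

section \<open>Coordinate spaces, with explicit formulas in ranks one and two\<close>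

lemma matrix_space_simps:
  "carrier (matrix_space R n A) = {..<n} \<rightarrow>\<^sub>E carrier R"
  "\<zero>\<^bsub>matrix_space R n A\<^esub> = (\<lambda>i\<in>{..<n}. \<zero>\<^bsub>R\<^esub>)"
  "x \<oplus>\<^bsub>matrix_space R n A\<^esub> y = (\<lambda>i\<in>{..<n}. x i \<oplus>\<^bsub>R\<^esub> y i)"
  "r \<odot>\<^bsub>matrix_space R n A\<^esub> x = (\<lambda>i\<in>{..<n}. r \<otimes>\<^bsub>R\<^esub> x i)"
  "form (matrix_space R n A) x y
    = (\<Oplus>\<^bsub>R\<^esub>i\<in>{..<n}. \<Oplus>\<^bsub>R\<^esub>j\<in>{..<n}. x i \<otimes>\<^bsub>R\<^esub> A i j \<otimes>\<^bsub>R\<^esub> y j)"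
  by (simp_all add: matrix_space_def)

text \<open>Carrier and operations agree with those of the free module on \<open>{..<n}\<close>;
  only the record type differs, so the identity map transfers the axioms.\<close>

lemma matrix_space_module:
  assumes "cring R" shows "module R (matrix_space R n A)"
  by (rule module_transfer[OF free_module_module[OF assms, of "{..<n}"], of "\<lambda>x. x"])
    (simp_all add: matrix_space_simps free_module_def)

lemma matrix_space_zero_carrier: "carrier (matrix_space R 0 A) = {\<zero>\<^bsub>matrix_space R 0 A\<^esub>}"
  by (simp add: matrix_space_simps fun_eq_iff)

lemma matrix_space_zero_ips:
  assumes "cring R" shows "inner_product_space R (matrix_space R 0 A)"
proof (rule zero_ips[OF zero_form_spaceI[OF assms]])
  interpret cring R by fact
  show "form (matrix_space R 0 A) \<zero>\<^bsub>matrix_space R 0 A\<^esub> \<zero>\<^bsub>matrix_space R 0 A\<^esub> = \<zero>\<^bsub>R\<^esub>"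
    by (simp add: matrix_space_simps)
qed (auto simp: matrix_space_simps)

lemma rank_one_simps:
  "carrier (rank_one_space R u) = {..<1} \<rightarrow>\<^sub>E carrier R"
  "\<zero>\<^bsub>rank_one_space R u\<^esub> = (\<lambda>i\<in>{..<1}. \<zero>\<^bsub>R\<^esub>)"
  "x \<oplus>\<^bsub>rank_one_space R u\<^esub> y = (\<lambda>i\<in>{..<1}. x i \<oplus>\<^bsub>R\<^esub> y i)"
  "r \<odot>\<^bsub>rank_one_space R u\<^esub> x = (\<lambda>i\<in>{..<1}. r \<otimes>\<^bsub>R\<^esub> x i)"
  by (simp_all add: rank_one_space_def matrix_space_simps)

lemma rank_two_simps:
  "carrier (rank_two_space R a b) = {..<2} \<rightarrow>\<^sub>E carrier R"
  "\<zero>\<^bsub>rank_two_space R a b\<^esub> = (\<lambda>i\<in>{..<2}. \<zero>\<^bsub>R\<^esub>)"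
  "x \<oplus>\<^bsub>rank_two_space R a b\<^esub> y = (\<lambda>i\<in>{..<2}. x i \<oplus>\<^bsub>R\<^esub> y i)"
  "r \<odot>\<^bsub>rank_two_space R a b\<^esub> x = (\<lambda>i\<in>{..<2}. r \<otimes>\<^bsub>R\<^esub> x i)"
  by (simp_all add: rank_two_space_def matrix_space_simps)

lemma rank_two_coord:
  assumes "x \<in> carrier (rank_two_space R a b)"
  shows "x 0 \<in> carrier R" "x (Suc 0) \<in> carrier R"
proof -
  have "x \<in> {..<2} \<rightarrow> carrier R" using assms by (auto simp: rank_two_simps)
  from funcset_mem[OF this, of 0] funcset_mem[OF this, of "Suc 0"]
  show "x 0 \<in> carrier R" "x (Suc 0) \<in> carrier R" by simp_all
qed

lemma rank_one_ext:
  assumes "x \<in> {..<1::nat} \<rightarrow>\<^sub>E A" "y \<in> {..<1::nat} \<rightarrow>\<^sub>E A" "x 0 = y 0"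
  shows "x = y"
  using assms by (intro PiE_ext) auto

lemma rank_two_ext:
  assumes "x \<in> {..<2::nat} \<rightarrow>\<^sub>E A" "y \<in> {..<2::nat} \<rightarrow>\<^sub>E A" "x 0 = y 0" "x 1 = y 1"
  shows "x = y"
proof (rule PiE_ext[OF assms(1,2)])
  fix i :: nat assume "i \<in> {..<2}"
  then have "i = 0 \<or> i = 1" by auto
  then show "x i = y i" using assms(3,4) by auto
qed

context cring
begin

lemma rank_one_form:
  assumes "u \<in> carrier R" "x \<in> carrier (rank_one_space R u)" "y \<in> carrier (rank_one_space R u)"
  shows "form (rank_one_space R u) x y = x 0 \<otimes> u \<otimes> y 0"
proof -
  have "x 0 \<in> carrier R" "y 0 \<in> carrier R" using assms by (auto simp: rank_one_simps)
  then show ?thesis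
    using assms(1) by (simp add: rank_one_space_def matrix_space_simps lessThan_Suc)
qed

lemma rank_two_form:
  assumes "a \<in> carrier R" "b \<in> carrier R"
    and "x \<in> carrier (rank_two_space R a b)" "y \<in> carrier (rank_two_space R a b)"
  shows "form (rank_two_space R a b) x y =
    (x 0 \<otimes> a \<otimes> y 0 \<oplus> x 0 \<otimes> y 1) \<oplus> (x 1 \<otimes> y 0 \<oplus> x 1 \<otimes> b \<otimes> y 1)"
proof -
  have "{..<2::nat} = {0, Suc 0}" by auto
  then show ?thesis
    using assms(1,2) rank_two_coord[OF assms(3)] rank_two_coord[OF assms(4)] by (simp add: rank_two_space_def matrix_space_simps mat2_def Pi_def)
qed

lemma rank_one_form_space:
  assumes u: "u \<in> carrier R"
  shows "form_space R (rank_one_space R u)"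
proof -
  interpret M: module R "rank_one_space R u"
    unfolding rank_one_space_def by (rule matrix_space_module) (rule is_cring)
  have C: "x 0 \<in> carrier R" if "x \<in> carrier (rank_one_space R u)" for x
    using that by (auto simp: rank_one_simps)
  have ev: "(x \<oplus>\<^bsub>rank_one_space R u\<^esub> y) 0 = x 0 \<oplus> y 0"
    "(r \<odot>\<^bsub>rank_one_space R u\<^esub> x) 0 = r \<otimes> x 0" for x y r
    by (simp_all add: rank_one_simps)
  show ?thesis
    by (intro form_space.intro M.module_axioms form_space_axioms.intro)
      (simp_all add: rank_one_form u ev C l_distr r_distr m_ac)
qed

lemma rank_one_ips:
  assumes u: "u \<in> Units R"
  shows "inner_product_space R (rank_one_space R u)"
proof -
  have uc: "u \<in> carrier R" "inv u \<in> carrier R" using u by auto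
  interpret form_space R "rank_one_space R u" by (rule rank_one_form_space) fact
  let ?e = "\<lambda>r. \<lambda>i\<in>{..<1::nat}. r"
  have e: "?e r \<in> carrier (rank_one_space R u)" if "r \<in> carrier R" for r
    using that by (auto simp: rank_one_simps)
  \<comment> \<open>The standard basis vector has norm \<open>u\<close>, so its dual vector is
    \<open>inv u\<close> times itself.\<close>
  have "dual_family R (rank_one_space R u) {()} (\<lambda>_. ?e \<one>) (\<lambda>_. ?e (inv u))"
    unfolding dual_family_def
  proof (intro conjI ballI)
    fix x assume x: "x \<in> carrier (rank_one_space R u)"
    have x0: "x 0 \<in> carrier R" using x by (auto simp: rank_one_simps)
    have f: "form (rank_one_space R u) (?e (inv u)) x = x 0"
      using u uc x0 by (subst rank_one_form) (auto simp: e e[unfolded One_nat_def] x)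
    have "x = x 0 \<odot>\<^bsub>rank_one_space R u\<^esub> ?e \<one>"
      using x x0 by (intro rank_one_ext[of _ "carrier R"]) (auto simp: rank_one_simps)
    also have "\<dots> = (\<Oplus>\<^bsub>rank_one_space R u\<^esub>i\<in>{()}.
        form (rank_one_space R u) (?e (inv u)) x \<odot>\<^bsub>rank_one_space R u\<^esub> ?e \<one>)"
      unfolding f using e[of \<one>] x0 by simp
    finally show "x = \<dots>" .
  qed (use e uc in auto)
  then show ?thesis by (rule dual_family_ips)
qed

lemma rank_two_form_space:
  assumes ab: "a \<in> carrier R" "b \<in> carrier R"
  shows "form_space R (rank_two_space R a b)"
proof -
  interpret M: module R "rank_two_space R a b"
    unfolding rank_two_space_def by (rule matrix_space_module) (rule is_cring)
  note C = rank_two_coord[of _ R a b]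
  have ev: "(x \<oplus>\<^bsub>rank_two_space R a b\<^esub> y) 0 = x 0 \<oplus> y 0"
    "(r \<odot>\<^bsub>rank_two_space R a b\<^esub> x) 0 = r \<otimes> x 0"
    "(x \<oplus>\<^bsub>rank_two_space R a b\<^esub> y) (Suc 0) = x (Suc 0) \<oplus> y (Suc 0)"
    "(r \<odot>\<^bsub>rank_two_space R a b\<^esub> x) (Suc 0) = r \<otimes> x (Suc 0)" for x y r
    by (simp_all add: rank_two_simps)
  show ?thesis
    by (intro form_space.intro M.module_axioms form_space_axioms.intro)
      (simp_all add: rank_two_form ab ev C l_distr r_distr m_ac a_ac)
qed

lemma rank_two_ips:
  assumes ab: "a \<in> carrier R" "b \<in> carrier R" and d: "a \<otimes> b \<ominus> \<one> \<in> Units R"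
  shows "inner_product_space R (rank_two_space R a b)"
proof -
  interpret form_space R "rank_two_space R a b" by (rule rank_two_form_space) fact+
  let ?N = "rank_two_space R a b" and ?d = "inv (a \<otimes> b \<ominus> \<one>)"
  have dc: "?d \<in> carrier R" using d by simp
  let ?e = "\<lambda>r s. \<lambda>i\<in>{..<2::nat}. if i = 0 then r else s"
  have e: "?e r s \<in> carrier ?N" if "r \<in> carrier R" "s \<in> carrier R" for r s
    using that by (auto simp: rank_two_simps)
  let ?u = "\<lambda>k. if k then ?e \<one> \<zero> else ?e \<zero> \<one>"
  \<comment> \<open>These are the rows of the inverse Gram matrix, namely \<open>?d\<close> times
    the rows (b, -1) and (-1, a), where \<open>?d\<close> inverts the determinant.
    \<open>True\<close> stands for coordinate 0 and \<open>False\<close> for coordinate 1.\<close>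
  let ?w = "\<lambda>k. if k then ?e (?d \<otimes> b) (\<ominus> ?d) else ?e (\<ominus> ?d) (?d \<otimes> a)"
  have "dual_family R ?N UNIV ?u ?w"
    unfolding dual_family_def
  proof (intro conjI ballI)
    fix x assume x: "x \<in> carrier ?N"
    have x0: "x 0 \<in> carrier R" "x 1 \<in> carrier R" using rank_two_coord[OF x] by simp_all
    have f0: "form ?N (?w True) x = x 0"
    proof -
      have "form ?N (?w True) x =
        (?d \<otimes> b \<otimes> a \<otimes> x 0 \<oplus> ?d \<otimes> b \<otimes> x 1) \<oplus> (\<ominus> ?d \<otimes> x 0 \<oplus> \<ominus> ?d \<otimes> b \<otimes> x 1)"
        using e x dc ab by (subst rank_two_form) auto
      also have "\<dots> = ?d \<otimes> (a \<otimes> b \<ominus> \<one>) \<otimes> x 0"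
        using dc ab x0 by algebra
      also have "\<dots> = x 0" using d x0 by simp
      finally show ?thesis .
    qed
    have f1: "form ?N (?w False) x = x 1"
    proof -
      have "form ?N (?w False) x =
        (\<ominus> ?d \<otimes> a \<otimes> x 0 \<oplus> \<ominus> ?d \<otimes> x 1) \<oplus> (?d \<otimes> a \<otimes> x 0 \<oplus> ?d \<otimes> a \<otimes> b \<otimes> x 1)"
        using e x dc ab by (subst rank_two_form) auto
      also have "\<dots> = ?d \<otimes> (a \<otimes> b \<ominus> \<one>) \<otimes> x 1"
        using dc ab x0 by algebra
      also have "\<dots> = x 1" using d x0 by simp
      finally show ?thesis .
    qed
    \<comment> \<open>Coordinate 1 comes first because the sum over \<open>bool\<close> is expanded
      in the order \<open>False\<close>, \<open>True\<close>.\<close>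
    have "x = x 1 \<odot>\<^bsub>?N\<^esub> ?e \<zero> \<one> \<oplus>\<^bsub>?N\<^esub> x 0 \<odot>\<^bsub>?N\<^esub> ?e \<one> \<zero>"
      using x x0 by (intro rank_two_ext[of _ "carrier R"]) (auto simp: rank_two_simps)
    also have "\<dots> = (\<Oplus>\<^bsub>?N\<^esub>k\<in>UNIV. form ?N (?w k) x \<odot>\<^bsub>?N\<^esub> ?u k)"
      unfolding UNIV_bool using f0 f1 x0 e[of \<one> \<zero>] e[of \<zero> \<one>] by simp
    finally show "x = \<dots>" .
  qed (use e dc ab in auto)
  then show ?thesis by (rule dual_family_ips)
qed

end

section \<open>Orthogonal sums of finite families\<close>

lemma orth_sum_family_simps:
  "carrier (orth_sum_family R k V) = (\<Pi>\<^sub>E i\<in>{..<k}. carrier (V i))"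
  "\<zero>\<^bsub>orth_sum_family R k V\<^esub> = (\<lambda>i\<in>{..<k}. \<zero>\<^bsub>V i\<^esub>)"
  "x \<oplus>\<^bsub>orth_sum_family R k V\<^esub> y = (\<lambda>i\<in>{..<k}. x i \<oplus>\<^bsub>V i\<^esub> y i)"
  "r \<odot>\<^bsub>orth_sum_family R k V\<^esub> x = (\<lambda>i\<in>{..<k}. r \<odot>\<^bsub>V i\<^esub> x i)"
  "form (orth_sum_family R k V) x y = (\<Oplus>\<^bsub>R\<^esub>i\<in>{..<k}. form (V i) (x i) (y i))"
  by (simp_all add: orth_sum_family_def)

lemma orth_sum_family_zero_carrier:
  "carrier (orth_sum_family R 0 V) = {\<zero>\<^bsub>orth_sum_family R 0 V\<^esub>}"
  by (simp add: orth_sum_family_simps fun_eq_iff)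

lemma orth_sum_family_zero_ips:
  assumes "cring R" shows "inner_product_space R (orth_sum_family R 0 V)"
proof (rule zero_ips[OF zero_form_spaceI[OF assms]])
  interpret cring R by fact
  show "form (orth_sum_family R 0 V) \<zero>\<^bsub>orth_sum_family R 0 V\<^esub> \<zero>\<^bsub>orth_sum_family R 0 V\<^esub> = \<zero>\<^bsub>R\<^esub>"
    by (simp add: orth_sum_family_simps)
qed (auto simp: orth_sum_family_simps)

text \<open>Hypothesis \<open>F\<close> breaks a circle: that the sum of the first \<open>k\<close>
  spaces is an inner product space is itself proved by induction from this lemma.\<close>

lemma orth_sum_family_Suc_aux:
  fixes V :: "nat \<Rightarrow> ('a, 'b) ips"
  assumes F: "inner_product_space R (orth_sum_family R k V)"
    and V: "\<And>i. i \<le> k \<Longrightarrow> inner_product_space R (V i)"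
  shows "isometric R (orth_sum R (orth_sum_family R k V) (V k)) (orth_sum_family R (Suc k) V)"
proof (rule isometric_transfer)
  let ?F = "orth_sum_family R"
  \<comment> \<open>The vector of \<open>V k\<close> is appended as coordinate \<open>k\<close>,
    which extends the domain of an extensional function from \<open>{..<k}\<close> to
    \<open>{..<Suc k}\<close>.\<close>
  let ?f = "\<lambda>p. (fst p)(k := snd p)"
  interpret F: form_space R "?F k V" using ips_form_space[OF F] .
  have FV: "form_space R (V i)" if "i \<le> k" for i using ips_form_space[OF V[OF that]] .
  show "inner_product_space R (orth_sum R (?F k V) (V k))" by (intro orth_sum_ips F V) simp
  have c: "x i \<in> carrier (V i)" if "x \<in> carrier (?F k V)" "i < k" for x i
    using that by (auto simp: orth_sum_family_simps)
  have cl: "?f p \<in> carrier (?F (Suc k) V)" if "p \<in> carrier (orth_sum R (?F k V) (V k))" for p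
    using that by (auto simp: orth_sum_family_simps PiE_def Pi_def extensional_def less_Suc_eq)
  show "?f \<in> form_hom R (orth_sum R (?F k V) (V k)) (?F (Suc k) V)"
  proof (intro form_homI mod_homI)
    fix p q assume p: "p \<in> carrier (orth_sum R (?F k V) (V k))"
      and q: "q \<in> carrier (orth_sum R (?F k V) (V k))"
    obtain x y x' y' where pq: "p = (x, y)" "q = (x', y')" by (cases p; cases q)
    have xy: "x \<in> carrier (?F k V)" "y \<in> carrier (V k)" "x' \<in> carrier (?F k V)" "y' \<in> carrier (V k)"
      using p q pq by auto
    have "form (?F (Suc k) V) (?f p) (?f q) =
      (\<Oplus>\<^bsub>R\<^esub>i\<in>insert k {..<k}. form (V i) ((x(k := y)) i) ((x'(k := y')) i))"
      by (simp add: orth_sum_family_simps pq lessThan_Suc)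
    also have "\<dots> = form (V k) y y' \<oplus>\<^bsub>R\<^esub>
        (\<Oplus>\<^bsub>R\<^esub>i\<in>{..<k}. form (V i) ((x(k := y)) i) ((x'(k := y')) i))"
      using xy c form_space.form_closed[OF FV]
      by (subst F.R.finsum_insert) (auto simp: Pi_def)
    also have "(\<Oplus>\<^bsub>R\<^esub>i\<in>{..<k}. form (V i) ((x(k := y)) i) ((x'(k := y')) i)) = form (?F k V) x x'"
      unfolding orth_sum_family_simps using xy c form_space.form_closed[OF FV]
      by (intro F.R.finsum_cong') (auto simp: Pi_def)
    finally show "form (?F (Suc k) V) (?f p) (?f q) = form (orth_sum R (?F k V) (V k)) p q"
      using xy pq form_space.form_closed[OF FV] by (simp add: F.R.a_comm fun_upd_def)
  next
    fix p assume "p \<in> carrier (orth_sum R (?F k V) (V k))"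
    then show "?f p \<in> carrier (?F (Suc k) V)" by (rule cl)
  next
    fix p q
    show "?f (p \<oplus>\<^bsub>orth_sum R (?F k V) (V k)\<^esub> q) = ?f p \<oplus>\<^bsub>?F (Suc k) V\<^esub> ?f q"
      by (cases p; cases q; rule ext) (simp add: orth_sum_family_simps restrict_def less_Suc_eq)
  next
    fix r p
    show "?f (r \<odot>\<^bsub>orth_sum R (?F k V) (V k)\<^esub> p) = r \<odot>\<^bsub>?F (Suc k) V\<^esub> ?f p"
      by (cases p; rule ext) (simp add: orth_sum_family_simps restrict_def less_Suc_eq)
  qed
  show "?f ` carrier (orth_sum R (?F k V) (V k)) = carrier (?F (Suc k) V)"
  proof (intro subset_antisym subsetI)
    fix z assume z: "z \<in> carrier (?F (Suc k) V)"
    then have z': "z \<in> (\<Pi>\<^sub>E i\<in>{..<Suc k}. carrier (V i))" by (simp add: orth_sum_family_simps)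
    have "z = ?f (restrict z {..<k}, z k)"
    proof
      show "z i = ?f (restrict z {..<k}, z k) i" for i
        using PiE_arb[OF z', of i] by (simp add: restrict_def less_Suc_eq)
    qed
    moreover have "(restrict z {..<k}, z k) \<in> carrier (orth_sum R (?F k V) (V k))"
      using PiE_mem[OF z'] by (simp add: orth_sum_family_simps)
    ultimately show "z \<in> ?f ` carrier (orth_sum R (?F k V) (V k))" by (rule image_eqI)
  next
    fix z assume "z \<in> ?f ` carrier (orth_sum R (?F k V) (V k))"
    then show "z \<in> carrier (?F (Suc k) V)" using cl by blast
  qed
  show "?f \<zero>\<^bsub>orth_sum R (?F k V) (V k)\<^esub> = \<zero>\<^bsub>?F (Suc k) V\<^esub>"
    by (rule ext) (simp add: orth_sum_family_simps restrict_def less_Suc_eq)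
qed

lemma orth_sum_family_ips:
  assumes "cring R" "\<And>i. i < k \<Longrightarrow> inner_product_space R (V i)"
  shows "inner_product_space R (orth_sum_family R k V)"
  using assms(2)
proof (induction k)
  case 0
  show ?case by (rule orth_sum_family_zero_ips) fact
next
  case (Suc k)
  then have "isometric R (orth_sum R (orth_sum_family R k V) (V k)) (orth_sum_family R (Suc k) V)"
    by (intro orth_sum_family_Suc_aux) auto
  then show ?case by (rule isometric_ips)
qed

lemma orth_sum_family_Suc:
  assumes "cring R" "\<And>i. i \<le> k \<Longrightarrow> inner_product_space R (V i)"
  shows "isometric R (orth_sum R (orth_sum_family R k V) (V k)) (orth_sum_family R (Suc k) V)"
  using assms by (intro orth_sum_family_Suc_aux orth_sum_family_ips) auto

lemma orth_sum_family_isometric: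
  assumes R: "cring R" and iso: "\<And>i. i < k \<Longrightarrow> isometric R (V i) (W i)"
  shows "isometric R (orth_sum_family R k V) (orth_sum_family R k W)"
  using iso
proof (induction k)
  case 0
  show ?case
    by (intro isometric_zero orth_sum_family_zero_ips orth_sum_family_zero_carrier R)
next
  case (Suc k)
  have V: "inner_product_space R (V i)" "inner_product_space R (W i)" if "i \<le> k" for i
    using isometric_ips[OF Suc.prems] that by auto
  note SV = orth_sum_family_Suc[OF R, of k]
  have "isometric R (orth_sum R (orth_sum_family R k V) (V k)) (orth_sum R (orth_sum_family R k W) (W k))"
    using Suc by (intro orth_sum_cong) auto
  from isometric_trans[OF isometric_sym[OF SV[OF V(1)]] isometric_trans[OF this SV[OF V(2)]]]
  show ?case by simp
qed

text \<open>The coordinates given by a dual family embed any inner product space into functions on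
  an initial segment of the natural numbers. This is why isometry classes on the single type
  \<open>nat \<Rightarrow> 'a\<close> account for spaces on every carrier type.\<close>

lemma ips_encode:
  fixes V :: "('a, 'b) ips"
  assumes V: "inner_product_space R V"
  obtains X :: "('a, nat \<Rightarrow> 'a) ips" where "isometric R V X"
proof -
  interpret V: form_space R V using ips_form_space[OF V] .
  obtain I :: "'b set" and u w where d: "dual_family R V I u w" using ips_dual_family[OF V] .
  note D = dual_familyD[OF d]
  obtain e and n :: nat where e: "bij_betw e {..<n} I"
    using ex_bij_betw_nat_finite[OF D(1)] by (auto simp: atLeast0LessThan)
  define \<phi> where "\<phi> x = (\<lambda>i\<in>{..<n}. form V (w (e i)) x)" for x
  have inj: "inj_on \<phi> (carrier V)"
  proof (rule inj_onI)
    fix x y assume xy: "x \<in> carrier V" "y \<in> carrier V" "\<phi> x = \<phi> y"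
    have "form V (w i) x = form V (w i) y" if "i \<in> I" for i
    proof -
      from that e obtain j where "j < n" "i = e j" by (auto simp: bij_betw_def)
      then show ?thesis using fun_cong[OF xy(3), of j] by (simp add: \<phi>_def)
    qed
    then have "(\<Oplus>\<^bsub>V\<^esub>i\<in>I. form V (w i) x \<odot>\<^bsub>V\<^esub> u i) = (\<Oplus>\<^bsub>V\<^esub>i\<in>I. form V (w i) y \<odot>\<^bsub>V\<^esub> u i)"
      using D xy by (intro V.M.finsum_cong') auto
    then show "x = y" using D(6) xy by simp
  qed
  define \<psi> where "\<psi> = the_inv_into (carrier V) \<phi>"
  have \<psi>: "\<psi> (\<phi> x) = x" if "x \<in> carrier V" for x
    using inj that by (simp add: \<psi>_def the_inv_into_f_f)
  \<comment> \<open>All operations and the form are transported along \<open>\<phi>\<close>, so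
    \<open>\<phi>\<close> is an isometry by construction and \<open>isometric_transfer\<close>
    supplies the axioms for \<open>X\<close>.\<close>
  define X :: "('a, nat \<Rightarrow> 'a) ips" where "X =
    \<lparr>carrier = \<phi> ` carrier V, mult = undefined, one = undefined, zero = \<phi> \<zero>\<^bsub>V\<^esub>,
     add = (\<lambda>x y. \<phi> (\<psi> x \<oplus>\<^bsub>V\<^esub> \<psi> y)), smult = (\<lambda>r x. \<phi> (r \<odot>\<^bsub>V\<^esub> \<psi> x)),
     form = (\<lambda>x y. form V (\<psi> x) (\<psi> y))\<rparr>"
  have "isometric R V X"
  proof (rule isometric_transfer[OF V])
    show "\<phi> \<in> form_hom R V X" by (intro form_homI mod_homI) (auto simp: X_def \<psi>)
  qed (simp_all add: X_def)
  then show ?thesis by (rule that)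
qed


section \<open>The Grothendieck group of a commutative monoid\<close>

context comm_monoid
begin

lemma grothendieck_rel_iff:
  "((a, b), (c, d)) \<in> grothendieck_rel G \<longleftrightarrow>
    a \<in> carrier G \<and> b \<in> carrier G \<and> c \<in> carrier G \<and> d \<in> carrier G \<and>
    (\<exists>e \<in> carrier G. a \<otimes> d \<otimes> e = c \<otimes> b \<otimes> e)"
  by (simp add: grothendieck_rel_def)

lemma grothendieck_rel_trans:
  assumes "((a, b), (c, d)) \<in> grothendieck_rel G" "((c, d), (f, g)) \<in> grothendieck_rel G"
  shows "((a, b), (f, g)) \<in> grothendieck_rel G"
proof -
  from assms obtain e k where C: "a \<in> carrier G" "b \<in> carrier G" "c \<in> carrier G" "d \<in> carrier G"
      "f \<in> carrier G" "g \<in> carrier G" "e \<in> carrier G" "k \<in> carrier G"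
    and e: "a \<otimes> d \<otimes> e = c \<otimes> b \<otimes> e" and k: "c \<otimes> g \<otimes> k = f \<otimes> d \<otimes> k"
    unfolding grothendieck_rel_iff by blast
  \<comment> \<open>The monoid need not be cancellative, so the intermediate entry \<open>d\<close>
    is kept: the witness is \<open>d\<close> times both given witnesses.\<close>
  have "a \<otimes> g \<otimes> (d \<otimes> e \<otimes> k) = (a \<otimes> d \<otimes> e) \<otimes> (g \<otimes> k)" using C by (simp add: m_ac)
  also have "\<dots> = (c \<otimes> g \<otimes> k) \<otimes> (b \<otimes> e)" unfolding e using C by (simp add: m_ac)
  also have "\<dots> = f \<otimes> b \<otimes> (d \<otimes> e \<otimes> k)" unfolding k using C by (simp add: m_ac)
  finally have "a \<otimes> g \<otimes> (d \<otimes> e \<otimes> k) = f \<otimes> b \<otimes> (d \<otimes> e \<otimes> k)" .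
  then show ?thesis
    unfolding grothendieck_rel_iff using C by (intro conjI bexI[of _ "d \<otimes> e \<otimes> k"]) auto
qed

lemma grothendieck_rel_equiv: "equiv (carrier G \<times> carrier G) (grothendieck_rel G)"
proof (rule equivI)
  show "grothendieck_rel G \<subseteq> (carrier G \<times> carrier G) \<times> carrier G \<times> carrier G"
    by (auto simp: grothendieck_rel_def)
  show "refl_on (carrier G \<times> carrier G) (grothendieck_rel G)"
    by (auto simp: refl_on_def grothendieck_rel_def)
  show "sym (grothendieck_rel G)"
    unfolding sym_def grothendieck_rel_def by clarsimp metis
  show "trans (grothendieck_rel G)"
  proof (rule transI)
    fix x y z assume "(x, y) \<in> grothendieck_rel G" "(y, z) \<in> grothendieck_rel G"
    then show "(x, z) \<in> grothendieck_rel G"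
      using grothendieck_rel_trans by (cases x; cases y; cases z) blast
  qed
qed

definition diff_class :: "'a \<Rightarrow> 'a \<Rightarrow> ('a \<times> 'a) set"
  where "diff_class a b = grothendieck_rel G `` {(a, b)}"

lemma diff_class_eqI:
  assumes "a \<in> carrier G" "b \<in> carrier G" "c \<in> carrier G" "d \<in> carrier G" "a \<otimes> d = c \<otimes> b"
  shows "diff_class a b = diff_class c d"
  unfolding diff_class_def
  by (rule equiv_class_eq[OF grothendieck_rel_equiv])
    (use assms in \<open>auto simp: grothendieck_rel_iff intro!: bexI[of _ \<one>]\<close>)

lemma carrier_grothendieck_group:
  "carrier (grothendieck_group G) = {diff_class a b |a b. a \<in> carrier G \<and> b \<in> carrier G}"
  by (auto simp: grothendieck_group_def quotient_def diff_class_def)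

lemma one_grothendieck_group: "\<one>\<^bsub>grothendieck_group G\<^esub> = diff_class \<one> \<one>"
  by (simp add: grothendieck_group_def diff_class_def)

text \<open>The product is defined as a union over all pairs of representatives. It collapses to one
  class because a change of representatives is witnessed by the product of the two given witnesses,
  and because the classes are non-empty.\<close>

lemma mult_grothendieck_group:
  assumes C: "a \<in> carrier G" "b \<in> carrier G" "c \<in> carrier G" "d \<in> carrier G"
  shows "diff_class a b \<otimes>\<^bsub>grothendieck_group G\<^esub> diff_class c d = diff_class (a \<otimes> c) (b \<otimes> d)"
proof -
  let ?f = "\<lambda>p q. grothendieck_rel G `` {(fst p \<otimes> fst q, snd p \<otimes> snd q)}"
  have eq: "?f (a', b') (c', d') = ?f (a, b) (c, d)"
    if p: "((a, b), (a', b')) \<in> grothendieck_rel G" and q: "((c, d), (c', d')) \<in> grothendieck_rel G"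
    for a' b' c' d'
  proof -
    from p q obtain e k where C': "a' \<in> carrier G" "b' \<in> carrier G" "c' \<in> carrier G" "d' \<in> carrier G"
        "e \<in> carrier G" "k \<in> carrier G"
      and e: "a \<otimes> b' \<otimes> e = a' \<otimes> b \<otimes> e" and k: "c \<otimes> d' \<otimes> k = c' \<otimes> d \<otimes> k"
      unfolding grothendieck_rel_iff by blast
    have "(a \<otimes> c) \<otimes> (b' \<otimes> d') \<otimes> (e \<otimes> k) = (a \<otimes> b' \<otimes> e) \<otimes> (c \<otimes> d' \<otimes> k)"
      using C C' by (simp add: m_ac)
    also have "\<dots> = (a' \<otimes> c') \<otimes> (b \<otimes> d) \<otimes> (e \<otimes> k)"
      unfolding e k using C C' by (simp add: m_ac)
    finally have "(a \<otimes> c) \<otimes> (b' \<otimes> d') \<otimes> (e \<otimes> k) = (a' \<otimes> c') \<otimes> (b \<otimes> d) \<otimes> (e \<otimes> k)" .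
    then have "((a \<otimes> c, b \<otimes> d), (a' \<otimes> c', b' \<otimes> d')) \<in> grothendieck_rel G"
      unfolding grothendieck_rel_iff using C C' by (intro conjI bexI[of _ "e \<otimes> k"]) auto
    from equiv_class_eq[OF grothendieck_rel_equiv this] show ?thesis by simp
  qed
  have self: "(a, b) \<in> diff_class a b" "(c, d) \<in> diff_class c d"
    unfolding diff_class_def using C equiv_class_self[OF grothendieck_rel_equiv] by auto
  have "diff_class a b \<otimes>\<^bsub>grothendieck_group G\<^esub> diff_class c d
      = (\<Union>p\<in>diff_class a b. \<Union>q\<in>diff_class c d. ?f p q)"
    by (simp add: grothendieck_group_def case_prod_beta)
  also have "\<dots> = (\<Union>p\<in>diff_class a b. \<Union>q\<in>diff_class c d. ?f (a, b) (c, d))"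
  proof (intro SUP_cong refl)
    fix p q assume "p \<in> diff_class a b" "q \<in> diff_class c d"
    then show "?f p q = ?f (a, b) (c, d)"
      using eq[of "fst p" "snd p" "fst q" "snd q"] by (simp add: diff_class_def)
  qed
  also have "\<dots> = ?f (a, b) (c, d)" using self by auto
  finally show ?thesis by (simp add: diff_class_def)
qed

lemma comm_group_grothendieck_group: "comm_group (grothendieck_group G)"
proof (rule comm_groupI)
  let ?K = "grothendieck_group G"
  note S = carrier_grothendieck_group one_grothendieck_group
  show "\<one>\<^bsub>?K\<^esub> \<in> carrier ?K" unfolding S by blast
  fix X assume "X \<in> carrier ?K"
  then obtain a b where X: "X = diff_class a b" "a \<in> carrier G" "b \<in> carrier G" unfolding S by blast
  show "\<one>\<^bsub>?K\<^esub> \<otimes>\<^bsub>?K\<^esub> X = X" using X by (simp add: S mult_grothendieck_group)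
  show "\<exists>Y\<in>carrier ?K. Y \<otimes>\<^bsub>?K\<^esub> X = \<one>\<^bsub>?K\<^esub>"
  proof
    show "diff_class b a \<in> carrier ?K" using X unfolding S by blast
    show "diff_class b a \<otimes>\<^bsub>?K\<^esub> X = \<one>\<^bsub>?K\<^esub>"
      unfolding X(1) S mult_grothendieck_group[OF X(3,2,2,3)]
      using X(2,3) by (intro diff_class_eqI) (auto simp: m_comm)
  qed
  fix Y assume "Y \<in> carrier ?K"
  then obtain c d where Y: "Y = diff_class c d" "c \<in> carrier G" "d \<in> carrier G" unfolding S by blast
  show "X \<otimes>\<^bsub>?K\<^esub> Y \<in> carrier ?K"
    unfolding X(1) Y(1) mult_grothendieck_group[OF X(2,3) Y(2,3)] S using X Y by blast
  show "X \<otimes>\<^bsub>?K\<^esub> Y = Y \<otimes>\<^bsub>?K\<^esub> X"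
    using X Y by (simp add: mult_grothendieck_group m_comm)
  fix Z assume "Z \<in> carrier ?K"
  then obtain f g where Z: "Z = diff_class f g" "f \<in> carrier G" "g \<in> carrier G" unfolding S by blast
  show "X \<otimes>\<^bsub>?K\<^esub> Y \<otimes>\<^bsub>?K\<^esub> Z = X \<otimes>\<^bsub>?K\<^esub> (Y \<otimes>\<^bsub>?K\<^esub> Z)"
    using X Y Z by (simp add: mult_grothendieck_group m_assoc)
qed

lemma grothendieck_class_closed:
  "a \<in> carrier G \<Longrightarrow> grothendieck_class G a \<in> carrier (grothendieck_group G)"
  unfolding carrier_grothendieck_group grothendieck_class_def diff_class_def by blast

lemma grothendieck_class_mult:
  assumes "a \<in> carrier G" "b \<in> carrier G"
  shows "grothendieck_class G (a \<otimes> b) =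
    grothendieck_class G a \<otimes>\<^bsub>grothendieck_group G\<^esub> grothendieck_class G b"
  using mult_grothendieck_group[OF assms(1) one_closed assms(2) one_closed]
  by (simp add: grothendieck_class_def diff_class_def)

lemma grothendieck_class_one: "grothendieck_class G \<one> = \<one>\<^bsub>grothendieck_group G\<^esub>"
  by (simp add: grothendieck_class_def grothendieck_group_def)

lemma grothendieck_group_difference:
  assumes "X \<in> carrier (grothendieck_group G)"
  obtains a b where "a \<in> carrier G" "b \<in> carrier G"
    "X = grothendieck_class G a \<otimes>\<^bsub>grothendieck_group G\<^esub>
      inv\<^bsub>grothendieck_group G\<^esub> grothendieck_class G b"
proof -
  interpret K: comm_group "grothendieck_group G" by (rule comm_group_grothendieck_group)
  obtain a b where X: "X = diff_class a b" and ab: "a \<in> carrier G" "b \<in> carrier G"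
    using assms unfolding carrier_grothendieck_group by blast
  \<comment> \<open>Multiplying a formal difference by the class of its second entry leaves the
    class of its first; the group law then solves for \<open>X\<close>.\<close>
  have "X \<otimes>\<^bsub>grothendieck_group G\<^esub> grothendieck_class G b = diff_class (a \<otimes> b) (b \<otimes> \<one>)"
    using mult_grothendieck_group[OF ab ab(2) one_closed] X
    by (simp add: grothendieck_class_def diff_class_def)
  also have "\<dots> = diff_class a \<one>" using ab by (intro diff_class_eqI) auto
  finally have "X \<otimes>\<^bsub>grothendieck_group G\<^esub> grothendieck_class G b = grothendieck_class G a"
    by (simp add: grothendieck_class_def diff_class_def)
  then show ?thesis
    using that[OF ab] assms ab by (metis K.inv_solve_right grothendieck_class_closed)
qed

end


section \<open>The monoid of isometry classes\<close>

lemma isometry_class_eqI: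
  assumes "isometric R V W" shows "isometry_class R V = isometry_class R W"
  unfolding isometry_class_def
  using isometric_trans[OF assms] isometric_trans[OF isometric_sym[OF assms]] by blast

text \<open>\<open>V\<close> and \<open>W\<close> may live on other carrier types and so need not
  belong to their own classes. A common encoded member \<open>X\<close> links them.\<close>

lemma isometry_class_eq_iff:
  assumes "inner_product_space R V"
  shows "isometry_class R V = isometry_class R W \<longleftrightarrow> isometric R V W"
proof
  assume eq: "isometry_class R V = isometry_class R W"
  obtain X :: "('a, nat \<Rightarrow> 'a) ips" where X: "isometric R V X" using ips_encode[OF assms] by blast
  then have "isometric R W X" using eq by (auto simp: isometry_class_def)
  from isometric_trans[OF X isometric_sym[OF this]] show "isometric R V W" .
qed (rule isometry_class_eqI)

lemma isometry_class_closed: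
  assumes "inner_product_space R V"
  shows "isometry_class R V \<in> carrier (isometry_class_monoid R)"
proof -
  obtain X :: "('a, nat \<Rightarrow> 'a) ips" where X: "isometric R V X" using ips_encode[OF assms] by blast
  show ?thesis
    unfolding isometry_class_eqI[OF X] isometry_class_monoid_def using isometric_ips(2)[OF X] by auto
qed

lemma isometry_class_monoidE:
  assumes "A \<in> carrier (isometry_class_monoid R)"
  obtains V :: "('a, nat \<Rightarrow> 'a) ips" where "inner_product_space R V" "A = isometry_class R V"
  using assms by (auto simp: isometry_class_monoid_def)

lemma isometry_class_mult:
  fixes V :: "('a, 'b) ips" and W :: "('a, 'c) ips"
  assumes V: "inner_product_space R V" and W: "inner_product_space R W"
  shows "isometry_class R V \<otimes>\<^bsub>isometry_class_monoid R\<^esub> isometry_class R W =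
    isometry_class R (orth_sum R V W)"
proof -
  obtain X Y :: "('a, nat \<Rightarrow> 'a) ips" where "isometric R V X" "isometric R W Y"
    using ips_encode[OF V] ips_encode[OF W] by metis
  \<comment> \<open>The product of classes is a union over members; it yields the expected class
    only if both index sets are inhabited, which the encodings guarantee.\<close>
  then have ne: "isometry_class R V \<noteq> {}" "isometry_class R W \<noteq> {}"
    by (auto simp: isometry_class_def)
  have "isometry_class R V \<otimes>\<^bsub>isometry_class_monoid R\<^esub> isometry_class R W =
      (\<Union>V'\<in>isometry_class R V. \<Union>W'\<in>isometry_class R W. isometry_class R (orth_sum R V' W'))"
    by (simp add: isometry_class_monoid_def)
  also have "\<dots> = (\<Union>V'\<in>isometry_class R V. \<Union>W'\<in>isometry_class R W. isometry_class R (orth_sum R V W))"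
  proof (intro SUP_cong refl)
    fix V' W' :: "('a, nat \<Rightarrow> 'a) ips"
    assume "V' \<in> isometry_class R V" "W' \<in> isometry_class R W"
    then have "isometric R (orth_sum R V W) (orth_sum R V' W')"
      by (intro orth_sum_cong) (auto simp: isometry_class_def)
    from isometry_class_eqI[OF this]
    show "isometry_class R (orth_sum R V' W') = isometry_class R (orth_sum R V W)" by simp
  qed
  also have "\<dots> = isometry_class R (orth_sum R V W)" using ne by simp
  finally show ?thesis .
qed

lemma isometry_class_one:
  assumes "cring R" "inner_product_space R Z" "carrier Z = {\<zero>\<^bsub>Z\<^esub>}"
  shows "isometry_class R Z = \<one>\<^bsub>isometry_class_monoid R\<^esub>"
  using isometry_class_eqI[OF isometric_zero[OF assms(2,3) matrix_space_zero_ips[OF assms(1)]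
    matrix_space_zero_carrier]] by (simp add: isometry_class_monoid_def)

text \<open>Regrouping and reordering of orthogonal summands, which are isometries between different
  carrier types, become rewriting in a commutative monoid.\<close>

lemma isometry_class_comm_monoid:
  fixes R :: "('a, 'm) ring_scheme"
  assumes R: "cring R"
  shows "comm_monoid (isometry_class_monoid R)"
proof (rule comm_monoidI)
  let ?M = "isometry_class_monoid R" and ?Z = "matrix_space R 0 (\<lambda>_ _. \<zero>\<^bsub>R\<^esub>)"
  note Z = matrix_space_zero_ips[OF R, of "\<lambda>_ _. \<zero>\<^bsub>R\<^esub>"]
  have one: "\<one>\<^bsub>?M\<^esub> = isometry_class R ?Z" by (simp add: isometry_class_monoid_def)
  show "\<one>\<^bsub>?M\<^esub> \<in> carrier ?M" unfolding one by (intro isometry_class_closed Z)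
  fix A assume "A \<in> carrier ?M"
  then obtain U :: "('a, nat \<Rightarrow> 'a) ips" where U: "inner_product_space R U" "A = isometry_class R U"
    by (rule isometry_class_monoidE)
  have "isometric R (orth_sum R ?Z U) U"
    by (rule isometric_trans[OF orth_sum_comm[OF Z U(1)] orth_sum_zero_right[OF U(1) Z]])
      (rule matrix_space_zero_carrier)
  then show "\<one>\<^bsub>?M\<^esub> \<otimes>\<^bsub>?M\<^esub> A = A"
    unfolding one U(2) isometry_class_mult[OF Z U(1)] by (rule isometry_class_eqI)
  fix B assume "B \<in> carrier ?M"
  then obtain V :: "('a, nat \<Rightarrow> 'a) ips" where V: "inner_product_space R V" "B = isometry_class R V"
    by (rule isometry_class_monoidE)
  show "A \<otimes>\<^bsub>?M\<^esub> B \<in> carrier ?M"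
    unfolding U(2) V(2) isometry_class_mult[OF U(1) V(1)]
    by (intro isometry_class_closed orth_sum_ips U V)
  show "A \<otimes>\<^bsub>?M\<^esub> B = B \<otimes>\<^bsub>?M\<^esub> A"
    unfolding U(2) V(2) isometry_class_mult[OF U(1) V(1)] isometry_class_mult[OF V(1) U(1)]
    by (rule isometry_class_eqI[OF orth_sum_comm[OF U(1) V(1)]])
  fix C assume "C \<in> carrier ?M"
  then obtain W :: "('a, nat \<Rightarrow> 'a) ips" where W: "inner_product_space R W" "C = isometry_class R W"
    by (rule isometry_class_monoidE)
  show "A \<otimes>\<^bsub>?M\<^esub> B \<otimes>\<^bsub>?M\<^esub> C = A \<otimes>\<^bsub>?M\<^esub> (B \<otimes>\<^bsub>?M\<^esub> C)"
    unfolding U(2) V(2) W(2) isometry_class_mult[OF U(1) V(1)] isometry_class_mult[OF V(1) W(1)]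
      isometry_class_mult[OF orth_sum_ips[OF U(1) V(1)] W(1)]
      isometry_class_mult[OF U(1) orth_sum_ips[OF V(1) W(1)]]
    by (rule isometry_class_eqI[OF orth_sum_assoc[OF U(1) V(1) W(1)]])
qed


section \<open>Splitting off orthogonal summands\<close>

text \<open>Orthogonality of the two images removes the cross terms. The lemma serves both for
  splitting off a subspace and for assembling the diagonal form of a stabilised plane.\<close>

lemma form_hom_orth_sum:
  assumes A: "form_space R A" and B: "form_space R B" and V: "form_space R V"
    and \<alpha>: "\<alpha> \<in> form_hom R A V" and \<beta>: "\<beta> \<in> form_hom R B V"
    and orth: "\<And>x y. \<lbrakk>x \<in> carrier A; y \<in> carrier B\<rbrakk> \<Longrightarrow> form V (\<alpha> x) (\<beta> y) = \<zero>\<^bsub>R\<^esub>"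
  shows "(\<lambda>p. \<alpha> (fst p) \<oplus>\<^bsub>V\<^esub> \<beta> (snd p)) \<in> form_hom R (orth_sum R A B) V"
proof -
  interpret A: form_space R A by fact
  interpret B: form_space R B by fact
  interpret V: form_space R V by fact
  note F = form_homD[OF \<alpha>] and G = form_homD[OF \<beta>]
  show ?thesis
  proof (intro form_homI mod_homI)
    fix p q assume "p \<in> carrier (orth_sum R A B)" "q \<in> carrier (orth_sum R A B)"
    then obtain x y x' y' where pq: "p = (x, y)" "q = (x', y')" "x \<in> carrier A" "y \<in> carrier B"
      "x' \<in> carrier A" "y' \<in> carrier B" by auto
    have "form V (\<beta> y) (\<alpha> x') = \<zero>\<^bsub>R\<^esub>"
      using orth[of x' y] pq F(3) G(3) V.form_sym by metis
    then show "form V (\<alpha> (fst p) \<oplus>\<^bsub>V\<^esub> \<beta> (snd p)) (\<alpha> (fst q) \<oplus>\<^bsub>V\<^esub> \<beta> (snd q)) = form (orth_sum R A B) p q"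
      using pq orth[of x y'] by (simp add: F(2,3) G(2,3) V.form_add_left V.form_add_right)
    show "\<alpha> (fst (p \<oplus>\<^bsub>orth_sum R A B\<^esub> q)) \<oplus>\<^bsub>V\<^esub> \<beta> (snd (p \<oplus>\<^bsub>orth_sum R A B\<^esub> q)) =
        \<alpha> (fst p) \<oplus>\<^bsub>V\<^esub> \<beta> (snd p) \<oplus>\<^bsub>V\<^esub> (\<alpha> (fst q) \<oplus>\<^bsub>V\<^esub> \<beta> (snd q))"
      using pq by (simp add: F(3,4) G(3,4) V.M.a_ac)
  next
    fix r p assume "r \<in> carrier R" "p \<in> carrier (orth_sum R A B)"
    then show "\<alpha> (fst (r \<odot>\<^bsub>orth_sum R A B\<^esub> p)) \<oplus>\<^bsub>V\<^esub> \<beta> (snd (r \<odot>\<^bsub>orth_sum R A B\<^esub> p)) =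
        r \<odot>\<^bsub>V\<^esub> (\<alpha> (fst p) \<oplus>\<^bsub>V\<^esub> \<beta> (snd p))"
      by (cases p) (simp add: F(3,5) G(3,5) V.smult_r_distr)
  qed (auto simp: F G)
qed

lemma (in form_space) orthogonal_complement_form_space:
  assumes "S \<subseteq> carrier V"
  shows "form_space R (V\<lparr>carrier := {x \<in> carrier V. \<forall>y\<in>S. form V x y = \<zero>}\<rparr>)"
proof -
  let ?U = "{x \<in> carrier V. \<forall>y\<in>S. form V x y = \<zero>}"
  have sub: "submodule ?U R V"
    using assms by (intro submoduleI) (auto simp: form_minus_left form_add_left form_smult_left subset_iff)
  have M: "module R (V\<lparr>carrier := ?U\<rparr>)"
    by (rule submodule.submodule_is_module[OF sub module_axioms])
  show ?thesis
    by (intro form_space.intro M form_space_axioms.intro)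
      (auto simp: form_add_left form_smult_left intro: form_sym)
qed

text \<open>Non-degeneracy of \<open>E\<close> gives \<open>\<alpha>\<close> an adjoint
  \<open>q\<close> that is also a left inverse. Hence \<open>\<alpha>\<close> after \<open>q\<close>
  is the orthogonal projection onto the image, and \<open>p\<close> is the complementary one. It
  kills each \<open>u i\<close> in the image, so those indices leave the family.\<close>

lemma orthogonal_splitting:
  fixes V :: "('a, 'b) ips" and E :: "('a, 'c) ips"
  assumes E: "inner_product_space R E" and V: "form_space R V"
    and \<alpha>: "\<alpha> \<in> form_hom R E V" and dual: "dual_family R V I u w"
  obtains V' :: "('a, 'b) ips" and u' w' where
    "isometric R V (orth_sum R E V')" "inner_product_space R V'" "dual_family R V' {i \<in> I. u i \<notin> \<alpha> ` carrier E} u' w'"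
proof -
  interpret V: form_space R V by fact
  interpret E: inner_product_space R E by fact
  interpret EF: form_space R E using ips_form_space[OF E] .
  note F = form_homD[OF \<alpha>] and D = dual_familyD[OF dual]
  have "\<exists>y\<in>carrier E. \<forall>e\<in>carrier E. form E y e = form V x (\<alpha> e)" if x: "x \<in> carrier V" for x
  proof -
    have "(\<lambda>e\<in>carrier E. form V x (\<alpha> e)) \<in> linear_dual R E"
      unfolding linear_dual_def using x by (auto simp: F V.form_add_right V.form_smult_right)
    then obtain y where y: "y \<in> carrier E"
      "(\<lambda>e\<in>carrier E. form E y e) = (\<lambda>e\<in>carrier E. form V x (\<alpha> e))"
      using E.nondegenerate unfolding bij_betw_def by (metis (no_types, lifting) imageE)
    have "form E y e = form V x (\<alpha> e)" if "e \<in> carrier E" for e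
      using fun_cong[OF y(2), of e] that by simp
    with y(1) show ?thesis by blast
  qed
  \<comment> \<open>\<open>q x\<close> represents the functional that pairs \<open>x\<close> with
    \<open>\<alpha> e\<close>. Such a vector of \<open>E\<close> is unique, so linearity of
    \<open>q\<close> and \<open>q (\<alpha> e) = e\<close> are checked by pairing.\<close>
  then obtain q where q: "\<And>x. x \<in> carrier V \<Longrightarrow> q x \<in> carrier E"
    "\<And>x e. \<lbrakk>x \<in> carrier V; e \<in> carrier E\<rbrakk> \<Longrightarrow> form E (q x) e = form V x (\<alpha> e)" by metis
  have q_add: "q (x \<oplus>\<^bsub>V\<^esub> y) = q x \<oplus>\<^bsub>E\<^esub> q y" if "x \<in> carrier V" "y \<in> carrier V" for x y
    using that by (intro ips_cancel[OF E]) (auto simp: q EF.form_add_left V.form_add_left F)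
  have q_smult: "q (r \<odot>\<^bsub>V\<^esub> x) = r \<odot>\<^bsub>E\<^esub> q x" if "r \<in> carrier R" "x \<in> carrier V" for r x
    using that by (intro ips_cancel[OF E]) (auto simp: q EF.form_smult_left V.form_smult_left F)
  have q_\<alpha>: "q (\<alpha> e) = e" if "e \<in> carrier E" for e
    using that by (intro ips_cancel[OF E]) (auto simp: q F)
  define U where "U = {x \<in> carrier V. \<forall>y\<in>\<alpha> ` carrier E. form V x y = \<zero>\<^bsub>R\<^esub>}"
  define V' where "V' = V\<lparr>carrier := U\<rparr>"
  interpret V': form_space R V'
    unfolding V'_def U_def using F(3) by (intro V.orthogonal_complement_form_space) auto
  have V's: "carrier V' = U" "add V' = add V" "smult V' = smult V" "form V' = form V" "zero V' = zero V"
    by (simp_all add: V'_def)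
  have U: "x \<in> carrier V" "\<And>e. e \<in> carrier E \<Longrightarrow> form V x (\<alpha> e) = \<zero>\<^bsub>R\<^esub>"
    "\<And>e. e \<in> carrier E \<Longrightarrow> form V (\<alpha> e) x = \<zero>\<^bsub>R\<^esub>" if "x \<in> U" for x
    using that V.form_sym F(3) by (auto simp: U_def)
  define p where "p x = x \<oplus>\<^bsub>V\<^esub> \<ominus>\<^bsub>V\<^esub> \<alpha> (q x)" for x
  have pV: "p x \<in> carrier V" if "x \<in> carrier V" for x using that by (simp add: p_def q F)
  have pU: "p x \<in> U" if "x \<in> carrier V" for x
    using that unfolding U_def
    by (auto simp: p_def q F V.form_add_left V.form_minus_left V.R.r_neg)
  have p_hom: "p \<in> mod_hom R V V'"
    by (rule mod_homI)
      (auto simp: V's pU[unfolded p_def] p_def q q_add q_smult F V.M.minus_add V.M.a_ac V.smult_r_distr V.smult_r_minus)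
  have q_U: "q x = \<zero>\<^bsub>E\<^esub>" if "x \<in> U" for x
    using U[OF that] by (intro ips_cancel[OF E]) (auto simp: q)
  have p_U: "p x = x" if "x \<in> U" for x
    using U[OF that] mod_hom_zero[OF E.module_axioms V.module_axioms F(1)]
    by (simp add: p_def q_U[OF that])
  have p_\<alpha>: "p (\<alpha> e) = \<zero>\<^bsub>V\<^esub>" if "e \<in> carrier E" for e
    using that by (simp add: p_def q_\<alpha> F V.M.r_neg)
  let ?J = "{i \<in> I. u i \<notin> \<alpha> ` carrier E}"
  have "dual_family R V' ?J (p \<circ> u) (p \<circ> w)"
    unfolding dual_family_def
  proof (intro conjI ballI)
    fix x assume "x \<in> carrier V'"
    then have xU: "x \<in> U" and x: "x \<in> carrier V" using U by (auto simp: V's)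
    \<comment> \<open>Projecting \<open>w i\<close> changes it by a vector of the image of
      \<open>\<alpha>\<close>, to which \<open>x\<close> is orthogonal.\<close>
    have fw: "form V (p (w i)) x = form V (w i) x" if "i \<in> I" for i
      using that x D(5) U(3)[OF xU]
      by (simp add: p_def q F V.form_add_left V.form_minus_left)
    have "x = p (\<Oplus>\<^bsub>V\<^esub>i\<in>I. form V (w i) x \<odot>\<^bsub>V\<^esub> u i)" using D(6)[OF x] p_U[OF xU] by simp
    also have "\<dots> = (\<Oplus>\<^bsub>V'\<^esub>i\<in>I. form V (w i) x \<odot>\<^bsub>V'\<^esub> p (u i))"
      using D x by (intro mod_hom_lincomb[OF V.module_axioms V'.module_axioms p_hom]) auto
    also have "\<dots> = (\<Oplus>\<^bsub>V'\<^esub>i\<in>?J. form V' ((p \<circ> w) i) x \<odot>\<^bsub>V'\<^esub> (p \<circ> u) i)"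
    proof (rule V'.M.add.finprod_mono_neutral_cong_right)
      show "form V (w i) x \<odot>\<^bsub>V'\<^esub> p (u i) = \<zero>\<^bsub>V'\<^esub>" if "i \<in> I - ?J" for i
        using that p_\<alpha> D(5) x by (auto simp: V's)
      show "(\<lambda>i. form V (w i) x \<odot>\<^bsub>V'\<^esub> p (u i)) \<in> I \<rightarrow> carrier V'"
        using pU D(4,5) x by (auto simp: V's(1)[symmetric])
    qed (use D fw in \<open>auto simp: V's\<close>)
    finally show "x = (\<Oplus>\<^bsub>V'\<^esub>i\<in>?J. form V' ((p \<circ> w) i) x \<odot>\<^bsub>V'\<^esub> (p \<circ> u) i)" .
  qed (use D pU in \<open>auto simp: V's\<close>)
  moreover from this have V'_ips: "inner_product_space R V'" by (rule V'.dual_family_ips)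
  moreover have "isometric R (orth_sum R E V') V"
  proof (rule isometric_transfer)
    let ?f = "\<lambda>z. \<alpha> (fst z) \<oplus>\<^bsub>V\<^esub> (\<lambda>x. x) (snd z)"
    show "inner_product_space R (orth_sum R E V')" by (intro orth_sum_ips E V'_ips)
    show "?f \<in> form_hom R (orth_sum R E V') V"
    proof (rule form_hom_orth_sum[OF EF.form_space_axioms V'.form_space_axioms V.form_space_axioms \<alpha>])
      show "(\<lambda>x. x) \<in> form_hom R V' V"
        by (intro form_homI mod_homI) (auto simp: V's U)
    qed (auto simp: V's U)
    show "?f ` carrier (orth_sum R E V') = carrier V"
    proof (intro subset_antisym subsetI)
      fix x assume x: "x \<in> carrier V"
      have "x = \<alpha> (q x) \<oplus>\<^bsub>V\<^esub> p x" using x q F V.M.add.m_lcomm V.M.r_neg by (simp add: p_def)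
      then show "x \<in> ?f ` carrier (orth_sum R E V')"
        using x q pU by (intro image_eqI[of _ _ "(q x, p x)"]) (auto simp: V's)
    qed (auto simp: V's U F)
    show "?f \<zero>\<^bsub>orth_sum R E V'\<^esub> = \<zero>\<^bsub>V\<^esub>"
      using mod_hom_zero[OF E.module_axioms V.module_axioms F(1)] by (simp add: V's)
  qed
  ultimately show ?thesis using that isometric_sym by blast
qed

text \<open>The Nakayama step: the relation for \<open>u i\<close> can be solved for \<open>u i\<close>.\<close>

lemma dual_family_drop:
  assumes V: "form_space R V" and dual: "dual_family R V I u w" and i: "i \<in> I"
    and unit: "\<one>\<^bsub>R\<^esub> \<ominus>\<^bsub>R\<^esub> form V (w i) (u i) \<in> Units R"
  obtains w' where "dual_family R V (I - {i}) u w'"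
proof -
  interpret form_space R V by fact
  note D = dual_familyD[OF dual]
  define s where "s = inv\<^bsub>R\<^esub> (\<one>\<^bsub>R\<^esub> \<ominus>\<^bsub>R\<^esub> form V (w i) (u i))"
  have s: "s \<in> carrier R" "s \<otimes>\<^bsub>R\<^esub> (\<one>\<^bsub>R\<^esub> \<ominus>\<^bsub>R\<^esub> form V (w i) (u i)) = \<one>\<^bsub>R\<^esub>"
    using unit by (simp_all add: s_def)
  let ?J = "I - {i}" and ?t = "form V (w i) (u i)"
  let ?c = "\<lambda>j. s \<otimes>\<^bsub>R\<^esub> form V (w j) (u i)"
  \<comment> \<open>Replacing \<open>u i\<close> by its expression with coefficients
    \<open>?c j\<close> turns the coefficient of \<open>u j\<close> in \<open>x\<close> into
    \<open>form V (w j) x\<close> plus \<open>?c j\<close> times \<open>form V (w i) x\<close>,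
    which is the pairing with this vector.\<close>
  let ?w = "\<lambda>j. w j \<oplus>\<^bsub>V\<^esub> ?c j \<odot>\<^bsub>V\<^esub> w i"
  have ui: "u i \<in> carrier V" "w i \<in> carrier V" "?t \<in> carrier R" using D i by auto
  have split: "x = form V (w i) x \<odot>\<^bsub>V\<^esub> u i \<oplus>\<^bsub>V\<^esub> (\<Oplus>\<^bsub>V\<^esub>j\<in>?J. form V (w j) x \<odot>\<^bsub>V\<^esub> u j)"
    if x: "x \<in> carrier V" for x
  proof -
    have "x = (\<Oplus>\<^bsub>V\<^esub>j\<in>insert i ?J. form V (w j) x \<odot>\<^bsub>V\<^esub> u j)"
      using D(6)[OF x] i by (simp add: insert_absorb)
    also have "\<dots> = form V (w i) x \<odot>\<^bsub>V\<^esub> u i \<oplus>\<^bsub>V\<^esub> (\<Oplus>\<^bsub>V\<^esub>j\<in>?J. form V (w j) x \<odot>\<^bsub>V\<^esub> u j)"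
      using D(1,4,5) x i by (intro M.finsum_insert) auto
    finally show ?thesis .
  qed
  have cl: "(\<Oplus>\<^bsub>V\<^esub>j\<in>?J. form V (w j) x \<odot>\<^bsub>V\<^esub> u j) \<in> carrier V" if "x \<in> carrier V" for x
    using that D by (intro lincomb_closed) auto
  let ?S = "\<Oplus>\<^bsub>V\<^esub>j\<in>?J. form V (w j) (u i) \<odot>\<^bsub>V\<^esub> u j"
  have "(\<one>\<^bsub>R\<^esub> \<ominus>\<^bsub>R\<^esub> ?t) \<odot>\<^bsub>V\<^esub> u i = u i \<oplus>\<^bsub>V\<^esub> \<ominus>\<^bsub>V\<^esub> (?t \<odot>\<^bsub>V\<^esub> u i)"
    using ui by (simp add: R.minus_eq smult_l_distr smult_l_minus)
  also have "\<dots> = (?t \<odot>\<^bsub>V\<^esub> u i \<oplus>\<^bsub>V\<^esub> ?S) \<oplus>\<^bsub>V\<^esub> \<ominus>\<^bsub>V\<^esub> (?t \<odot>\<^bsub>V\<^esub> u i)"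
    using split[OF ui(1)] by simp
  also have "\<dots> = ?S"
    using ui cl[OF ui(1)] by (simp add: M.a_comm[of "?t \<odot>\<^bsub>V\<^esub> u i"] M.a_assoc M.r_neg)
  finally have "s \<odot>\<^bsub>V\<^esub> ((\<one>\<^bsub>R\<^esub> \<ominus>\<^bsub>R\<^esub> ?t) \<odot>\<^bsub>V\<^esub> u i) = s \<odot>\<^bsub>V\<^esub> ?S" by simp
  then have "u i = s \<odot>\<^bsub>V\<^esub> ?S"
    using s ui by (subst (asm) smult_assoc1[symmetric]) auto
  also have "\<dots> = (\<Oplus>\<^bsub>V\<^esub>j\<in>?J. s \<odot>\<^bsub>V\<^esub> (form V (w j) (u i) \<odot>\<^bsub>V\<^esub> u j))"
    using D s ui by (intro finsum_smult_ldistr) auto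
  also have "\<dots> = (\<Oplus>\<^bsub>V\<^esub>j\<in>?J. ?c j \<odot>\<^bsub>V\<^esub> u j)"
    using D s ui by (intro M.finsum_cong') (auto simp: smult_assoc1)
  finally have sol: "u i = (\<Oplus>\<^bsub>V\<^esub>j\<in>?J. ?c j \<odot>\<^bsub>V\<^esub> u j)" .
  have "dual_family R V ?J u ?w"
    unfolding dual_family_def
  proof (intro conjI ballI)
    fix x assume x: "x \<in> carrier V"
    have c: "?c j \<in> carrier R" if "j \<in> ?J" for j using that D s ui by auto
    have "form V (w i) x \<odot>\<^bsub>V\<^esub> u i = form V (w i) x \<odot>\<^bsub>V\<^esub> (\<Oplus>\<^bsub>V\<^esub>j\<in>?J. ?c j \<odot>\<^bsub>V\<^esub> u j)"
      using sol by simp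
    also have "\<dots> = (\<Oplus>\<^bsub>V\<^esub>j\<in>?J. form V (w i) x \<odot>\<^bsub>V\<^esub> (?c j \<odot>\<^bsub>V\<^esub> u j))"
      using D x ui c by (intro finsum_smult_ldistr) auto
    finally have "x = (\<Oplus>\<^bsub>V\<^esub>j\<in>?J. form V (w i) x \<odot>\<^bsub>V\<^esub> (?c j \<odot>\<^bsub>V\<^esub> u j)) \<oplus>\<^bsub>V\<^esub>
        (\<Oplus>\<^bsub>V\<^esub>j\<in>?J. form V (w j) x \<odot>\<^bsub>V\<^esub> u j)"
      using split[OF x] by simp
    also have "\<dots> = (\<Oplus>\<^bsub>V\<^esub>j\<in>?J. form V (w i) x \<odot>\<^bsub>V\<^esub> (?c j \<odot>\<^bsub>V\<^esub> u j) \<oplus>\<^bsub>V\<^esub> form V (w j) x \<odot>\<^bsub>V\<^esub> u j)"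
      using D x ui c by (intro M.finsum_addf[symmetric]) auto
    also have "\<dots> = (\<Oplus>\<^bsub>V\<^esub>j\<in>?J. form V (?w j) x \<odot>\<^bsub>V\<^esub> u j)"
    proof (intro M.finsum_cong' refl)
      fix j assume j: "j \<in> ?J"
      have C: "u j \<in> carrier V" "w j \<in> carrier V" using j D by auto
      have "form V (?w j) x = form V (w i) x \<otimes>\<^bsub>R\<^esub> ?c j \<oplus>\<^bsub>R\<^esub> form V (w j) x"
        using x ui c[OF j] C by (simp add: form_add_left form_smult_left R.m_comm[of "?c j"] R.a_comm)
      then show "form V (w i) x \<odot>\<^bsub>V\<^esub> (?c j \<odot>\<^bsub>V\<^esub> u j) \<oplus>\<^bsub>V\<^esub> form V (w j) x \<odot>\<^bsub>V\<^esub> u j = form V (?w j) x \<odot>\<^bsub>V\<^esub> u j"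
        using x ui c[OF j] C by (simp add: smult_l_distr smult_assoc1)
    qed (use x ui c D in auto)
    finally show "x = (\<Oplus>\<^bsub>V\<^esub>j\<in>?J. form V (?w j) x \<odot>\<^bsub>V\<^esub> u j)" .
  qed (use D s ui in auto)
  then show ?thesis by (rule that)
qed

section \<open>Lines and planes mapped into a form space\<close>

context form_space
begin

lemma rank_one_form_hom:
  assumes "e \<in> carrier V" "form V e e = u"
  shows "(\<lambda>y. y 0 \<odot>\<^bsub>V\<^esub> e) \<in> form_hom R (rank_one_space R u) V"
proof -
  have u: "u \<in> carrier R" using assms by auto
  have C: "x 0 \<in> carrier R" if "x \<in> carrier (rank_one_space R u)" for x
    using that by (auto simp: rank_one_simps)
  show ?thesis
  proof (intro form_homI mod_homI)
    fix x y assume xy: "x \<in> carrier (rank_one_space R u)" "y \<in> carrier (rank_one_space R u)"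
    show "form V (x 0 \<odot>\<^bsub>V\<^esub> e) (y 0 \<odot>\<^bsub>V\<^esub> e) = form (rank_one_space R u) x y"
      using xy assms u C[OF xy(1)] C[OF xy(2)]
      by (simp add: form_smult_left form_smult_right R.rank_one_form R.m_ac)
    show "(x \<oplus>\<^bsub>rank_one_space R u\<^esub> y) 0 \<odot>\<^bsub>V\<^esub> e = x 0 \<odot>\<^bsub>V\<^esub> e \<oplus>\<^bsub>V\<^esub> y 0 \<odot>\<^bsub>V\<^esub> e"
      using xy assms C by (simp add: rank_one_simps(3) smult_l_distr)
  next
    fix r x assume "r \<in> carrier R" "x \<in> carrier (rank_one_space R u)"
    then show "(r \<odot>\<^bsub>rank_one_space R u\<^esub> x) 0 \<odot>\<^bsub>V\<^esub> e = r \<odot>\<^bsub>V\<^esub> (x 0 \<odot>\<^bsub>V\<^esub> e)"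
      using assms C by (simp add: rank_one_simps(4) smult_assoc1)
  qed (use assms C in auto)
qed

lemma rank_two_form_hom:
  assumes f: "f \<in> carrier V" and g: "g \<in> carrier V"
    and "form V f f = a" "form V f g = \<one>" "form V g g = b"
  shows "(\<lambda>y. y 0 \<odot>\<^bsub>V\<^esub> f \<oplus>\<^bsub>V\<^esub> y 1 \<odot>\<^bsub>V\<^esub> g) \<in> form_hom R (rank_two_space R a b) V"
proof -
  have ab: "a \<in> carrier R" "b \<in> carrier R" using assms by auto
  have gf: "form V g f = \<one>" using assms form_sym by metis
  note C = rank_two_coord[of _ R a b]
  have ev: "(x \<oplus>\<^bsub>rank_two_space R a b\<^esub> y) 0 = x 0 \<oplus> y 0"
    "(r \<odot>\<^bsub>rank_two_space R a b\<^esub> x) 0 = r \<otimes> x 0"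
    "(x \<oplus>\<^bsub>rank_two_space R a b\<^esub> y) (Suc 0) = x (Suc 0) \<oplus> y (Suc 0)"
    "(r \<odot>\<^bsub>rank_two_space R a b\<^esub> x) (Suc 0) = r \<otimes> x (Suc 0)" for x y r
    by (simp_all add: rank_two_simps)
  show ?thesis
  proof (intro form_homI mod_homI)
    fix x y assume xy: "x \<in> carrier (rank_two_space R a b)" "y \<in> carrier (rank_two_space R a b)"
    note C' = C[OF xy(1)] C[OF xy(2)]
    show "form V (x 0 \<odot>\<^bsub>V\<^esub> f \<oplus>\<^bsub>V\<^esub> x 1 \<odot>\<^bsub>V\<^esub> g) (y 0 \<odot>\<^bsub>V\<^esub> f \<oplus>\<^bsub>V\<^esub> y 1 \<odot>\<^bsub>V\<^esub> g) = form (rank_two_space R a b) x y"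
      using xy assms gf ab C'
      by (simp add: form_add_left form_add_right form_smult_left form_smult_right R.rank_two_form
          R.m_ac R.a_ac R.r_distr)
    show "(x \<oplus>\<^bsub>rank_two_space R a b\<^esub> y) 0 \<odot>\<^bsub>V\<^esub> f \<oplus>\<^bsub>V\<^esub> (x \<oplus>\<^bsub>rank_two_space R a b\<^esub> y) 1 \<odot>\<^bsub>V\<^esub> g =
        x 0 \<odot>\<^bsub>V\<^esub> f \<oplus>\<^bsub>V\<^esub> x 1 \<odot>\<^bsub>V\<^esub> g \<oplus>\<^bsub>V\<^esub> (y 0 \<odot>\<^bsub>V\<^esub> f \<oplus>\<^bsub>V\<^esub> y 1 \<odot>\<^bsub>V\<^esub> g)"
      using f g C' by (simp add: ev smult_l_distr M.a_ac)
  next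
    fix r x assume "r \<in> carrier R" "x \<in> carrier (rank_two_space R a b)"
    then show "(r \<odot>\<^bsub>rank_two_space R a b\<^esub> x) 0 \<odot>\<^bsub>V\<^esub> f \<oplus>\<^bsub>V\<^esub> (r \<odot>\<^bsub>rank_two_space R a b\<^esub> x) 1 \<odot>\<^bsub>V\<^esub> g =
        r \<odot>\<^bsub>V\<^esub> (x 0 \<odot>\<^bsub>V\<^esub> f \<oplus>\<^bsub>V\<^esub> x 1 \<odot>\<^bsub>V\<^esub> g)"
      using f g C[of x] by (simp add: ev smult_assoc1 smult_r_distr)
  qed (use f g C in auto)
qed

end


section \<open>Local rings\<close>

text \<open>\<open>local_ring\<close> says that \<open>\<mm>\<close> is the only maximal ideal. To
  conclude that all non-units lie in it, every non-unit must be placed in some maximal ideal, and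
  this takes Zorn's lemma.\<close>

lemma (in cring) nonunit_in_maximalideal:
  assumes x: "x \<in> carrier R" "x \<notin> Units R"
  obtains I where "maximalideal I R" "x \<in> I"
proof -
  \<comment> \<open>A member that is maximal under inclusion is a maximal ideal: a larger ideal
    still contains \<open>x\<close>, so it can leave this set only by containing
    \<open>\<one>\<close>.\<close>
  let ?A = "{I. ideal I R \<and> x \<in> I \<and> \<one> \<notin> I}"
  have "\<one> \<notin> PIdl x"
  proof
    assume "\<one> \<in> PIdl x"
    then obtain y where y: "y \<in> carrier R" "\<one> = y \<otimes> x" by (auto simp: cgenideal_def)
    then have "x \<otimes> y = \<one>" using x(1) m_comm by simp
    then show False using x y unfolding Units_def by auto
  qed
  then have ne: "?A \<noteq> {}" using cgenideal_ideal[OF x(1)] cgenideal_self[OF x(1)] by blast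
  have "\<Union>C \<in> ?A" if C: "C \<noteq> {}" "subset.chain ?A C" for C
  proof -
    have id: "ideal I R" if "I \<in> C" for I using C(2) that unfolding subset.chain_def by auto
    note add_id = additive_subgroup.a_closed[OF ideal.axioms(1)[OF id]]
      additive_subgroup.a_inv_closed[OF ideal.axioms(1)[OF id]]
    have "ideal (\<Union>C) R"
    proof (rule idealI[OF ring_axioms add.subgroupI])
      show "\<Union>C \<subseteq> carrier R" using ideal.Icarr[OF id] by blast
      show "\<Union>C \<noteq> {}" using C ideal.axioms(1) unfolding subset.chain_def by blast
      show "\<ominus> y \<in> \<Union>C" if "y \<in> \<Union>C" for y using that add_id(2) by blast
      show "y \<oplus> z \<in> \<Union>C" if yz: "y \<in> \<Union>C" "z \<in> \<Union>C" for y z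
      proof -
        \<comment> \<open>In a chain two members are comparable, so both elements lie in the larger
          one.\<close>
        from yz C(2) obtain I where "I \<in> C" "y \<in> I" "z \<in> I"
          unfolding subset.chain_def by blast
        then show ?thesis using add_id(1) by blast
      qed
      show "r \<otimes> y \<in> \<Union>C" "y \<otimes> r \<in> \<Union>C" if "y \<in> \<Union>C" "r \<in> carrier R" for y r
        using that ideal.I_l_closed[OF id] ideal.I_r_closed[OF id] by blast+
    qed
    moreover have "x \<in> \<Union>C" "\<one> \<notin> \<Union>C" using C unfolding subset.chain_def by auto
    ultimately show ?thesis by blast
  qed
  from subset_Zorn_nonempty[OF ne this] obtain I where I: "ideal I R" "x \<in> I" "\<one> \<notin> I"
    and max: "\<And>J. \<lbrakk>ideal J R; x \<in> J; \<one> \<notin> J; I \<subseteq> J\<rbrakk> \<Longrightarrow> J = I" by blast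
  have "maximalideal I R"
  proof (rule maximalidealI)
    show "ideal I R" by fact
    show "carrier R \<noteq> I" using I(3) by auto
    fix J assume J: "ideal J R" "I \<subseteq> J" "J \<subseteq> carrier R"
    show "J = I \<or> J = carrier R"
      using max[OF J(1)] J I(2) ideal.one_imp_carrier[OF J(1)] by blast
  qed
  then show ?thesis using that I(2) by blast
qed

context local_ring
begin

lemma nonunit_in_max: "\<lbrakk>x \<in> carrier R; x \<notin> Units R\<rbrakk> \<Longrightarrow> x \<in> \<mm>"
  using nonunit_in_maximalideal maximalideal_unique by metis

lemma max_carrier: "x \<in> \<mm> \<Longrightarrow> x \<in> carrier R"
  by (rule Icarr)

lemma max_add: "\<lbrakk>x \<in> \<mm>; y \<in> \<mm>\<rbrakk> \<Longrightarrow> x \<oplus> y \<in> \<mm>"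
  by (rule additive_subgroup.a_closed[OF additive_subgroup_axioms])

lemma max_minus: "x \<in> \<mm> \<Longrightarrow> \<ominus> x \<in> \<mm>"
  by (rule additive_subgroup.a_inv_closed[OF additive_subgroup_axioms])

lemma one_notin_max: "\<one> \<notin> \<mm>"
  using one_imp_carrier I_notcarr by blast

text \<open>Otherwise the sum would lie in \<open>\<mm>\<close>, hence so would \<open>u\<close>,
  and then \<open>\<one>\<close>.\<close>

lemma unit_plus_max:
  assumes "u \<in> Units R" "x \<in> \<mm>"
  shows "u \<oplus> x \<in> Units R"
proof (rule ccontr)
  have u: "u \<in> carrier R" and x: "x \<in> carrier R" using assms max_carrier by auto
  assume "u \<oplus> x \<notin> Units R"
  then have "u \<oplus> x \<in> \<mm>" using u x by (intro nonunit_in_max) auto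
  then have "(u \<oplus> x) \<oplus> \<ominus> x \<in> \<mm>" by (rule max_add[OF _ max_minus[OF assms(2)]])
  moreover have "(u \<oplus> x) \<oplus> \<ominus> x = u" using u x by algebra
  ultimately have "u \<in> \<mm>" by simp
  then have "inv u \<otimes> u \<in> \<mm>" using assms(1) by (intro I_l_closed) auto
  then show False using assms(1) one_notin_max by simp
qed

lemma neg_one_unit: "\<ominus> \<one> \<in> Units R"
proof -
  have "\<ominus> \<one> \<otimes> \<ominus> \<one> = \<one>" by algebra
  then show ?thesis unfolding Units_def by auto
qed

text \<open>The determinant of the block is -1 plus an element of \<open>\<mm>\<close>.\<close>

lemma rank_two_ips_max:
  assumes "a \<in> \<mm>" "b \<in> \<mm>"
  shows "inner_product_space R (rank_two_space R a b)"
proof (rule rank_two_ips)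
  have ab: "a \<in> carrier R" "b \<in> carrier R" using assms max_carrier by auto
  then show "a \<in> carrier R" "b \<in> carrier R" .
  have "a \<otimes> b \<in> \<mm>" using assms ab by (intro I_l_closed)
  then have "\<ominus> \<one> \<oplus> a \<otimes> b \<in> Units R" by (intro unit_plus_max neg_one_unit)
  then show "a \<otimes> b \<ominus> \<one> \<in> Units R" using ab by (simp add: minus_eq a_comm)
qed


section \<open>Decomposition into blocks\<close>

lemma family_class_Suc:
  assumes "\<And>i. i \<le> k \<Longrightarrow> inner_product_space R (V i)"
  shows "isometry_class R (orth_sum_family R (Suc k) V) =
    isometry_class R (orth_sum_family R k V) \<otimes>\<^bsub>isometry_class_monoid R\<^esub> isometry_class R (V k)"
proof -
  have "inner_product_space R (orth_sum_family R k V)"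
    using assms by (intro orth_sum_family_ips is_cring) auto
  from isometry_class_mult[OF this assms[of k]]
    isometry_class_eqI[OF orth_sum_family_Suc[of R k V, OF is_cring assms]]
  show ?thesis by simp
qed

text \<open>Families are functions on all natural numbers, of which only the values below
  \<open>k\<close> count. This allows updating \<open>u\<close> at \<open>n\<close> to append a
  summand without disturbing the first \<open>n\<close>.\<close>

lemma family_class_cong:
  assumes "\<And>i. i < k \<Longrightarrow> inner_product_space R (V i)" "\<And>i. i < k \<Longrightarrow> V i = W i"
  shows "isometry_class R (orth_sum_family R k V) = isometry_class R (orth_sum_family R k W)"
proof (intro isometry_class_eqI orth_sum_family_isometric is_cring)
  show "isometric R (V i) (W i)" if "i < k" for i
    using isometric_refl[OF assms(1)[OF that]] assms(2)[OF that] by simp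
qed

lemma family_class_zero:
  "isometry_class R (orth_sum_family R 0 V) = \<one>\<^bsub>isometry_class_monoid R\<^esub>"
  by (intro isometry_class_one orth_sum_family_zero_ips orth_sum_family_zero_carrier is_cring)

text \<open>Collecting the classes of sums of unit lines of every length lets diagonalisability be
  handled as membership in a subset of the monoid.\<close>

definition diagonal_classes :: "('a, nat \<Rightarrow> 'a) ips set set"
  where "diagonal_classes = {isometry_class R (orth_sum_family R n (\<lambda>i. rank_one_space R (u i))) |n u.
    \<forall>i<n. u i \<in> Units R}"

text \<open>Modulo \<open>\<mm>\<close> each block has zero diagonal and off-diagonal entries 1, so
  its norms there have the form 2 x y. These are the summands left over when no unit norm is
  found.\<close>

definition even_classes :: "('a, nat \<Rightarrow> 'a) ips set set"
  where "even_classes =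
    {isometry_class R (orth_sum_family R n (\<lambda>i. rank_two_space R (a i) (b i))) |n a b.
      \<forall>i<n. a i \<in> \<mm> \<and> b i \<in> \<mm>}"

lemma one_diagonal: "\<one>\<^bsub>isometry_class_monoid R\<^esub> \<in> diagonal_classes"
  unfolding diagonal_classes_def using family_class_zero[symmetric] by blast

lemma one_even: "\<one>\<^bsub>isometry_class_monoid R\<^esub> \<in> even_classes"
  unfolding even_classes_def using family_class_zero[symmetric] by blast

lemma diagonal_mult_rank_one:
  assumes "A \<in> diagonal_classes" "v \<in> Units R"
  shows "A \<otimes>\<^bsub>isometry_class_monoid R\<^esub> isometry_class R (rank_one_space R v) \<in> diagonal_classes"
proof -
  obtain n u where A: "A = isometry_class R (orth_sum_family R n (\<lambda>i. rank_one_space R (u i)))"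
    and u: "\<And>i. i < n \<Longrightarrow> u i \<in> Units R" using assms(1) unfolding diagonal_classes_def by blast
  let ?u = "u(n := v)"
  have u': "\<And>i. i < Suc n \<Longrightarrow> ?u i \<in> Units R" using u assms(2) by (auto simp: less_Suc_eq)
  have "isometry_class R (orth_sum_family R (Suc n) (\<lambda>i. rank_one_space R (?u i))) =
      isometry_class R (orth_sum_family R n (\<lambda>i. rank_one_space R (?u i)))
        \<otimes>\<^bsub>isometry_class_monoid R\<^esub> isometry_class R (rank_one_space R (?u n))"
    using u' by (intro family_class_Suc rank_one_ips) (simp add: le_simps)
  also have "isometry_class R (orth_sum_family R n (\<lambda>i. rank_one_space R (?u i))) = A"
    unfolding A using u by (intro family_class_cong rank_one_ips) auto
  finally have "A \<otimes>\<^bsub>isometry_class_monoid R\<^esub> isometry_class R (rank_one_space R v) =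
      isometry_class R (orth_sum_family R (Suc n) (\<lambda>i. rank_one_space R (?u i)))" by simp
  then show ?thesis
    unfolding diagonal_classes_def using u' by (intro CollectI exI[of _ "Suc n"] exI[of _ ?u] conjI) auto
qed

lemma even_mult_rank_two:
  assumes "A \<in> even_classes" "c \<in> \<mm>" "d \<in> \<mm>"
  shows "A \<otimes>\<^bsub>isometry_class_monoid R\<^esub> isometry_class R (rank_two_space R c d) \<in> even_classes"
proof -
  obtain n a b where A: "A = isometry_class R (orth_sum_family R n (\<lambda>i. rank_two_space R (a i) (b i)))"
    and ab: "\<And>i. i < n \<Longrightarrow> a i \<in> \<mm>" "\<And>i. i < n \<Longrightarrow> b i \<in> \<mm>"
    using assms(1) unfolding even_classes_def by blast
  let ?a = "a(n := c)" and ?b = "b(n := d)"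
  have ab': "?a i \<in> \<mm> \<and> ?b i \<in> \<mm>" if "i < Suc n" for i using that ab assms(2,3) by (auto simp: less_Suc_eq)
  have "isometry_class R (orth_sum_family R (Suc n) (\<lambda>i. rank_two_space R (?a i) (?b i))) =
      isometry_class R (orth_sum_family R n (\<lambda>i. rank_two_space R (?a i) (?b i)))
        \<otimes>\<^bsub>isometry_class_monoid R\<^esub> isometry_class R (rank_two_space R (?a n) (?b n))"
    using ab' by (intro family_class_Suc rank_two_ips_max) (simp_all add: le_simps)
  also have "isometry_class R (orth_sum_family R n (\<lambda>i. rank_two_space R (?a i) (?b i))) = A"
    unfolding A using ab by (intro family_class_cong rank_two_ips_max) auto
  finally have "A \<otimes>\<^bsub>isometry_class_monoid R\<^esub> isometry_class R (rank_two_space R c d) =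
      isometry_class R (orth_sum_family R (Suc n) (\<lambda>i. rank_two_space R (?a i) (?b i)))" by simp
  then show ?thesis
    unfolding even_classes_def using ab'
    by (intro CollectI exI[of _ "Suc n"] exI[of _ ?a] exI[of _ ?b] conjI) auto
qed

lemma diagonal_closed: "A \<in> diagonal_classes \<Longrightarrow> A \<in> carrier (isometry_class_monoid R)"
  unfolding diagonal_classes_def
  by (auto intro!: isometry_class_closed orth_sum_family_ips rank_one_ips is_cring)

lemma even_closed: "A \<in> even_classes \<Longrightarrow> A \<in> carrier (isometry_class_monoid R)"
  unfolding even_classes_def
  by (auto intro!: isometry_class_closed orth_sum_family_ips rank_two_ips_max is_cring)

text \<open>Peeling off the last summand hides the length and the indexing of the family: the rule
  is the one for a submonoid generated by the classes of unit lines.\<close>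

lemma diagonal_induct [consumes 1, case_names one rank_one]:
  assumes "A \<in> diagonal_classes" and "P \<one>\<^bsub>isometry_class_monoid R\<^esub>"
    and step: "\<And>A v. \<lbrakk>A \<in> diagonal_classes; P A; v \<in> Units R\<rbrakk> \<Longrightarrow>
      P (A \<otimes>\<^bsub>isometry_class_monoid R\<^esub> isometry_class R (rank_one_space R v))"
  shows "P A"
proof -
  obtain n u where A: "A = isometry_class R (orth_sum_family R n (\<lambda>i. rank_one_space R (u i)))"
    and u: "\<And>i. i < n \<Longrightarrow> u i \<in> Units R" using assms(1) unfolding diagonal_classes_def by blast
  have "P (isometry_class R (orth_sum_family R n (\<lambda>i. rank_one_space R (u i))))" using u
  proof (induction n)
    case 0
    show ?case using assms(2) unfolding family_class_zero .
  next
    case (Suc n)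
    have "isometry_class R (orth_sum_family R n (\<lambda>i. rank_one_space R (u i))) \<in> diagonal_classes"
      unfolding diagonal_classes_def using Suc.prems by (intro CollectI exI conjI refl) auto
    from step[OF this Suc.IH Suc.prems] show ?case
      using Suc.prems by (subst family_class_Suc) (auto intro: rank_one_ips)
  qed
  then show ?thesis using A by simp
qed

lemma even_induct [consumes 1, case_names one rank_two]:
  assumes "A \<in> even_classes" and "P \<one>\<^bsub>isometry_class_monoid R\<^esub>"
    and step: "\<And>A a b. \<lbrakk>A \<in> even_classes; P A; a \<in> \<mm>; b \<in> \<mm>\<rbrakk> \<Longrightarrow>
      P (A \<otimes>\<^bsub>isometry_class_monoid R\<^esub> isometry_class R (rank_two_space R a b))"
  shows "P A"
proof -
  obtain n a b where A: "A = isometry_class R (orth_sum_family R n (\<lambda>i. rank_two_space R (a i) (b i)))"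
    and ab: "\<And>i. i < n \<Longrightarrow> a i \<in> \<mm> \<and> b i \<in> \<mm>" using assms(1) unfolding even_classes_def by blast
  have "P (isometry_class R (orth_sum_family R n (\<lambda>i. rank_two_space R (a i) (b i))))" using ab
  proof (induction n)
    case 0
    show ?case using assms(2) unfolding family_class_zero .
  next
    case (Suc n)
    have "isometry_class R (orth_sum_family R n (\<lambda>i. rank_two_space R (a i) (b i))) \<in> even_classes"
      unfolding even_classes_def using Suc.prems by (intro CollectI exI conjI refl) auto
    from step[OF this Suc.IH, of "a n" "b n"] show ?case
      using Suc.prems by (subst family_class_Suc) (auto intro: rank_two_ips_max)
  qed
  then show ?thesis using A by simp
qed

text \<open>The induction varies the space and the family while both types stay fixed. This is
  possible because a complement keeps the carrier type of \<open>V\<close> and is indexed by a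
  subset of \<open>I\<close>.\<close>

lemma decomposition:
  fixes V :: "('a, 'v) ips" and I :: "'i set"
  assumes "inner_product_space R V" "dual_family R V I u w"
  shows "\<exists>D\<in>diagonal_classes. \<exists>E\<in>even_classes.
    isometry_class R V = D \<otimes>\<^bsub>isometry_class_monoid R\<^esub> E"
  using assms
proof (induction "card I" arbitrary: V I u w rule: less_induct)
  case less
  let ?M = "isometry_class_monoid R"
  interpret M: comm_monoid ?M by (rule isometry_class_comm_monoid) (rule is_cring)
  interpret V: form_space R V using ips_form_space[OF less.prems(1)] .
  note D = dual_familyD[OF less.prems(2)]
  show ?case
  proof (cases "I = {}")
    case True
    have "carrier V = {\<zero>\<^bsub>V\<^esub>}" using D(6) True by auto
    then have "isometry_class R V = \<one>\<^bsub>?M\<^esub>"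
      by (intro isometry_class_one is_cring less.prems(1))
    then show ?thesis using one_diagonal one_even by (metis M.l_one M.one_closed)
  next
    case ne: False
    \<comment> \<open>Non-units lie in \<open>\<mm>\<close>. In case \<open>two\<close> the norms of
      both vectors are recorded to lie in \<open>\<mm>\<close>, which makes the plane that they span
      an admissible block.\<close>
    consider (one) i where "i \<in> I" "form V (u i) (u i) \<in> Units R"
      | (two) i j where "i \<in> I" "j \<in> I" "form V (u i) (u j) \<in> Units R" "form V (u i) (u i) \<in> \<mm>"
          "form V (u j) (u j) \<in> \<mm>"
      | (none) "\<And>i j. \<lbrakk>i \<in> I; j \<in> I\<rbrakk> \<Longrightarrow> form V (u i) (u j) \<in> \<mm>"
      using nonunit_in_max D(4) V.form_closed by metis
    then show ?thesis
    proof cases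
      case one
      let ?c = "form V (u i) (u i)"
      let ?\<alpha> = "\<lambda>y. y 0 \<odot>\<^bsub>V\<^esub> u i"
      let ?E = "rank_one_space R ?c"
      have ui: "u i \<in> carrier V" using one D by auto
      have E: "inner_product_space R ?E" using one by (intro rank_one_ips)
      obtain V' :: "('a, 'v) ips" and u' w' where V': "isometric R V (orth_sum R ?E V')"
        and V'_ips: "inner_product_space R V'"
        and dual': "dual_family R V' {k \<in> I. u k \<notin> ?\<alpha> ` carrier ?E} u' w'"
        using orthogonal_splitting[OF E V.form_space_axioms V.rank_one_form_hom[OF ui refl] less.prems(2)]
        by blast
      \<comment> \<open>The coordinate vector 1 maps to \<open>u i\<close>, so the index
        \<open>i\<close> disappears from the family of the complement.\<close>
      have "u i \<in> ?\<alpha> ` carrier ?E"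
        using ui by (intro image_eqI[of _ _ "\<lambda>i\<in>{..<1}. \<one>"]) (auto simp: rank_one_simps)
      then have "{k \<in> I. u k \<notin> ?\<alpha> ` carrier ?E} \<subset> I" using one by blast
      then have card: "card {k \<in> I. u k \<notin> ?\<alpha> ` carrier ?E} < card I" by (rule psubset_card_mono[OF D(1)])
      from less.hyps[OF card V'_ips dual'] obtain A B where AB: "A \<in> diagonal_classes" "B \<in> even_classes"
        "isometry_class R V' = A \<otimes>\<^bsub>?M\<^esub> B" by blast
      have C: "isometry_class R ?E \<in> carrier ?M" by (rule isometry_class_closed[OF E])
      have "isometry_class R V = isometry_class R ?E \<otimes>\<^bsub>?M\<^esub> isometry_class R V'"
        using isometry_class_eqI[OF V'] isometry_class_mult[OF E V'_ips] by simp
      also have "\<dots> = (A \<otimes>\<^bsub>?M\<^esub> isometry_class R ?E) \<otimes>\<^bsub>?M\<^esub> B"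
        using AB C diagonal_closed even_closed by (simp add: M.m_ac)
      finally show ?thesis using diagonal_mult_rank_one[OF AB(1) one(2)] AB(2) by blast
    next
      case two
      let ?c = "form V (u i) (u j)"
      define f where "f = u i"
      \<comment> \<open>Scaling \<open>u j\<close> makes the off-diagonal entry exactly 1, as the
        blocks require, and multiplies the norm by a square, so that it stays in
        \<open>\<mm>\<close>.\<close>
      define g where "g = inv ?c \<odot>\<^bsub>V\<^esub> u j"
      have c: "?c \<in> carrier R" "inv ?c \<in> carrier R" using two by auto
      have uij: "u i \<in> carrier V" "u j \<in> carrier V" using two D by auto
      have fg: "f \<in> carrier V" "g \<in> carrier V" using uij c by (auto simp: f_def g_def)
      let ?a = "form V f f" and ?b = "form V g g"
      let ?E = "rank_two_space R ?a ?b"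
      let ?\<alpha> = "\<lambda>y. y 0 \<odot>\<^bsub>V\<^esub> f \<oplus>\<^bsub>V\<^esub> y 1 \<odot>\<^bsub>V\<^esub> g"
      have a: "?a \<in> \<mm>" using two by (simp add: f_def)
      have b: "?b \<in> \<mm>"
        using two uij c by (simp add: g_def V.form_smult_left V.form_smult_right I_l_closed)
      have one: "form V f g = \<one>" using two(3) uij c by (simp add: f_def g_def V.form_smult_right)
      have E: "inner_product_space R ?E" using a b by (rule rank_two_ips_max)
      obtain V' :: "('a, 'v) ips" and u' w' where V': "isometric R V (orth_sum R ?E V')"
        and V'_ips: "inner_product_space R V'"
        and dual': "dual_family R V' {k \<in> I. u k \<notin> ?\<alpha> ` carrier ?E} u' w'"
        using orthogonal_splitting[OF E V.form_space_axioms V.rank_two_form_hom[OF fg refl one refl] less.prems(2)]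
        by blast
      \<comment> \<open>Losing the index \<open>i\<close> is enough for the induction, although
        \<open>u j\<close> lies in the plane as well.\<close>
      have "u i \<in> ?\<alpha> ` carrier ?E"
        using fg by (intro image_eqI[of _ _ "\<lambda>i\<in>{..<2}. if i = 0 then \<one> else \<zero>"])
          (auto simp: rank_two_simps f_def[symmetric])
      then have "{k \<in> I. u k \<notin> ?\<alpha> ` carrier ?E} \<subset> I" using two by blast
      then have card: "card {k \<in> I. u k \<notin> ?\<alpha> ` carrier ?E} < card I" by (rule psubset_card_mono[OF D(1)])
      from less.hyps[OF card V'_ips dual'] obtain A B where AB: "A \<in> diagonal_classes" "B \<in> even_classes"
        "isometry_class R V' = A \<otimes>\<^bsub>?M\<^esub> B" by blast
      have C: "isometry_class R ?E \<in> carrier ?M" by (rule isometry_class_closed[OF E])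
      have "isometry_class R V = isometry_class R ?E \<otimes>\<^bsub>?M\<^esub> isometry_class R V'"
        using isometry_class_eqI[OF V'] isometry_class_mult[OF E V'_ips] by simp
      also have "\<dots> = A \<otimes>\<^bsub>?M\<^esub> (B \<otimes>\<^bsub>?M\<^esub> isometry_class R ?E)"
        using AB C diagonal_closed even_closed by (simp add: M.m_ac)
      finally show ?thesis using even_mult_rank_two[OF AB(2) a b] AB(1) by blast
    next
      case none
      from ne obtain i where i: "i \<in> I" by blast
      have "form V (u i) (w i) \<in> \<mm>"
      proof -
        \<comment> \<open>Nothing is known about \<open>w i\<close> itself. The family equation
          applied to \<open>w i\<close> expresses it through the \<open>u j\<close>, whose pairings
          with \<open>u i\<close> all lie in \<open>\<mm>\<close>.\<close>
        have "form V (u i) (w i) = form V (u i) (\<Oplus>\<^bsub>V\<^esub>j\<in>I. form V (w j) (w i) \<odot>\<^bsub>V\<^esub> u j)"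
          using D(5,6) i by simp
        also have "\<dots> = (\<Oplus>j\<in>I. form V (w j) (w i) \<otimes> form V (u i) (u j))"
          using D i by (intro V.form_lincomb_right) auto
        also have "\<dots> \<in> \<mm>"
        proof -
          have "(\<Oplus>j\<in>J. form V (w j) (w i) \<otimes> form V (u i) (u j)) \<in> \<mm>" if "J \<subseteq> I" "finite J" for J
            using that(2,1)
          proof (induction J)
            case (insert j J)
            then show ?case
              using D none i by (subst finsum_insert) (auto intro!: max_add I_l_closed m_closed simp: subset_iff)
          qed simp
          then show ?thesis using D(1) by blast
        qed
        finally show ?thesis .
      qed
      then have "form V (w i) (u i) \<in> \<mm>" using V.form_sym D(4,5) i by metis
      then have "\<one> \<oplus> \<ominus> form V (w i) (u i) \<in> Units R" by (intro unit_plus_max max_minus) auto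
      then have "\<one> \<ominus> form V (w i) (u i) \<in> Units R" by (simp add: minus_eq)
      from dual_family_drop[OF V.form_space_axioms less.prems(2) i this]
      obtain w' where w': "dual_family R V (I - {i}) u w'" .
      show ?thesis
        using less.hyps[OF _ less.prems(1) w'] card_Diff1_less[OF D(1) i] by blast
    qed
  qed
qed

end


section \<open>Stabilising a plane\<close>

text \<open>
  Let \<open>f, g\<close> be the basis of the plane and \<open>h\<close> that of \<open>\<langle>-1\<rangle>\<close>. Then \<open>f + h\<close> and \<open>g + h\<close> are
  orthogonal of norms \<open>-1 + a\<close> and \<open>-1 + b\<close>. With \<open>s = 1 / (-1 + a)\<close> and \<open>t = 1 / (-1 + b)\<close>,
  the vector \<open>z = s f + t g + (1 + s + t) h\<close> is orthogonal to both and has norm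
  \<open>-(1 + s + t) = (1 - ab) s t\<close>; moreover \<open>h = z - s (f + h) - t (g + h)\<close>.
\<close>

lemma (in cring) stabilised_plane:
  assumes ab: "a \<in> carrier R" "b \<in> carrier R"
    and N: "inner_product_space R (rank_two_space R a b)"
    and units: "\<ominus> \<one> \<in> Units R" "\<ominus> \<one> \<oplus> a \<in> Units R" "\<ominus> \<one> \<oplus> b \<in> Units R" "\<one> \<ominus> a \<otimes> b \<in> Units R"
  shows "isometric R
    (orth_sum R (rank_two_space R a b) (rank_one_space R (\<ominus> \<one>)))
    (orth_sum R (orth_sum R
      (rank_one_space R ((\<one> \<ominus> a \<otimes> b) \<otimes> inv ((\<ominus> \<one> \<oplus> a) \<otimes> (\<ominus> \<one> \<oplus> b))))
      (rank_one_space R (\<ominus> \<one> \<oplus> a))) (rank_one_space R (\<ominus> \<one> \<oplus> b)))"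
proof -
  define A where "A = \<ominus> \<one> \<oplus> a"
  define B where "B = \<ominus> \<one> \<oplus> b"
  define s where "s = inv A"
  define t where "t = inv B"
  define n where "n = (\<one> \<ominus> a \<otimes> b) \<otimes> inv (A \<otimes> B)"
  define k where "k = \<one> \<oplus> s \<oplus> t"
  have AB: "A \<in> Units R" "B \<in> Units R" using units by (simp_all add: A_def B_def)
  have AB': "A \<otimes> B \<in> Units R" using AB by (rule Units_m_closed)
  have c: "A \<in> carrier R" "B \<in> carrier R" "s \<in> carrier R" "t \<in> carrier R" "k \<in> carrier R"
    using AB by (simp_all add: s_def t_def k_def Units_closed)
  have As: "A \<otimes> s = \<one>" and Bt: "B \<otimes> t = \<one>" using AB by (simp_all add: s_def t_def)
  \<comment> \<open>Written in terms of \<open>A\<close> and \<open>B\<close>, every identity below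
    is a polynomial identity followed by the substitutions \<open>A \<otimes> s = \<one>\<close> and
    \<open>B \<otimes> t = \<one>\<close>, which \<open>algebra\<close> is not asked to
    find.\<close>
  have a: "a = A \<oplus> \<one>" and b: "b = B \<oplus> \<one>"
    unfolding A_def B_def using ab by algebra+
  have n_unit: "n \<in> Units R" unfolding n_def using units(4) AB' by (intro Units_m_closed) auto
  have n: "n = \<ominus> k"
  proof -
    have "(A \<otimes> B) \<otimes> (s \<otimes> t) = (A \<otimes> s) \<otimes> (B \<otimes> t)" using c by algebra
    then have "inv (A \<otimes> B) = s \<otimes> t" using As Bt c by (intro comm_inv_char) auto
    then have "n = (\<one> \<ominus> (A \<oplus> \<one>) \<otimes> (B \<oplus> \<one>)) \<otimes> (s \<otimes> t)" by (simp add: n_def flip: a b)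
    also have "\<dots> = \<ominus> ((A \<otimes> s) \<otimes> (B \<otimes> t) \<oplus> (A \<otimes> s) \<otimes> t \<oplus> (B \<otimes> t) \<otimes> s)"
      using c by algebra
    also have "\<dots> = \<ominus> k" unfolding As Bt k_def using c by algebra
    finally show ?thesis .
  qed
  let ?N = "rank_two_space R a b" and ?H = "rank_one_space R (\<ominus> \<one>)"
  define L where "L = orth_sum R ?N ?H"
  have H: "inner_product_space R ?H" by (rule rank_one_ips) (rule units)
  have L: "inner_product_space R L" unfolding L_def by (intro orth_sum_ips N H)
  interpret L: form_space R L using ips_form_space[OF L] .
  \<comment> \<open>Coordinates with respect to \<open>f\<close>, \<open>g\<close>,
    \<open>h\<close>; all computations in \<open>L\<close> become computations with triples of ring
    elements.\<close>
  define v where "v x y z = ((\<lambda>i\<in>{..<2::nat}. if i = 0 then x else y), (\<lambda>i\<in>{..<1::nat}. z))" for x y z :: 'a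
  have v_closed: "v x y z \<in> carrier L" if "x \<in> carrier R" "y \<in> carrier R" "z \<in> carrier R" for x y z
    using that by (auto simp: v_def L_def rank_two_simps rank_one_simps)
  have v_add: "v x y z \<oplus>\<^bsub>L\<^esub> v x' y' z' = v (x \<oplus> x') (y \<oplus> y') (z \<oplus> z')" for x y z x' y' z'
    by (auto simp: v_def L_def rank_two_simps rank_one_simps fun_eq_iff)
  have v_smult: "r \<odot>\<^bsub>L\<^esub> v x y z = v (r \<otimes> x) (r \<otimes> y) (r \<otimes> z)" for r x y z
    by (auto simp: v_def L_def rank_two_simps rank_one_simps fun_eq_iff)
  have v_form: "form L (v x y z) (v x' y' z') =
      x \<otimes> a \<otimes> x' \<oplus> x \<otimes> y' \<oplus> (y \<otimes> x' \<oplus> y \<otimes> b \<otimes> y') \<ominus> z \<otimes> z'"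
    if "x \<in> carrier R" "y \<in> carrier R" "z \<in> carrier R" "x' \<in> carrier R" "y' \<in> carrier R" "z' \<in> carrier R"
    for x y z x' y' z'
  proof -
    let ?e = "\<lambda>x y. \<lambda>i\<in>{..<2::nat}. if i = 0 then x else y" and ?d = "\<lambda>z. \<lambda>i\<in>{..<1::nat}. z"
    have m: "?e x y \<in> carrier ?N" "?e x' y' \<in> carrier ?N" "?d z \<in> carrier ?H" "?d z' \<in> carrier ?H"
      using that by (auto simp: rank_two_simps rank_one_simps)
    have "form L (v x y z) (v x' y' z') = form ?N (?e x y) (?e x' y') \<oplus> form ?H (?d z) (?d z')"
      by (simp add: v_def L_def)
    also have "form ?N (?e x y) (?e x' y') = x \<otimes> a \<otimes> x' \<oplus> x \<otimes> y' \<oplus> (y \<otimes> x' \<oplus> y \<otimes> b \<otimes> y')"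
      by (subst rank_two_form[OF ab m(1,2)]) simp
    also have "form ?H (?d z) (?d z') = z \<otimes> \<ominus> \<one> \<otimes> z'"
      by (subst rank_one_form[OF _ m(3,4)]) auto
    finally show ?thesis using that ab by (simp add: minus_eq r_minus l_minus)
  qed
  have v_cases: "\<exists>x y z. x \<in> carrier R \<and> y \<in> carrier R \<and> z \<in> carrier R \<and> p = v x y z"
    if p: "p \<in> carrier L" for p
  proof -
    obtain p1 p2 where pp: "p = (p1, p2)" "p1 \<in> carrier ?N" "p2 \<in> carrier ?H"
      using p by (auto simp: L_def)
    have c0: "p1 0 \<in> carrier R" "p1 1 \<in> carrier R" "p2 0 \<in> carrier R"
      using rank_two_coord[OF pp(2)] pp(3) by (auto simp: rank_one_simps)
    have "p1 = (\<lambda>i\<in>{..<2::nat}. if i = 0 then p1 0 else p1 1)"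
      using pp(2) c0 by (intro rank_two_ext[of _ "carrier R"]) (auto simp: rank_two_simps)
    moreover have "p2 = (\<lambda>i\<in>{..<1::nat}. p2 0)"
      using pp(3) c0 by (intro rank_one_ext[of _ "carrier R"]) (auto simp: rank_one_simps)
    ultimately show ?thesis using c0 pp(1) unfolding v_def by metis
  qed
  \<comment> \<open>From here on \<open>x\<close> and \<open>y\<close> stand for the vectors f + h
    and g + h.\<close>
  define x where "x = v \<one> \<zero> \<one>"
  define y where "y = v \<zero> \<one> \<one>"
  define z where "z = v s t k"
  have xyz: "x \<in> carrier L" "y \<in> carrier L" "z \<in> carrier L"
    unfolding x_def y_def z_def using c by (simp_all add: v_closed)
  have xx: "form L x x = A" unfolding x_def using ab by (subst v_form) (auto simp: A_def minus_eq a_comm)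
  have yy: "form L y y = B" unfolding y_def using ab by (subst v_form) (auto simp: B_def minus_eq a_comm)
  \<comment> \<open>The pairing 1 of \<open>f\<close> with \<open>g\<close> cancels against the norm
    -1 of \<open>h\<close>.\<close>
  have xy: "form L x y = \<zero>" unfolding x_def y_def using ab by (subst v_form) (auto simp: minus_eq r_neg)
  have zx: "form L z x = \<zero>"
  proof -
    have "form L z x = s \<otimes> (A \<oplus> \<one>) \<oplus> t \<ominus> (\<one> \<oplus> s \<oplus> t)"
      unfolding x_def z_def using ab c by (subst v_form) (auto simp: k_def simp flip: a)
    also have "\<dots> = A \<otimes> s \<ominus> \<one>" using c by algebra
    finally show ?thesis by (simp add: As minus_eq r_neg)
  qed
  have zy: "form L z y = \<zero>"
  proof -
    have "form L z y = s \<oplus> t \<otimes> (B \<oplus> \<one>) \<ominus> (\<one> \<oplus> s \<oplus> t)"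
      unfolding y_def z_def using ab c by (subst v_form) (auto simp: k_def simp flip: b)
    also have "\<dots> = B \<otimes> t \<ominus> \<one>" using c by algebra
    finally show ?thesis by (simp add: Bt minus_eq r_neg)
  qed
  have zz: "form L z z = n"
  proof -
    have h: "v \<zero> \<zero> \<one> \<in> carrier L" by (simp add: v_closed)
    \<comment> \<open>Since \<open>z\<close> is orthogonal to \<open>x\<close> and \<open>y\<close>,
      its norm is its pairing with \<open>h\<close>, that is, minus its last coordinate
      \<open>k\<close>. This avoids expanding a quadratic expression in \<open>s\<close> and
      \<open>t\<close>.\<close>
    have "z = s \<odot>\<^bsub>L\<^esub> x \<oplus>\<^bsub>L\<^esub> t \<odot>\<^bsub>L\<^esub> y \<oplus>\<^bsub>L\<^esub> v \<zero> \<zero> \<one>"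
      using c by (simp add: z_def x_def y_def v_smult v_add k_def a_ac)
    then have "form L z z = form L z (s \<odot>\<^bsub>L\<^esub> x \<oplus>\<^bsub>L\<^esub> t \<odot>\<^bsub>L\<^esub> y \<oplus>\<^bsub>L\<^esub> v \<zero> \<zero> \<one>)" by simp
    also have "\<dots> = form L z (v \<zero> \<zero> \<one>)"
      using xyz h c by (simp add: L.form_add_right L.form_smult_right zx zy)
    also have "\<dots> = \<ominus> k"
      unfolding z_def using ab c by (subst v_form) (auto simp: minus_eq)
    finally show ?thesis by (simp add: n)
  qed
  let ?U = "rank_one_space R n" and ?A = "rank_one_space R A" and ?B = "rank_one_space R B"
  have ips: "inner_product_space R ?U" "inner_product_space R ?A" "inner_product_space R ?B"
    using n_unit AB by (auto intro: rank_one_ips)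
  note fs = ips_form_space[OF ips(1)] ips_form_space[OF ips(2)] ips_form_space[OF ips(3)]
  have coord: "q 0 \<in> carrier R" if "q \<in> carrier (rank_one_space R m)" for q :: "nat \<Rightarrow> 'a" and m
    using that by (auto simp: rank_one_simps)
  let ?\<phi> = "\<lambda>p. fst p 0 \<odot>\<^bsub>L\<^esub> z \<oplus>\<^bsub>L\<^esub> snd p 0 \<odot>\<^bsub>L\<^esub> x"
  let ?\<psi> = "\<lambda>p. ?\<phi> (fst p) \<oplus>\<^bsub>L\<^esub> snd p 0 \<odot>\<^bsub>L\<^esub> y"
  have \<phi>: "?\<phi> \<in> form_hom R (orth_sum R ?U ?A) L"
    by (rule form_hom_orth_sum[OF fs(1,2) L.form_space_axioms L.rank_one_form_hom[OF xyz(3) zz]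
          L.rank_one_form_hom[OF xyz(1) xx]])
      (use coord xyz zx in \<open>auto simp: L.form_smult_left L.form_smult_right\<close>)
  have \<psi>: "?\<psi> \<in> form_hom R (orth_sum R (orth_sum R ?U ?A) ?B) L"
    by (rule form_hom_orth_sum[OF orth_sum_form_space[OF fs(1,2)] fs(3) L.form_space_axioms \<phi>
          L.rank_one_form_hom[OF xyz(2) yy]])
      (use coord xyz zy xy in \<open>auto simp: L.form_smult_left L.form_smult_right L.form_add_left\<close>)
  have "?\<psi> ` carrier (orth_sum R (orth_sum R ?U ?A) ?B) = carrier L"
  proof (intro subset_antisym subsetI)
    fix p assume "p \<in> carrier L"
    then obtain p1 p2 p3 where p: "p1 \<in> carrier R" "p2 \<in> carrier R" "p3 \<in> carrier R" "p = v p1 p2 p3"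
      using v_cases by blast
    let ?e = "\<lambda>r. \<lambda>i\<in>{..<1::nat}. r"
    \<comment> \<open>Substituting f = x - h and g = y - h turns \<open>p\<close> into p1 x + p2 y +
      r h, and h = z - s x - t y then gives the coefficients in \<open>?q\<close>.\<close>
    let ?r = "p3 \<ominus> p1 \<ominus> p2"
    let ?q = "((?e ?r, ?e (p1 \<ominus> ?r \<otimes> s)), ?e (p2 \<ominus> ?r \<otimes> t))"
    have q: "?q \<in> carrier (orth_sum R (orth_sum R ?U ?A) ?B)"
      using p c by (auto simp: rank_one_simps)
    have "?\<psi> ?q = v (?r \<otimes> s \<oplus> (p1 \<ominus> ?r \<otimes> s)) (?r \<otimes> t \<oplus> (p2 \<ominus> ?r \<otimes> t))
        (?r \<otimes> k \<oplus> (p1 \<ominus> ?r \<otimes> s) \<oplus> (p2 \<ominus> ?r \<otimes> t))"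
      using p c by (simp add: x_def y_def z_def v_smult v_add)
    moreover have "?r \<otimes> s \<oplus> (p1 \<ominus> ?r \<otimes> s) = p1" using p c by algebra
    moreover have "?r \<otimes> t \<oplus> (p2 \<ominus> ?r \<otimes> t) = p2" using p c by algebra
    moreover have "?r \<otimes> k \<oplus> (p1 \<ominus> ?r \<otimes> s) \<oplus> (p2 \<ominus> ?r \<otimes> t) = p3"
      unfolding k_def using p c by algebra
    ultimately have "p = ?\<psi> ?q" using p(4) by simp
    then show "p \<in> ?\<psi> ` carrier (orth_sum R (orth_sum R ?U ?A) ?B)" using q by (rule image_eqI)
  next
    fix p assume "p \<in> ?\<psi> ` carrier (orth_sum R (orth_sum R ?U ?A) ?B)"
    then show "p \<in> carrier L" using form_homD(3)[OF \<psi>] by blast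
  qed
  then have "isometric R (orth_sum R (orth_sum R ?U ?A) ?B) L"
    unfolding isometric_iff using \<psi> L ips by (intro conjI bexI[of _ ?\<psi>] orth_sum_ips)
  from isometric_sym[OF this] show ?thesis by (simp add: L_def n_def A_def B_def)
qed


section \<open>Orthogonal bases\<close>

text \<open>Spanning together with unit norms replaces the unique coefficients of
  \<open>is_basis\<close>. This form is easy to move along isometries and to extend by a line, and
  uniqueness is recovered at the end.\<close>

definition orthogonal_frame :: "('a, 'm) ring_scheme \<Rightarrow> ('a, 'b) ips \<Rightarrow> nat \<Rightarrow> (nat \<Rightarrow> 'b) \<Rightarrow> bool"
  where "orthogonal_frame R V n e \<longleftrightarrow>
    e \<in> {..<n} \<rightarrow> carrier V \<and>
    (\<forall>i<n. form V (e i) (e i) \<in> Units R) \<and>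
    (\<forall>i<n. \<forall>j<n. i \<noteq> j \<longrightarrow> form V (e i) (e j) = \<zero>\<^bsub>R\<^esub>) \<and>
    (\<forall>x\<in>carrier V. \<exists>c\<in>{..<n} \<rightarrow> carrier R. x = (\<Oplus>\<^bsub>V\<^esub>i\<in>{..<n}. c i \<odot>\<^bsub>V\<^esub> e i))"

text \<open>Pairing a combination with \<open>e j\<close> leaves \<open>c j\<close> times the norm
  of \<open>e j\<close>; that norm is a unit, so the coefficient is determined.\<close>

lemma (in form_space) orthogonal_frame_basis:
  assumes "orthogonal_frame R V n e"
  shows "has_orthogonal_basis R V"
proof -
  have e: "e \<in> {..<n} \<rightarrow> carrier V" "\<And>i. i < n \<Longrightarrow> e i \<in> carrier V"
    and unit: "\<And>i. i < n \<Longrightarrow> form V (e i) (e i) \<in> Units R"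
    and orth: "\<And>i j. \<lbrakk>i < n; j < n; i \<noteq> j\<rbrakk> \<Longrightarrow> form V (e i) (e j) = \<zero>"
    and span: "\<And>x. x \<in> carrier V \<Longrightarrow> \<exists>c\<in>{..<n} \<rightarrow> carrier R. x = (\<Oplus>\<^bsub>V\<^esub>i\<in>{..<n}. c i \<odot>\<^bsub>V\<^esub> e i)"
    using assms unfolding orthogonal_frame_def by auto
  have coeff: "form V (e j) (\<Oplus>\<^bsub>V\<^esub>i\<in>{..<n}. c i \<odot>\<^bsub>V\<^esub> e i) = c j \<otimes> form V (e j) (e j)"
    if c: "c \<in> {..<n} \<rightarrow> carrier R" and j: "j < n" for c j
  proof -
    have "form V (e j) (\<Oplus>\<^bsub>V\<^esub>i\<in>{..<n}. c i \<odot>\<^bsub>V\<^esub> e i) = (\<Oplus>i\<in>{..<n}. c i \<otimes> form V (e j) (e i))"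
      using e j c by (intro form_lincomb_right) auto
    also have "\<dots> = (\<Oplus>i\<in>{..<n}. if j = i then c i \<otimes> form V (e j) (e i) else \<zero>)"
      using e j c orth by (intro R.finsum_cong') (auto simp: Pi_iff)
    also have "\<dots> = c j \<otimes> form V (e j) (e j)"
      using e j c by (intro R.finsum_singleton) auto
    finally show ?thesis .
  qed
  have "is_basis R V n e"
    unfolding is_basis_def
  proof (intro conjI ballI e(1))
    fix x assume "x \<in> carrier V"
    from span[OF this] obtain c where c: "c \<in> {..<n} \<rightarrow> carrier R"
      "x = (\<Oplus>\<^bsub>V\<^esub>i\<in>{..<n}. c i \<odot>\<^bsub>V\<^esub> e i)" by blast
    show "\<exists>!c. c \<in> {..<n} \<rightarrow>\<^sub>E carrier R \<and> x = (\<Oplus>\<^bsub>V\<^esub>i\<in>{..<n}. c i \<odot>\<^bsub>V\<^esub> e i)"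
    proof (intro ex1I conjI)
      show "restrict c {..<n} \<in> {..<n} \<rightarrow>\<^sub>E carrier R" using c(1) by auto
      show "x = (\<Oplus>\<^bsub>V\<^esub>i\<in>{..<n}. restrict c {..<n} i \<odot>\<^bsub>V\<^esub> e i)"
        unfolding c(2) using c(1) e by (intro M.finsum_cong') (auto simp: Pi_iff)
      fix d assume d: "d \<in> {..<n} \<rightarrow>\<^sub>E carrier R \<and> x = (\<Oplus>\<^bsub>V\<^esub>i\<in>{..<n}. d i \<odot>\<^bsub>V\<^esub> e i)"
      show "d = restrict c {..<n}"
      proof (rule PiE_ext[of _ "{..<n}" "\<lambda>_. carrier R"])
        fix j assume "j \<in> {..<n}"
        then have j: "j < n" by simp
        have dc: "d \<in> {..<n} \<rightarrow> carrier R" using d by auto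
        have "d j \<otimes> form V (e j) (e j) = c j \<otimes> form V (e j) (e j)"
          using coeff[OF dc j] coeff[OF c(1) j] d c(2) by simp
        then have "(d j \<otimes> form V (e j) (e j)) \<otimes> inv form V (e j) (e j) =
            (c j \<otimes> form V (e j) (e j)) \<otimes> inv form V (e j) (e j)" by simp
        moreover have "d j \<in> carrier R" "c j \<in> carrier R" using dc c(1) j by auto
        ultimately have "d j = c j" using unit[OF j] e(2)[OF j] by (simp add: R.m_assoc)
        then show "d j = restrict c {..<n} j" using j by simp
      qed (use d c(1) in auto)
    qed
  qed
  then show ?thesis unfolding has_orthogonal_basis_def using orth by blast
qed

lemma orthogonal_frame_isometric:
  assumes "isometric R V W" "orthogonal_frame R V n e"
  shows "\<exists>e'. orthogonal_frame R W n e'"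
proof -
  obtain f where f: "f \<in> form_hom R V W" "f ` carrier V = carrier W"
    using assms(1) unfolding isometric_iff by blast
  note F = form_homD[OF f(1)] and ips = isometric_ips[OF assms(1)]
  have e: "e \<in> {..<n} \<rightarrow> carrier V"
    and span: "\<And>x. x \<in> carrier V \<Longrightarrow> \<exists>c\<in>{..<n} \<rightarrow> carrier R. x = (\<Oplus>\<^bsub>V\<^esub>i\<in>{..<n}. c i \<odot>\<^bsub>V\<^esub> e i)"
    using assms(2) unfolding orthogonal_frame_def by auto
  have ec: "e i \<in> carrier V" if "i < n" for i using e that by auto
  have "orthogonal_frame R W n (f \<circ> e)"
    unfolding orthogonal_frame_def
  proof (intro conjI ballI)
    fix y assume "y \<in> carrier W"
    then obtain x where x: "x \<in> carrier V" "y = f x" using f(2) by auto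
    from span[OF x(1)] obtain c where c: "c \<in> {..<n} \<rightarrow> carrier R"
      "x = (\<Oplus>\<^bsub>V\<^esub>i\<in>{..<n}. c i \<odot>\<^bsub>V\<^esub> e i)" by blast
    have "y = (\<Oplus>\<^bsub>W\<^esub>i\<in>{..<n}. c i \<odot>\<^bsub>W\<^esub> f (e i))"
      unfolding x(2) c(2)
      by (rule mod_hom_lincomb[OF ips_module[OF ips(1)] ips_module[OF ips(2)] F(1) _ c(1) e]) simp
    then show "\<exists>c\<in>{..<n} \<rightarrow> carrier R. y = (\<Oplus>\<^bsub>W\<^esub>i\<in>{..<n}. c i \<odot>\<^bsub>W\<^esub> (f \<circ> e) i)"
      using c(1) by auto
  qed (use assms(2) ec F in \<open>auto simp: orthogonal_frame_def\<close>)
  then show ?thesis by blast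
qed

lemma orthogonal_frame_rank_one_extend:
  assumes R: "cring R" and V: "inner_product_space R V" and fr: "orthogonal_frame R V n e"
    and u: "u \<in> Units R"
  shows "\<exists>e'. orthogonal_frame R (orth_sum R V (rank_one_space R u)) (Suc n) e'"
proof -
  interpret cring R by fact
  have uc: "u \<in> carrier R" using u by auto
  let ?S = "orth_sum R V (rank_one_space R u)" and ?E = "rank_one_space R u"
  have E: "inner_product_space R ?E" by (rule rank_one_ips[OF u])
  interpret V: form_space R V using ips_form_space[OF V] .
  interpret E: form_space R ?E using ips_form_space[OF E] .
  interpret S: form_space R ?S by (rule orth_sum_form_space[OF V.form_space_axioms E.form_space_axioms])
  have e: "e \<in> {..<n} \<rightarrow> carrier V" "\<And>i. i < n \<Longrightarrow> e i \<in> carrier V"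
    and unit: "\<And>i. i < n \<Longrightarrow> form V (e i) (e i) \<in> Units R"
    and orth: "\<And>i j. \<lbrakk>i < n; j < n; i \<noteq> j\<rbrakk> \<Longrightarrow> form V (e i) (e j) = \<zero>\<^bsub>R\<^esub>"
    and span: "\<And>x. x \<in> carrier V \<Longrightarrow> \<exists>c\<in>{..<n} \<rightarrow> carrier R. x = (\<Oplus>\<^bsub>V\<^esub>i\<in>{..<n}. c i \<odot>\<^bsub>V\<^esub> e i)"
    using fr unfolding orthogonal_frame_def by auto
  define d where "d = (\<lambda>i\<in>{..<1::nat}. \<one>\<^bsub>R\<^esub>)"
  have d: "d \<in> carrier ?E" by (auto simp: d_def rank_one_simps)
  have dd: "form ?E d d = u" using rank_one_form[OF uc d d] uc by (simp add: d_def)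
  define e' where "e' i = (if i < n then (e i, \<zero>\<^bsub>?E\<^esub>) else (\<zero>\<^bsub>V\<^esub>, d))" for i
  have e'n: "e' n = (\<zero>\<^bsub>V\<^esub>, d)" and e'i: "\<And>i. i < n \<Longrightarrow> e' i = (e i, \<zero>\<^bsub>?E\<^esub>)" by (simp_all add: e'_def)
  have e'c: "e' i \<in> carrier ?S" for i using e d by (auto simp: e'_def)
  have "orthogonal_frame R ?S (Suc n) e'"
    unfolding orthogonal_frame_def
  proof (intro conjI ballI allI impI)
    show "e' \<in> {..<Suc n} \<rightarrow> carrier ?S" using e'c by auto
    show "form ?S (e' i) (e' i) \<in> Units R" if "i < Suc n" for i
      using that unit e u d dd uc unfolding less_Suc_eq by (auto simp: e'n e'i Units_closed)
    show "form ?S (e' i) (e' j) = \<zero>\<^bsub>R\<^esub>" if "i < Suc n" "j < Suc n" "i \<noteq> j" for i j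
      using that orth e d unfolding less_Suc_eq by (auto simp: e'n e'i)
    fix p assume "p \<in> carrier ?S"
    then obtain x y where p: "p = (x, y)" "x \<in> carrier V" "y \<in> carrier ?E" by auto
    from span[OF p(2)] obtain c where c: "c \<in> {..<n} \<rightarrow> carrier R"
      "x = (\<Oplus>\<^bsub>V\<^esub>i\<in>{..<n}. c i \<odot>\<^bsub>V\<^esub> e i)" by blast
    have y0: "y 0 \<in> carrier R" using p(3) by (auto simp: rank_one_simps)
    let ?c = "c(n := y 0)"
    have y: "y 0 \<odot>\<^bsub>?E\<^esub> d = y"
      using p(3) y0 d by (intro rank_one_ext[of _ "carrier R"]) (auto simp: rank_one_simps d_def)
    have "(\<Oplus>\<^bsub>?S\<^esub>i\<in>{..<Suc n}. ?c i \<odot>\<^bsub>?S\<^esub> e' i) =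
        ?c n \<odot>\<^bsub>?S\<^esub> e' n \<oplus>\<^bsub>?S\<^esub> (\<Oplus>\<^bsub>?S\<^esub>i\<in>{..<n}. ?c i \<odot>\<^bsub>?S\<^esub> e' i)"
      unfolding lessThan_Suc using c(1) y0
      by (intro S.M.finsum_insert) (auto simp del: orth_sum_simps(1) intro!: S.smult_closed e'c)
    also have "(\<Oplus>\<^bsub>?S\<^esub>i\<in>{..<n}. ?c i \<odot>\<^bsub>?S\<^esub> e' i) = (\<Oplus>\<^bsub>?S\<^esub>i\<in>{..<n}. c i \<odot>\<^bsub>?S\<^esub> (e i, \<zero>\<^bsub>?E\<^esub>))"
      using c(1) e by (intro S.M.finsum_cong') (auto simp: e'i Pi_iff)
    also have "\<dots> = (x, \<zero>\<^bsub>?E\<^esub>)"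
      unfolding c(2)
      by (rule mod_hom_lincomb[OF V.module_axioms S.module_axioms orth_sum_inl_hom[OF E.module_axioms]
            _ c(1) e(1), symmetric]) simp
    also have "?c n \<odot>\<^bsub>?S\<^esub> e' n = (\<zero>\<^bsub>V\<^esub>, y)" using y y0 by (simp add: e'n)
    finally have "p = (\<Oplus>\<^bsub>?S\<^esub>i\<in>{..<Suc n}. ?c i \<odot>\<^bsub>?S\<^esub> e' i)" using p by simp
    moreover have "?c \<in> {..<Suc n} \<rightarrow> carrier R" using c(1) y0 by (auto simp: less_Suc_eq)
    ultimately show "\<exists>c\<in>{..<Suc n} \<rightarrow> carrier R. p = (\<Oplus>\<^bsub>?S\<^esub>i\<in>{..<Suc n}. c i \<odot>\<^bsub>?S\<^esub> e' i)" by blast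
  qed
  then show ?thesis by blast
qed

lemma orthogonal_frame_family:
  assumes R: "cring R" and "\<And>i. i < n \<Longrightarrow> u i \<in> Units R"
  shows "\<exists>e. orthogonal_frame R (orth_sum_family R n (\<lambda>i. rank_one_space R (u i))) n e"
  using assms(2)
proof (induction n)
  case 0
  interpret cring R by fact
  let ?F = "orth_sum_family R 0 (\<lambda>i. rank_one_space R (u i))"
  interpret F: form_space R ?F by (rule ips_form_space[OF orth_sum_family_zero_ips[OF R]])
  show ?case
    unfolding orthogonal_frame_def orth_sum_family_zero_carrier by simp
next
  case (Suc n)
  let ?V = "\<lambda>i. rank_one_space R (u i)"
  have V: "inner_product_space R (?V i)" if "i \<le> n" for i
    using that Suc.prems by (intro cring.rank_one_ips[OF R]) auto
  obtain e where e: "orthogonal_frame R (orth_sum_family R n ?V) n e"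
    using Suc.IH Suc.prems by auto
  have "inner_product_space R (orth_sum_family R n ?V)"
    using V by (intro orth_sum_family_ips R) auto
  from orthogonal_frame_rank_one_extend[OF R this e Suc.prems[of n]]
  obtain e' where "orthogonal_frame R (orth_sum R (orth_sum_family R n ?V) (?V n)) (Suc n) e'" by blast
  from orthogonal_frame_isometric[OF orth_sum_family_Suc[of R n ?V, OF R V] this] show ?case by simp
qed


section \<open>Stable diagonalisability\<close>

context local_ring
begin

lemma diagonal_mult:
  assumes "A \<in> diagonal_classes" "B \<in> diagonal_classes"
  shows "A \<otimes>\<^bsub>isometry_class_monoid R\<^esub> B \<in> diagonal_classes"
proof -
  let ?M = "isometry_class_monoid R"
  interpret M: comm_monoid ?M by (rule isometry_class_comm_monoid) (rule is_cring)
  have A: "A \<in> carrier ?M" using assms(1) by (rule diagonal_closed)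
  show ?thesis
    using assms(2)
  proof (induction B rule: diagonal_induct)
    case one
    show ?case using assms(1) A by simp
  next
    case (rank_one B v)
    have "isometry_class R (rank_one_space R v) \<in> carrier ?M"
      using rank_one.hyps by (intro isometry_class_closed rank_one_ips)
    then have "A \<otimes>\<^bsub>?M\<^esub> (B \<otimes>\<^bsub>?M\<^esub> isometry_class R (rank_one_space R v)) =
        A \<otimes>\<^bsub>?M\<^esub> B \<otimes>\<^bsub>?M\<^esub> isometry_class R (rank_one_space R v)"
      using A rank_one.hyps(1) diagonal_closed by (simp add: M.m_assoc)
    then show ?case using diagonal_mult_rank_one[OF rank_one.IH rank_one.hyps(2)] by simp
  qed
qed

lemma rank_one_diagonal:
  assumes "v \<in> Units R"
  shows "isometry_class R (rank_one_space R v) \<in> diagonal_classes"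
proof -
  let ?M = "isometry_class_monoid R"
  interpret M: comm_monoid ?M by (rule isometry_class_comm_monoid) (rule is_cring)
  have "isometry_class R (rank_one_space R v) \<in> carrier ?M"
    using assms by (intro isometry_class_closed rank_one_ips)
  then show ?thesis using diagonal_mult_rank_one[OF one_diagonal assms] by simp
qed

lemma stabilised_plane_max:
  assumes "a \<in> \<mm>" "b \<in> \<mm>"
  shows "\<ominus> \<one> \<oplus> a \<in> Units R" "\<ominus> \<one> \<oplus> b \<in> Units R" "\<one> \<ominus> a \<otimes> b \<in> Units R"
    and "isometric R
      (orth_sum R (rank_two_space R a b) (rank_one_space R (\<ominus> \<one>)))
      (orth_sum R (orth_sum R
        (rank_one_space R ((\<one> \<ominus> a \<otimes> b) \<otimes> inv ((\<ominus> \<one> \<oplus> a) \<otimes> (\<ominus> \<one> \<oplus> b))))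
        (rank_one_space R (\<ominus> \<one> \<oplus> a))) (rank_one_space R (\<ominus> \<one> \<oplus> b)))"
proof -
  have ab: "a \<in> carrier R" "b \<in> carrier R" using assms max_carrier by auto
  show U: "\<ominus> \<one> \<oplus> a \<in> Units R" "\<ominus> \<one> \<oplus> b \<in> Units R"
    using assms by (auto intro: unit_plus_max neg_one_unit)
  have "\<ominus> (a \<otimes> b) \<in> \<mm>" using assms ab by (intro max_minus I_l_closed)
  then show U': "\<one> \<ominus> a \<otimes> b \<in> Units R"
    unfolding minus_eq by (intro unit_plus_max Units_one_closed)
  show "isometric R
      (orth_sum R (rank_two_space R a b) (rank_one_space R (\<ominus> \<one>)))
      (orth_sum R (orth_sum R
        (rank_one_space R ((\<one> \<ominus> a \<otimes> b) \<otimes> inv ((\<ominus> \<one> \<oplus> a) \<otimes> (\<ominus> \<one> \<oplus> b))))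
        (rank_one_space R (\<ominus> \<one> \<oplus> a))) (rank_one_space R (\<ominus> \<one> \<oplus> b)))"
    by (intro stabilised_plane ab rank_two_ips_max assms neg_one_unit U U')
qed

text \<open>The diagonal complement accumulates one copy of <-1> for each plane.\<close>

lemma even_stably_diagonal:
  assumes "A \<in> even_classes"
  shows "\<exists>W\<in>diagonal_classes. A \<otimes>\<^bsub>isometry_class_monoid R\<^esub> W \<in> diagonal_classes"
proof -
  let ?M = "isometry_class_monoid R"
  interpret M: comm_monoid ?M by (rule isometry_class_comm_monoid) (rule is_cring)
  show ?thesis
    using assms
  proof (induction A rule: even_induct)
    case one
    show ?case using one_diagonal by (intro bexI[of _ "\<one>\<^bsub>?M\<^esub>"]) auto
  next
    case (rank_two A a b)
    from rank_two.IH obtain W where W: "W \<in> diagonal_classes" "A \<otimes>\<^bsub>?M\<^esub> W \<in> diagonal_classes" by blast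
    let ?N = "isometry_class R (rank_two_space R a b)"
    let ?H = "isometry_class R (rank_one_space R (\<ominus> \<one>))"
    note U = stabilised_plane_max(1-3)[OF rank_two.hyps(2,3)]
    have N: "inner_product_space R (rank_two_space R a b)"
      by (rule rank_two_ips_max[OF rank_two.hyps(2,3)])
    have H: "inner_product_space R (rank_one_space R (\<ominus> \<one>))" by (intro rank_one_ips neg_one_unit)
    let ?n = "(\<one> \<ominus> a \<otimes> b) \<otimes> inv ((\<ominus> \<one> \<oplus> a) \<otimes> (\<ominus> \<one> \<oplus> b))"
    have n: "?n \<in> Units R" using U by (intro Units_m_closed Units_inv_Units)
    have ips: "inner_product_space R (rank_one_space R ?n)"
      "inner_product_space R (rank_one_space R (\<ominus> \<one> \<oplus> a))"
      "inner_product_space R (rank_one_space R (\<ominus> \<one> \<oplus> b))"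
      by (intro rank_one_ips n U)+
    have "?N \<otimes>\<^bsub>?M\<^esub> ?H = isometry_class R (rank_one_space R ?n) \<otimes>\<^bsub>?M\<^esub>
        isometry_class R (rank_one_space R (\<ominus> \<one> \<oplus> a)) \<otimes>\<^bsub>?M\<^esub> isometry_class R (rank_one_space R (\<ominus> \<one> \<oplus> b))"
      unfolding isometry_class_mult[OF N H] isometry_class_mult[OF ips(1,2)]
        isometry_class_mult[OF orth_sum_ips[OF ips(1,2)] ips(3)]
      by (rule isometry_class_eqI[OF stabilised_plane_max(4)[OF rank_two.hyps(2,3)]])
    also have "\<dots> \<in> diagonal_classes" by (intro diagonal_mult rank_one_diagonal n U)
    finally have NH: "?N \<otimes>\<^bsub>?M\<^esub> ?H \<in> diagonal_classes" .
    \<comment> \<open>The new plane is paired with the new line <-1>, and \<open>A\<close> with the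
      complement already found for it.\<close>
    have "(A \<otimes>\<^bsub>?M\<^esub> ?N) \<otimes>\<^bsub>?M\<^esub> (W \<otimes>\<^bsub>?M\<^esub> ?H) = (A \<otimes>\<^bsub>?M\<^esub> W) \<otimes>\<^bsub>?M\<^esub> (?N \<otimes>\<^bsub>?M\<^esub> ?H)"
      using even_closed[OF rank_two.hyps(1)] diagonal_closed[OF W(1)] isometry_class_closed[OF N]
        isometry_class_closed[OF H] by (simp add: M.m_ac)
    also have "\<dots> \<in> diagonal_classes" by (rule diagonal_mult[OF W(2) NH])
    finally show ?case using diagonal_mult_rank_one[OF W(1) neg_one_unit] by blast
  qed
qed

text \<open>The diagonal part of the decomposition does no harm, so a complement for the even part
  works for the whole space.\<close>

lemma stably_diagonal:
  fixes V :: "('a, 'v) ips"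
  assumes V: "inner_product_space R V"
  shows "\<exists>W\<in>diagonal_classes. isometry_class R V \<otimes>\<^bsub>isometry_class_monoid R\<^esub> W \<in> diagonal_classes"
proof -
  let ?M = "isometry_class_monoid R"
  interpret M: comm_monoid ?M by (rule isometry_class_comm_monoid) (rule is_cring)
  obtain I :: "'v set" and u w where "dual_family R V I u w" using ips_dual_family[OF V] .
  from decomposition[OF V this] obtain D E where DE: "D \<in> diagonal_classes" "E \<in> even_classes"
    "isometry_class R V = D \<otimes>\<^bsub>?M\<^esub> E" by blast
  from even_stably_diagonal[OF DE(2)] obtain W where W: "W \<in> diagonal_classes"
    "E \<otimes>\<^bsub>?M\<^esub> W \<in> diagonal_classes" by blast
  have "isometry_class R V \<otimes>\<^bsub>?M\<^esub> W = D \<otimes>\<^bsub>?M\<^esub> (E \<otimes>\<^bsub>?M\<^esub> W)"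
    unfolding DE(3) using DE(1,2) W(1) diagonal_closed even_closed by (simp add: M.m_assoc)
  also have "\<dots> \<in> diagonal_classes" by (rule diagonal_mult[OF DE(1) W(2)])
  finally show ?thesis using W(1) by blast
qed

text \<open>Equality of classes yields an actual isometry whatever the carrier type of
  \<open>V\<close>, so the result also applies to an orthogonal sum on a product type.\<close>

lemma diagonal_has_orthogonal_basis:
  assumes V: "inner_product_space R V" and "isometry_class R V \<in> diagonal_classes"
  shows "has_orthogonal_basis R V"
proof -
  obtain n u where u: "\<And>i. i < n \<Longrightarrow> u i \<in> Units R"
    and eq: "isometry_class R V = isometry_class R (orth_sum_family R n (\<lambda>i. rank_one_space R (u i)))"
    using assms(2) unfolding diagonal_classes_def by blast
  have iso: "isometric R V (orth_sum_family R n (\<lambda>i. rank_one_space R (u i)))"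
    using eq unfolding isometry_class_eq_iff[OF V] .
  obtain e where "orthogonal_frame R (orth_sum_family R n (\<lambda>i. rank_one_space R (u i))) n e"
    using orthogonal_frame_family[of R n u, OF is_cring u] by blast
  from orthogonal_frame_isometric[OF isometric_sym[OF iso] this]
  obtain e' where "orthogonal_frame R V n e'" by blast
  then show ?thesis by (rule form_space.orthogonal_frame_basis[OF ips_form_space[OF V]])
qed

section \<open>Conclusions for spaces and for the Grothendieck-Witt group\<close>

lemma block_decomposition:
  fixes V :: "('a, 'v) ips"
  assumes V: "inner_product_space R V"
  shows "\<exists>(l :: nat) (r :: nat) u a b.
    (\<forall>i<l. u i \<in> Units R) \<and> (\<forall>i<r. a i \<in> \<mm> \<and> b i \<in> \<mm>) \<and>
    isometric R V (orth_sum R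
      (orth_sum_family R l (\<lambda>i. rank_one_space R (u i)))
      (orth_sum_family R r (\<lambda>i. rank_two_space R (a i) (b i))))"
proof -
  obtain I :: "'v set" and u w where "dual_family R V I u w" using ips_dual_family[OF V] .
  from decomposition[OF V this] obtain D E where DE: "D \<in> diagonal_classes" "E \<in> even_classes"
    "isometry_class R V = D \<otimes>\<^bsub>isometry_class_monoid R\<^esub> E" by blast
  obtain l u where u: "\<forall>i<l. u i \<in> Units R"
    and D: "D = isometry_class R (orth_sum_family R l (\<lambda>i. rank_one_space R (u i)))"
    using DE(1) unfolding diagonal_classes_def by blast
  obtain r a b where ab: "\<forall>i<r. a i \<in> \<mm> \<and> b i \<in> \<mm>"
    and E: "E = isometry_class R (orth_sum_family R r (\<lambda>i. rank_two_space R (a i) (b i)))"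
    using DE(2) unfolding even_classes_def by blast
  have "inner_product_space R (orth_sum_family R l (\<lambda>i. rank_one_space R (u i)))"
    using u by (intro orth_sum_family_ips is_cring rank_one_ips) auto
  moreover have "inner_product_space R (orth_sum_family R r (\<lambda>i. rank_two_space R (a i) (b i)))"
    using ab by (intro orth_sum_family_ips is_cring rank_two_ips_max) auto
  ultimately have "isometric R V (orth_sum R
      (orth_sum_family R l (\<lambda>i. rank_one_space R (u i)))
      (orth_sum_family R r (\<lambda>i. rank_two_space R (a i) (b i))))"
    using DE(3) unfolding D E by (simp add: isometry_class_mult isometry_class_eq_iff[OF V])
  with u ab show ?thesis by blast
qed

lemma stable_orthogonal_basis:
  fixes V :: "('a, 'v) ips"
  assumes V: "inner_product_space R V"
  shows "\<exists>W :: ('a, nat \<Rightarrow> 'a) ips. inner_product_space R W \<and>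
    has_orthogonal_basis R W \<and> has_orthogonal_basis R (orth_sum R V W)"
proof -
  from stably_diagonal[OF V] obtain A where A: "A \<in> diagonal_classes"
    "isometry_class R V \<otimes>\<^bsub>isometry_class_monoid R\<^esub> A \<in> diagonal_classes" by blast
  obtain W :: "('a, nat \<Rightarrow> 'a) ips" where W: "inner_product_space R W" "A = isometry_class R W"
    using isometry_class_monoidE[OF diagonal_closed[OF A(1)]] by blast
  have "has_orthogonal_basis R W" using A(1) W by (intro diagonal_has_orthogonal_basis) auto
  moreover have "has_orthogonal_basis R (orth_sum R V W)"
    using A(2) unfolding W(2) isometry_class_mult[OF V W(1)]
    by (intro diagonal_has_orthogonal_basis orth_sum_ips V W(1))
  ultimately show ?thesis using W(1) by blast
qed

lemma GW_comm_group: "comm_group (GW R)"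
  unfolding GW_def
  by (intro comm_monoid.comm_group_grothendieck_group isometry_class_comm_monoid is_cring)

text \<open>With \<open>W\<close> and the sum of \<open>V\<close> and \<open>W\<close> both
  diagonal, the class of \<open>V\<close> is the difference of two sums of classes of unit
  lines.\<close>

lemma GW_generated:
  "generate (GW R) {GW_class R (rank_one_space R u) |u. u \<in> Units R} = carrier (GW R)"
proof -
  let ?M = "isometry_class_monoid R"
  let ?S = "{GW_class R (rank_one_space R u) |u. u \<in> Units R}"
  interpret M: comm_monoid ?M by (rule isometry_class_comm_monoid) (rule is_cring)
  interpret G: comm_group "GW R" by (rule GW_comm_group)
  note cls_closed = M.grothendieck_class_closed[folded GW_def]
  note cls_mult = M.grothendieck_class_mult[folded GW_def]
  have S: "?S \<subseteq> carrier (GW R)"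
    unfolding GW_class_def by (auto intro!: cls_closed isometry_class_closed rank_one_ips)
  have diag: "grothendieck_class ?M A \<in> generate (GW R) ?S" if "A \<in> diagonal_classes" for A
    using that
  proof (induction A rule: diagonal_induct)
    case one
    show ?case using M.grothendieck_class_one generate.one[of "GW R" ?S] by (simp add: GW_def)
  next
    case (rank_one A v)
    have "isometry_class R (rank_one_space R v) \<in> carrier ?M"
      using rank_one.hyps by (intro isometry_class_closed rank_one_ips)
    moreover have "grothendieck_class ?M (isometry_class R (rank_one_space R v)) \<in> generate (GW R) ?S"
      using rank_one.hyps by (intro generate.incl) (auto simp: GW_class_def)
    ultimately show ?case
      using rank_one.IH diagonal_closed[OF rank_one.hyps(1)] by (simp add: cls_mult generate.eng)
  qed
  have cls: "grothendieck_class ?M A \<in> generate (GW R) ?S" if A: "A \<in> carrier ?M" for A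
  proof -
    obtain V :: "('a, nat \<Rightarrow> 'a) ips" where V: "inner_product_space R V" "A = isometry_class R V"
      using isometry_class_monoidE[OF A] by blast
    from stably_diagonal[OF V(1)] obtain W where W: "W \<in> diagonal_classes" "A \<otimes>\<^bsub>?M\<^esub> W \<in> diagonal_classes"
      unfolding V(2) by blast
    have c: "grothendieck_class ?M A \<in> carrier (GW R)" "grothendieck_class ?M W \<in> carrier (GW R)"
      using A diagonal_closed[OF W(1)] by (auto intro: cls_closed)
    have "grothendieck_class ?M (A \<otimes>\<^bsub>?M\<^esub> W) = grothendieck_class ?M A \<otimes>\<^bsub>GW R\<^esub> grothendieck_class ?M W"
      by (rule cls_mult[OF A diagonal_closed[OF W(1)]])
    then have "grothendieck_class ?M A =
        grothendieck_class ?M (A \<otimes>\<^bsub>?M\<^esub> W) \<otimes>\<^bsub>GW R\<^esub> inv\<^bsub>GW R\<^esub> grothendieck_class ?M W"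
      using c by (simp add: G.m_assoc)
    moreover have "\<dots> \<in> generate (GW R) ?S"
      by (intro generate.eng diag[OF W(2)] G.generate_m_inv_closed[OF S diag[OF W(1)]])
    ultimately show ?thesis by (simp only:)
  qed
  \<comment> \<open>Every element of the group is a difference of two classes of spaces, and the
    generated subgroup contains each of them.\<close>
  have "X \<in> generate (GW R) ?S" if "X \<in> carrier (GW R)" for X
  proof -
    from M.grothendieck_group_difference[folded GW_def, OF that]
    obtain A B where AB: "A \<in> carrier ?M" "B \<in> carrier ?M"
      "X = grothendieck_class ?M A \<otimes>\<^bsub>GW R\<^esub> inv\<^bsub>GW R\<^esub> grothendieck_class ?M B" by blast
    show ?thesis
      unfolding AB(3) by (intro generate.eng cls AB G.generate_m_inv_closed[OF S])
  qed
  then show ?thesis using G.generate_incl[OF S] by blast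
qed

end

theorem proposition3p1:
  fixes R :: "('a, 'm) ring_scheme" and \<mm> :: "'a set"
  assumes "local_ring R \<mm>"
  shows
    "(\<forall>V :: ('a, 'b) ips. inner_product_space R V \<longrightarrow>
        (\<exists>(l :: nat) (r :: nat) u a b.
           (\<forall>i<l. u i \<in> Units R) \<and> (\<forall>i<r. a i \<in> \<mm> \<and> b i \<in> \<mm>) \<and>
           isometric R V
             (orth_sum R
               (orth_sum_family R l (\<lambda>i. rank_one_space R (u i)))
               (orth_sum_family R r (\<lambda>i. rank_two_space R (a i) (b i))))))
     \<and> (\<forall>a \<in> \<mm>. \<forall>b \<in> \<mm>.
          isometric R
            (orth_sum R (rank_two_space R a b) (rank_one_space R (\<ominus>\<^bsub>R\<^esub> \<one>\<^bsub>R\<^esub>)))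
            (orth_sum R
              (orth_sum R
                (rank_one_space R
                  ((\<one>\<^bsub>R\<^esub> \<ominus>\<^bsub>R\<^esub> a \<otimes>\<^bsub>R\<^esub> b) \<otimes>\<^bsub>R\<^esub>
                    inv\<^bsub>R\<^esub> ((\<ominus>\<^bsub>R\<^esub> \<one>\<^bsub>R\<^esub> \<oplus>\<^bsub>R\<^esub> a) \<otimes>\<^bsub>R\<^esub> (\<ominus>\<^bsub>R\<^esub> \<one>\<^bsub>R\<^esub> \<oplus>\<^bsub>R\<^esub> b))))
                (rank_one_space R (\<ominus>\<^bsub>R\<^esub> \<one>\<^bsub>R\<^esub> \<oplus>\<^bsub>R\<^esub> a)))
              (rank_one_space R (\<ominus>\<^bsub>R\<^esub> \<one>\<^bsub>R\<^esub> \<oplus>\<^bsub>R\<^esub> b))))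
     \<and> (\<forall>V :: ('a, 'b) ips. inner_product_space R V \<longrightarrow>
          (\<exists>W :: ('a, nat \<Rightarrow> 'a) ips. inner_product_space R W \<and>
             has_orthogonal_basis R W \<and> has_orthogonal_basis R (orth_sum R V W)))
     \<and> comm_group (GW R)
     \<and> generate (GW R) {GW_class R (rank_one_space R u) |u. u \<in> Units R} = carrier (GW R)"
proof -
  interpret local_ring R \<mm> by fact
  show ?thesis
    by (intro conjI allI ballI impI block_decomposition stabilised_plane_max(4)
        stable_orthogonal_basis GW_comm_group GW_generated)
qed

end
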